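(* Let $F$ and $G$ be continuous univariate distribution functions such that the function $\log\Big(\frac{F(1-G)}{G(1-F)}\Big)$ is monotone around $\pm\infty$ and $$\int_{\mathbb{R}}\log^2\left(\frac{F(t)(1-G(t))}{G(t)(1-F(t))}\right)dF(t)<\infty.$$ Let $F_n$ be the empirical distribution function of a random sample of size $n$ from $F$. Then the statistic $$B_n=\sqrt{n}\,\big(R(F_n,G)-R(F,G)\big)$$ satisfies, as $n\to\infty$, the convergence in distribution $$B_n\rightsquigarrow\sigma'_{K(F,G)}(\mathbb{W})=\sup_{M^+(K(F,G))}\mathbb{W},\qquad\text{where }\ \mathbb{W}=\mathbb{B}_F\log\frac{F(1-G)}{G(1-F)}$$ and $\mathbb{B}_F$ is an $F$-Brownian bridge.
   Context: $K(x,y)=x\log\frac{x}{y}+(1-x)\log\frac{1-x}{1-y}$ for $x\in[0,1]$, $y\in(0,1)$ (values at $x=0$ and $x=1$ taken by continuity). $R(F_n,G)=\sup_{x\in\mathbb{R}}K(F_n(x),G(x))$ (the Berk–Jones statistic) and $R(F,G)=\sup_{x\in\mathbb{R}}K(F(x),G(x))$; $K(F,G)$ denotes the function $x\mapsto K(F(x),G(x))$. "Monotone around $\pm\infty$" means monotone on some neighbourhood of $-\infty$ and on some neighbourhood of $+\infty$. An $F$-Brownian bridge $\mathbb{B}_F$ is the (tight) weak limit of $\sqrt{n}(F_n-F)$ in $\ell^\infty(\bar{\mathbb{R}})$ (bounded real functions on $\bar{\mathbb{R}}=[-\infty,+\infty]$ with the supremum norm): $\mathbb{B}_F=\mathbb{B}\circ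 F$ with $\mathbb{B}$ a standard Brownian bridge on $[0,1]$. Functions on $\mathbb{R}$ are regarded as functions on $\bar{\mathbb{R}}$ via their limits at $\pm\infty$. $\sigma(f)=\sup f$ for $f\in\ell^\infty(\bar{\mathbb{R}})$, and $\sigma'_f$ is its Hadamard directional derivative at $f$, that is, $\sigma'_f(g)=\lim_{\epsilon\downarrow0}\sup\{g(x):f(x)\ge\sup f-\epsilon\}$; $M^+(h)=\{x\in\bar{\mathbb{R}}:h(x)=\sup h\}$. *)

theory Defs
  imports "HOL-Probability.Probability"
begin

text \<open>
  With \<open>0 * ln z = 0\<close> the formula yields the values by continuity at \<open>x = 0\<close> and \<open>x = 1\<close> for
  \<open>0 < y < 1\<close>, and also the usual convention \<open>K(0,0) = K(1,1) = 0\<close>.  At the remaining points with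
  \<open>y \<in> {0, 1}\<close>, where the divergence is infinite, the value carries no meaning.  If the integral of
  \<open>log_ratio_sq (F t) (G t)\<close> against \<open>dF\<close> (see below) is finite, then \<open>(F x, G x)\<close> is never such a
  point, and almost surely no \<open>(F\<^sub>n x, G x)\<close> is.
\<close>
definition bern_KL :: "real \<Rightarrow> real \<Rightarrow> real" where
  "bern_KL x y = x * ln (x / y) + (1 - x) * ln ((1 - x) / (1 - y))"

definition berk_jones :: "(real \<Rightarrow> real) \<Rightarrow> (real \<Rightarrow> real) \<Rightarrow> real" where
  "berk_jones F G = (SUP x. bern_KL (F x) (G x))"

text \<open>
  Where \<open>u\<close> or \<open>v\<close> is 0 or 1 the logarithm is infinite or undefined, and \<open>log_ratio u v = 0\<close> since
  \<open>z / 0 = 0\<close> and \<open>ln 0 = 0\<close>.  For \<open>u \<in> {0, 1}\<close> this gives the convention \<open>0 \<cdot> (\<plusminus>\<infinity>) = 0\<close> in the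
  product with an \<open>F\<close>-Brownian bridge, which vanishes there almost surely.  Monotonicity near
  \<open>\<plusminus>\<infinity>\<close> is not affected: if \<open>F\<close> is eventually 0 or 1, so that the true logarithm is
  eventually constant or undefined, then \<open>log_ratio\<close> is eventually constant as well.
\<close>
definition log_ratio :: "real \<Rightarrow> real \<Rightarrow> real" where
  "log_ratio u v = ln (u * (1 - v) / (v * (1 - u)))"

text \<open>
  The squared logarithm with its infinite values restored.  For continuous \<open>F\<close>, the points where
  \<open>F t \<in> {0, 1}\<close> form a null set of the measure \<open>dF\<close>, so only \<open>G t \<in> {0, 1}\<close> can make the
  integral infinite through the second branch.
\<close>
definition log_ratio_sq :: "real \<Rightarrow> real \<Rightarrow> ennreal" where
  "log_ratio_sq u v =
     (if 0 < u \<and> u < 1 \<and> 0 < v \<and> v < 1 then ennreal ((log_ratio u v)\<^sup>2) else \<infinity>)"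

text \<open>The sense of monotonicity may differ at the two ends.\<close>
definition monotone_around_infinities :: "(real \<Rightarrow> real) \<Rightarrow> bool" where
  "monotone_around_infinities h \<longleftrightarrow>
     (\<exists>c. mono_on {..<c} h \<or> antimono_on {..<c} h) \<and>
     (\<exists>c. mono_on {c<..} h \<or> antimono_on {c<..} h)"

definition empirical_cdf :: "(nat \<Rightarrow> 'a \<Rightarrow> real) \<Rightarrow> nat \<Rightarrow> 'a \<Rightarrow> real \<Rightarrow> real" where
  "empirical_cdf X n \<omega> x = real (card {i. i < n \<and> X i \<omega> \<le> x}) / real n"

definition centered_normal :: "real \<Rightarrow> real measure" where
  "centered_normal v =
     (if v = 0 then return borel 0 else density lborel (normal_density 0 (sqrt v)))"

text \<open>
  Joint normality is expressed through all finite linear combinations.  Continuity is required of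
  every sample path, so that suprema over the process are measurable without completing \<open>N\<close>.
\<close>
definition brownian_bridge :: "'b measure \<Rightarrow> (real \<Rightarrow> 'b \<Rightarrow> real) \<Rightarrow> bool" where
  "brownian_bridge N B \<longleftrightarrow>
     prob_space N \<and>
     (\<forall>t\<in>{0..1}. B t \<in> borel_measurable N) \<and>
     (\<forall>\<omega>\<in>space N. continuous_on {0..1} (\<lambda>t. B t \<omega>)) \<and>
     (\<forall>I c. finite I \<and> I \<subseteq> {0..1} \<longrightarrow>
        distr N borel (\<lambda>\<omega>. \<Sum>t\<in>I. c t * B t \<omega>) =
        centered_normal (\<Sum>s\<in>I. \<Sum>t\<in>I. c s * c t * (min s t - s * t)))"

definition F_brownian_bridge ::
    "'b measure \<Rightarrow> (real \<Rightarrow> real) \<Rightarrow> (real \<Rightarrow> 'b \<Rightarrow> real) \<Rightarrow> bool" where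
  "F_brownian_bridge N F Z \<longleftrightarrow>
     (\<exists>B. brownian_bridge N B \<and> (\<forall>\<omega>\<in>space N. \<forall>x. Z x \<omega> = B (F x) \<omega>))"

text \<open>A function on the real line as a function on \<open>[-\<infinity>, \<infinity>]\<close>, via its limits.\<close>
definition extend :: "(real \<Rightarrow> real) \<Rightarrow> ereal \<Rightarrow> real" where
  "extend f x = (case x of ereal r \<Rightarrow> f r | PInfty \<Rightarrow> Lim at_top f | MInfty \<Rightarrow> Lim at_bot f)"

text \<open>
  The supremum functional \<open>\<sigma>\<close> on bounded functions, its Hadamard directional derivative
  \<open>\<sigma>'\<^sub>f(g)\<close>, and the set \<open>M\<^sup>+(f)\<close>.
\<close>
definition sup_fun :: "(ereal \<Rightarrow> real) \<Rightarrow> real" where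
  "sup_fun f = (SUP x. f x)"

definition sup_fun_deriv :: "(ereal \<Rightarrow> real) \<Rightarrow> (ereal \<Rightarrow> real) \<Rightarrow> real" where
  "sup_fun_deriv f g = Lim (at_right 0) (\<lambda>\<epsilon>. SUP x\<in>{x. f x \<ge> sup_fun f - \<epsilon>}. g x)"

definition max_set :: "(ereal \<Rightarrow> real) \<Rightarrow> ereal set" where
  "max_set f = {x. f x = sup_fun f}"

end

theory Submission
  imports Defs "HOL-Real_Asymp.Real_Asymp"
begin

text \<open>
  The divergence satisfies the Bregman identity \<open>K(p,g) = K(f,g) + (p - f) log (f(1-g) / (g(1-f))) + K(p,f)\<close>.
  With \<open>p = F\<^sub>n\<close>, \<open>f = F\<close>, \<open>g = G\<close>, the last term is the Berk-Jones statistic under the null hypothesis, which is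
  of smaller order than \<open>1 / \<surd>n\<close> in probability, so that \<open>\<surd>n (K(F\<^sub>n,G) - K(F,G))\<close> is uniformly close to the weighted
  empirical process \<open>L \<surd>n (F\<^sub>n - F)\<close>, where \<open>L\<close> is the log-ratio.

  The weight \<open>L\<close> is unbounded. Since \<open>G\<close> is increasing, \<open>L\<close> increases at most as fast as the logit of
  \<open>F\<close>; hence on each dyadic block \<open>2\<^sup>-\<^sup>k\<^sup>-\<^sup>1 < F \<le> 2\<^sup>-\<^sup>k\<close> it is bounded by some \<open>w\<^sub>k\<close>, and square
  integrability gives \<open>\<Sum> w\<^sub>k\<^sup>2 2\<^sup>-\<^sup>k < \<infinity>\<close>. A Doob-type maximal inequality bounds the probability that the
  empirical process exceeds \<open>\<lambda> / w\<^sub>k\<close> on the block by a multiple of \<open>w\<^sub>k\<^sup>2 2\<^sup>-\<^sup>k / \<lambda>\<^sup>2\<close>, so the weighted process is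
  uniformly negligible near the ends of the support; fourth moments give equicontinuity in between. These bounds
  pass to the Brownian bridge through the finite-dimensional distributions.

  The limit is then identified by comparing upper tails: the statistic dominates the weighted process on
  \<open>M\<^sup>+\<close>, and it is dominated, up to a small error, by a supremum of finitely many coordinates over the set
  where \<open>K(F,G) \<ge> sup - \<epsilon>\<close>.
\<close>

section \<open>The maximal inequality for counts of increasing sets\<close>

text \<open>Convergence in the space of bounded functions is never stated. Every event is squeezed
  between two levels of a bounded Lipschitz function of finitely many coordinates; for those the
  one-dimensional central limit theorem and Stone-Weierstrass suffice. The martingale behind the
  maximal inequality is the classical \<open>(F\<^sub>n(t) - t) / (1 - t)\<close>. Its second
  moments give a probability of order \<open>h / a^2\<close> on \<open>[0, h]\<close>, which is just
  what the summability of \<open>w_k^2 2^-k\<close> absorbs. In the middle a union over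
  \<open>N\<close> cells of length \<open>1/N\<close> would leave second moments with a constant,
  whereas fourth moments leave a bound of order \<open>1/N\<close>. Two further obstacles shape the
  last part. A real supremum of an unbounded set is a default value, so boundedness of the statistic
  is itself an event of large probability. And maximisers of the divergence may lie at
  \<open>-\<infinity>\<close>, at \<open>\<infinity>\<close> or where \<open>F\<close> is 0 or 1;
  there the limit process is 0, and these points are compared separately, at negative levels
  only.\<close>

lemma (in prob_space) indep_expectation_indicator:
  fixes U :: "'i \<Rightarrow> 'a \<Rightarrow> real"
  assumes ind: "indep_vars (\<lambda>_. borel) U UNIV" and "i \<notin> I"
    and h: "h \<in> borel_measurable (PiM I (\<lambda>_. borel))" and D: "D \<in> sets borel"
    and int: "integrable M (\<lambda>\<omega>. h (restrict (\<lambda>l. U l \<omega>) I))"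
  shows "expectation (\<lambda>\<omega>. h (restrict (\<lambda>l. U l \<omega>) I) * indicator D (U i \<omega>)) =
    expectation (\<lambda>\<omega>. h (restrict (\<lambda>l. U l \<omega>) I)) * prob {\<omega> \<in> space M. U i \<omega> \<in> D}"
proof -
  have rv: "U i \<in> borel_measurable M" using ind by (auto simp: indep_vars_def)
  have "indep_var borel (h \<circ> (\<lambda>\<omega>. restrict (\<lambda>l. U l \<omega>) I))
    borel ((\<lambda>f. indicator D (f i) :: real) \<circ> (\<lambda>\<omega>. restrict (\<lambda>l. U l \<omega>) {i}))"
    using assms by (intro indep_var_compose[OF indep_var_restrict[OF ind]]) auto
  then have iv: "indep_var borel (\<lambda>\<omega>. h (restrict (\<lambda>l. U l \<omega>) I)) borel (\<lambda>\<omega>. indicator D (U i \<omega>) :: real)"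
    by (simp add: comp_def)
  have i2: "integrable M (\<lambda>\<omega>. indicator D (U i \<omega>) :: real)"
    using rv D by (intro integrable_const_bound[where B=1]) auto
  have "(\<lambda>\<omega>. indicator D (U i \<omega>) :: real) = indicator (U i -` D)"
    by (auto simp: indicator_def)
  then have "expectation (\<lambda>\<omega>. indicator D (U i \<omega>) :: real) = prob {\<omega> \<in> space M. U i \<omega> \<in> D}"
    using rv D by (auto intro!: arg_cong[where f=prob])
  then show ?thesis
    using indep_var_lebesgue_integral[OF iv int i2] by simp
qed

text \<open>
  For an increasing chain of sets the compensated counts \<open>S k\<close> form a martingale: given
  \<open>U i \<notin> C j\<close>, the contribution of \<open>U i\<close> to \<open>S 0, \<dots>, S j\<close> is deterministic.
\<close>
lemma (in prob_space) chain_count_orthogonal: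
  fixes U :: "nat \<Rightarrow> 'a \<Rightarrow> real" and C :: "nat \<Rightarrow> real set" and c :: "nat \<Rightarrow> real" and n :: nat
    and G :: "(nat \<Rightarrow> real) \<Rightarrow> real"
  defines "\<xi> k u \<equiv> 1 - indicator (- C k) u / (1 - c k)"
  defines "S k \<omega> \<equiv> (\<Sum>i<n. \<xi> k (U i \<omega>))"
  assumes ind: "indep_vars (\<lambda>_. borel) U UNIV"
    and C: "\<And>k. C k \<in> sets borel" and mono: "\<And>k l. k \<le> l \<Longrightarrow> C k \<subseteq> C l"
    and c: "\<And>i k. prob {\<omega> \<in> space M. U i \<omega> \<in> C k} = c k" and c1: "\<And>k. c k < 1"
    and G: "G \<in> borel_measurable (PiM UNIV (\<lambda>_. borel))"
    and loc: "\<And>s s'. (\<And>k. k \<le> j \<Longrightarrow> s k = s' k) \<Longrightarrow> G s = G s'"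
    and bdd: "\<And>s :: nat \<Rightarrow> real. (\<And>k. \<bar>s k - real n\<bar> \<le> n / (1 - c k)) \<Longrightarrow> \<bar>G s\<bar> \<le> b"
    and "j \<le> m"
  shows "expectation (\<lambda>\<omega>. G (\<lambda>k. S k \<omega>) * (S m \<omega> - S j \<omega>)) = 0"
proof -
  have U[measurable]: "U i \<in> borel_measurable M" for i using ind by (auto simp: indep_vars_def)
  note C[measurable] G[measurable]
  have xm[measurable]: "\<xi> k \<in> borel_measurable borel" for k unfolding \<xi>_def by measurable
  \<comment> \<open>\<open>h i\<close> is \<open>G\<close> computed as if \<open>U i\<close> lay
    outside \<open>C 0, ..., C j\<close>, where its term is the constant
    \<open>1 - 1 / (1 - c k)\<close>. It depends on the other observations only.\<close>
  define h where "h i f = G (\<lambda>k. (\<Sum>l\<in>{..<n}-{i}. \<xi> k (f l)) + (1 - 1 / (1 - c k)))" for i f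
  have hm: "h i \<in> borel_measurable (PiM ({..<n}-{i}) (\<lambda>_. borel))" for i
    unfolding h_def by (rule measurable_compose[OF _ G]) (auto intro!: measurable_PiM_single' simp: space_PiM)
  have Sm[measurable]: "S k \<in> borel_measurable M" for k unfolding S_def by measurable
  have GSm[measurable]: "(\<lambda>\<omega>. G (\<lambda>k. S k \<omega>)) \<in> borel_measurable M"
    by (rule measurable_compose[OF _ G]) (auto intro!: measurable_PiM_single' simp: space_PiM)
  have x1: "\<bar>\<xi> k u - 1\<bar> \<le> 1 / (1 - c k)" for k u
    using c1[of k] by (auto simp: \<xi>_def indicator_def)
  \<comment> \<open>Boundedness of \<open>G\<close> is required only on the range that the sums can
    reach, because the derivatives \<open>2 x\<close> and \<open>4 x^3\<close> inserted later are
    unbounded.\<close>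
  have sb: "\<bar>(\<Sum>l\<in>A. \<xi> k (f l)) - card A\<bar> \<le> card A / (1 - c k)" for A :: "nat set" and k f
  proof -
    have "\<bar>(\<Sum>l\<in>A. \<xi> k (f l) - 1)\<bar> \<le> (\<Sum>l\<in>A. 1 / (1 - c k))"
      by (rule order_trans[OF sum_abs sum_mono]) (rule x1)
    then show ?thesis by (simp add: sum_subtractf)
  qed
  have hb: "\<bar>h i f\<bar> \<le> b" if "i < n" for i f
  proof -
    have "\<bar>(\<Sum>l\<in>{..<n}-{i}. \<xi> k (f l)) + (1 - 1 / (1 - c k)) - n\<bar> \<le> n / (1 - c k)" for k
    proof -
    have cd: "card ({..<n}-{i}) = n - 1" using that by simp
    have "\<bar>(\<Sum>l\<in>{..<n}-{i}. \<xi> k (f l)) + (1 - 1 / (1 - c k)) - n\<bar> =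
      \<bar>((\<Sum>l\<in>{..<n}-{i}. \<xi> k (f l)) - card ({..<n}-{i})) - 1 / (1 - c k)\<bar>"
      unfolding cd using that by (simp add: of_nat_diff)
    also have "\<dots> \<le> card ({..<n}-{i}) / (1 - c k) + 1 / (1 - c k)"
    proof -
      have "\<bar>(\<Sum>l\<in>{..<n}-{i}. \<xi> k (f l)) - card ({..<n}-{i})\<bar> \<le> card ({..<n}-{i}) / (1 - c k)" by (rule sb)
      moreover have "1 / (1 - c k) \<ge> 0" using c1[of k] by simp
      ultimately show ?thesis by linarith
    qed
    also have "\<dots> = n / (1 - c k)" unfolding cd using that by (simp add: of_nat_diff add_divide_distrib[symmetric])
    finally show ?thesis .
    qed
    from bdd[OF this] show ?thesis by (simp add: h_def)
  qed
  have GSb: "\<bar>G (\<lambda>k. S k \<omega>)\<bar> \<le> b" for \<omega>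
  proof -
    have "\<bar>S k \<omega> - n\<bar> \<le> n / (1 - c k)" for k
      using sb[of k "\<lambda>i. U i \<omega>" "{..<n}"] unfolding S_def by simp
    from bdd[OF this] show ?thesis .
  qed
  \<comment> \<open>The right-hand side does not involve \<open>p\<close>; this is the martingale
    property. The instances \<open>p = j\<close> and \<open>p = m\<close> then cancel term by
    term.\<close>
  have key: "expectation (\<lambda>\<omega>. G (\<lambda>k. S k \<omega>) * indicator (- C p) (U i \<omega>)) / (1 - c p) =
      expectation (\<lambda>\<omega>. h i (restrict (\<lambda>l. U l \<omega>) ({..<n}-{i})))" if "i < n" "j \<le> p" for i p
  proof -
    let ?h = "\<lambda>\<omega>. h i (restrict (\<lambda>l. U l \<omega>) ({..<n}-{i}))"
    have hmm[measurable]: "?h \<in> borel_measurable M"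
      by (rule measurable_compose[OF _ hm]) (auto intro!: measurable_restrict)
    have int: "integrable M ?h"
      using hb[OF that(1)] by (intro integrable_const_bound[where B=b]) auto
    have "G (\<lambda>k. S k \<omega>) = ?h \<omega>" if "U i \<omega> \<notin> C p" for \<omega>
      unfolding h_def
    proof (rule loc)
      fix k assume "k \<le> j"
      then have "U i \<omega> \<notin> C k" using that \<open>j \<le> p\<close> mono[of k p] by auto
      then have "\<xi> k (U i \<omega>) = 1 - 1 / (1 - c k)" by (simp add: \<xi>_def)
      then show "S k \<omega> = (\<Sum>l\<in>{..<n} - {i}. \<xi> k (restrict (\<lambda>l. U l \<omega>) ({..<n} - {i}) l)) + (1 - 1 / (1 - c k))"
        unfolding S_def using \<open>i < n\<close> by (subst sum.remove[of _ i]) (auto intro!: sum.cong)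
    qed
    then have eq: "(\<lambda>\<omega>. G (\<lambda>k. S k \<omega>) * indicator (- C p) (U i \<omega>)) = (\<lambda>\<omega>. ?h \<omega> * indicator (- C p) (U i \<omega>))"
      by (auto simp: fun_eq_iff indicator_def)
    have pc: "prob {\<omega> \<in> space M. U i \<omega> \<in> - C p} = 1 - c p"
      using prob_neg[of "\<lambda>\<omega>. U i \<omega> \<in> C p"] c[of i p] by simp
    show ?thesis
      unfolding eq
      by (subst indep_expectation_indicator[OF ind _ hm _ int]) (use c1[of p] pc in auto)
  qed
  have I: "integrable M (\<lambda>\<omega>. G (\<lambda>k. S k \<omega>) * indicator (- C p) (U i \<omega>))" for i p
    using order_trans[OF GSb abs_ge_self] by (intro integrable_const_bound[where B="\<bar>b\<bar>"]) (auto simp: indicator_def)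
  have "(\<lambda>\<omega>. G (\<lambda>k. S k \<omega>) * (S m \<omega> - S j \<omega>)) =
    (\<lambda>\<omega>. \<Sum>i<n. G (\<lambda>k. S k \<omega>) * indicator (- C j) (U i \<omega>) / (1 - c j)
       - G (\<lambda>k. S k \<omega>) * indicator (- C m) (U i \<omega>) / (1 - c m))"
    unfolding S_def[of m] S_def[of j] sum_subtractf[symmetric] sum_distrib_left \<xi>_def
    by (intro ext sum.cong refl) (simp add: algebra_simps)
  then have "expectation (\<lambda>\<omega>. G (\<lambda>k. S k \<omega>) * (S m \<omega> - S j \<omega>)) =
    (\<Sum>i<n. expectation (\<lambda>\<omega>. G (\<lambda>k. S k \<omega>) * indicator (- C j) (U i \<omega>)) / (1 - c j)
       - expectation (\<lambda>\<omega>. G (\<lambda>k. S k \<omega>) * indicator (- C m) (U i \<omega>)) / (1 - c m))"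
    using I by (simp add: Bochner_Integration.integral_sum Bochner_Integration.integral_diff)
  also have "\<dots> = 0"
    by (rule sum.neutral) (use key \<open>j \<le> m\<close> in auto)
  finally show ?thesis .
qed


text \<open>Doob's argument for a convex \<open>\<phi>\<close>: split by the first index
  \<open>j\<close> with \<open>a \<le> \<bar>S j\<bar>\<close> and use the tangent of
  \<open>\<phi>\<close> at \<open>S j\<close>. Its linear term is a function of the past times an
  increment and integrates to 0 by \<open>chain_count_orthogonal\<close>.\<close>

lemma (in prob_space) chain_count_maximal:
  fixes U :: "nat \<Rightarrow> 'a \<Rightarrow> real" and C :: "nat \<Rightarrow> real set" and c :: "nat \<Rightarrow> real" and n :: nat
    and \<phi> \<phi>' :: "real \<Rightarrow> real"
  defines "S k \<omega> \<equiv> (\<Sum>i<n. 1 - indicator (- C k) (U i \<omega>) / (1 - c k))"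
  assumes ind: "indep_vars (\<lambda>_. borel) U UNIV"
    and C: "\<And>k. C k \<in> sets borel" and mono: "\<And>k l. k \<le> l \<Longrightarrow> C k \<subseteq> C l"
    and c: "\<And>i k. prob {\<omega> \<in> space M. U i \<omega> \<in> C k} = c k" and c1: "\<And>k. c k < 1"
    and cont: "continuous_on UNIV \<phi>" "continuous_on UNIV \<phi>'"
    and tangent: "\<And>x y. \<phi> y \<ge> \<phi> x + \<phi>' x * (y - x)"
    and ge: "\<And>x. a \<le> \<bar>x\<bar> \<Longrightarrow> \<phi> a \<le> \<phi> x" and nonneg: "\<And>x. \<phi> x \<ge> 0"
  shows "\<phi> a * prob {\<omega> \<in> space M. \<exists>k\<le>m. a \<le> \<bar>S k \<omega>\<bar>} \<le> expectation (\<lambda>\<omega>. \<phi> (S m \<omega>))"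
proof -
  have U[measurable]: "U i \<in> borel_measurable M" for i using ind by (auto simp: indep_vars_def)
  note C[measurable]
  have [measurable]: "\<phi> \<in> borel_measurable borel" "\<phi>' \<in> borel_measurable borel"
    using cont by (auto intro: borel_measurable_continuous_onI)
  have Sm[measurable]: "S k \<in> borel_measurable M" for k unfolding S_def by measurable
  have Sb: "\<bar>S k \<omega>\<bar> \<le> real n * (1 + 1 / (1 - c k))" for k \<omega>
  proof -
    have "\<bar>S k \<omega>\<bar> \<le> (\<Sum>i<n. 1 + 1 / (1 - c k))"
    proof (unfold S_def, intro order_trans[OF sum_abs sum_mono])
      fix i
      have "1 / (1 - c k) \<ge> 0" using c1[of k] by simp
      then show "\<bar>1 - indicator (- C k) (U i \<omega>) / (1 - c k)\<bar> \<le> 1 + 1 / (1 - c k)"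
        by (auto simp: indicator_def simp del: zero_le_divide_1_iff)
    qed
    then show ?thesis by simp
  qed
  have bnd: "\<exists>b. \<forall>x. \<bar>x\<bar> \<le> r \<longrightarrow> \<bar>f x\<bar> \<le> b" if "continuous_on UNIV f" for f :: "real \<Rightarrow> real" and r
  proof -
    have "compact (f ` {-r..r})" using that continuous_on_subset by (intro compact_continuous_image) blast+
    then obtain b where "\<forall>y\<in>f ` {-r..r}. norm y \<le> b" using compact_imp_bounded bounded_iff by metis
    then show ?thesis by (intro exI[of _ b]) (auto simp: abs_le_iff)
  qed
  have int\<phi>: "integrable M (\<lambda>\<omega>. f (S k \<omega>))" if "continuous_on UNIV f" for f :: "real \<Rightarrow> real" and k
  proof -
    obtain b where b: "\<And>x. \<bar>x\<bar> \<le> real n * (1 + 1 / (1 - c k)) \<Longrightarrow> \<bar>f x\<bar> \<le> b" using bnd[OF \<open>continuous_on UNIV f\<close>] by blast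
    show ?thesis
      using b[OF Sb] borel_measurable_continuous_onI[OF that] by (intro integrable_const_bound[where B=b]) auto
  qed
  define A where "A j = {\<omega> \<in> space M. a \<le> \<bar>S j \<omega>\<bar> \<and> (\<forall>k<j. \<bar>S k \<omega>\<bar> < a)}" for j
  have Am[measurable]: "A j \<in> sets M" for j unfolding A_def by measurable
  have dis: "disjoint_family_on A {..m}"
    unfolding disjoint_family_on_def
  proof (intro ballI impI)
    fix j k :: nat assume jk: "j \<noteq> k"
    have "False" if "\<omega> \<in> A j" "\<omega> \<in> A k" for \<omega>
      using that jk unfolding A_def mem_Collect_eq by (metis linorder_neqE_nat not_le)
    then show "A j \<inter> A k = {}" by blast
  qed
  have un: "{\<omega> \<in> space M. \<exists>k\<le>m. a \<le> \<bar>S k \<omega>\<bar>} = (\<Union>j\<le>m. A j)"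
  proof (intro equalityI subsetI)
    fix \<omega> assume "\<omega> \<in> {\<omega> \<in> space M. \<exists>k\<le>m. a \<le> \<bar>S k \<omega>\<bar>}"
    then obtain k where k: "\<omega> \<in> space M" "k \<le> m" "a \<le> \<bar>S k \<omega>\<bar>" by auto
    define j where "j = (LEAST j. a \<le> \<bar>S j \<omega>\<bar>)"
    have "j \<le> m" using Least_le[of "\<lambda>j. a \<le> \<bar>S j \<omega>\<bar>", OF k(3)] k(2) by (simp add: j_def)
    moreover have "a \<le> \<bar>S j \<omega>\<bar>" unfolding j_def by (rule LeastI[of _ k]) (rule k(3))
    moreover have "\<bar>S l \<omega>\<bar> < a" if "l < j" for l
      using not_less_Least[OF that[unfolded j_def]] by linarith
    ultimately have "j \<le> m" "\<omega> \<in> A j" using k(1) by (auto simp: A_def)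
    then show "\<omega> \<in> (\<Union>j\<le>m. A j)" by auto
  next
    fix \<omega> assume "\<omega> \<in> (\<Union>j\<le>m. A j)"
    then show "\<omega> \<in> {\<omega> \<in> space M. \<exists>k\<le>m. a \<le> \<bar>S k \<omega>\<bar>}" unfolding A_def by blast
  qed
  have intA: "integrable M (\<lambda>\<omega>. indicator (A j) \<omega> * \<phi> (S m \<omega>))" for j
    using integrable_real_mult_indicator[OF Am int\<phi>[OF cont(1)]] by (simp add: mult.commute)
  have "\<phi> a * prob {\<omega> \<in> space M. \<exists>k\<le>m. a \<le> \<bar>S k \<omega>\<bar>} = (\<Sum>j\<le>m. expectation (\<lambda>\<omega>. indicator (A j) \<omega> * \<phi> a))"
  proof -
    have "prob (\<Union>j\<le>m. A j) = (\<Sum>j\<le>m. prob (A j))"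
      by (rule finite_measure_finite_Union[OF _ _ dis]) auto
    then show ?thesis unfolding un by (simp add: sum_distrib_left mult.commute)
  qed
  also have "\<dots> \<le> (\<Sum>j\<le>m. expectation (\<lambda>\<omega>. indicator (A j) \<omega> * \<phi> (S m \<omega>)))"
  proof (rule sum_mono)
    fix j assume j: "j \<in> {..m}"
    \<comment> \<open>The path functional that equals \<open>\<phi>' (S j)\<close> on
      \<open>A j\<close> and 0 elsewhere. It reads only the coordinates up to \<open>j\<close>, as
      orthogonality demands.\<close>
    define G where "G s = (if a \<le> \<bar>s j\<bar> \<and> (\<forall>k<j. \<bar>s k\<bar> < a) then \<phi>' (s j) else 0)" for s :: "nat \<Rightarrow> real"
    obtain b where b: "\<And>x. \<bar>x\<bar> \<le> real n + real n / (1 - c j) \<Longrightarrow> \<bar>\<phi>' x\<bar> \<le> b" using bnd[OF cont(2)] by blast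
    have "0 \<le> \<bar>\<phi>' (real n)\<bar>" by simp
    also have "\<dots> \<le> b" by (rule b) (use c1[of j] in simp)
    finally have b0: "0 \<le> b" .
    have o: "expectation (\<lambda>\<omega>. G (\<lambda>k. S k \<omega>) * (S m \<omega> - S j \<omega>)) = 0"
      unfolding S_def
    proof (rule chain_count_orthogonal[OF ind C mono c c1, where b=b])
      show "G \<in> borel_measurable (PiM UNIV (\<lambda>_. borel))"
        unfolding G_def by measurable
      show "G s = G s'" if "\<And>k. k \<le> j \<Longrightarrow> s k = s' k" for s s'
        using that unfolding G_def by auto
      show "\<bar>G s\<bar> \<le> b" if "\<And>k. \<bar>s k - real n\<bar> \<le> real n / (1 - c k)" for s
        unfolding G_def using b[of "s j"] that[of j] b0 by auto
    qed (use j in auto)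
    have GA: "G (\<lambda>k. S k \<omega>) = indicator (A j) \<omega> * \<phi>' (S j \<omega>)" if "\<omega> \<in> space M" for \<omega>
      using that unfolding G_def A_def by (auto simp: indicator_def)
    have o': "expectation (\<lambda>\<omega>. indicator (A j) \<omega> * \<phi>' (S j \<omega>) * (S m \<omega> - S j \<omega>)) = 0"
      unfolding o[symmetric] by (intro Bochner_Integration.integral_cong) (auto simp: GA)
    obtain b2 where b2: "\<And>x. \<bar>x\<bar> \<le> real n * (1 + 1 / (1 - c j)) \<Longrightarrow> \<bar>\<phi>' x\<bar> \<le> b2" using bnd[OF cont(2)] by blast
    have i0: "integrable M (\<lambda>\<omega>. indicator (A j) \<omega> * \<phi>' (S j \<omega>) * (S m \<omega> - S j \<omega>))"
    proof (rule integrable_const_bound[where B="b2 * (real n * (1 + 1 / (1 - c m)) + real n * (1 + 1 / (1 - c j)))"], rule AE_I2)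
      fix \<omega>
      have "norm (indicator (A j) \<omega> * \<phi>' (S j \<omega>) * (S m \<omega> - S j \<omega>)) = indicator (A j) \<omega> * (\<bar>\<phi>' (S j \<omega>)\<bar> * \<bar>S m \<omega> - S j \<omega>\<bar>)"
        by (simp add: abs_mult)
      also have "\<dots> \<le> \<bar>\<phi>' (S j \<omega>)\<bar> * \<bar>S m \<omega> - S j \<omega>\<bar>" by (simp add: indicator_def)
      also have "\<dots> \<le> b2 * (real n * (1 + 1 / (1 - c m)) + real n * (1 + 1 / (1 - c j)))"
        using b2[OF Sb[of j \<omega>]] Sb[of j \<omega>] Sb[of m \<omega>] by (intro mult_mono) linarith+
      finally show "norm (indicator (A j) \<omega> * \<phi>' (S j \<omega>) * (S m \<omega> - S j \<omega>)) \<le> b2 * (real n * (1 + 1 / (1 - c m)) + real n * (1 + 1 / (1 - c j)))" .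
    qed measurable
    have "expectation (\<lambda>\<omega>. indicator (A j) \<omega> * \<phi> a) \<le>
        expectation (\<lambda>\<omega>. indicator (A j) \<omega> * \<phi> (S m \<omega>) - indicator (A j) \<omega> * \<phi>' (S j \<omega>) * (S m \<omega> - S j \<omega>))"
    proof (rule integral_mono)
      show "integrable M (\<lambda>\<omega>. indicat_real (A j) \<omega> * \<phi> a)" by (intro integrable_mult_left integrable_const_bound[where B=1]) auto
      show "integrable M (\<lambda>\<omega>. indicator (A j) \<omega> * \<phi> (S m \<omega>) - indicator (A j) \<omega> * \<phi>' (S j \<omega>) * (S m \<omega> - S j \<omega>))"
        by (rule Bochner_Integration.integrable_diff[OF intA i0])
      show "indicator (A j) \<omega> * \<phi> a \<le> indicator (A j) \<omega> * \<phi> (S m \<omega>) - indicator (A j) \<omega> * \<phi>' (S j \<omega>) * (S m \<omega> - S j \<omega>)" for \<omega>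
        using tangent[of "S j \<omega>" "S m \<omega>"] ge[of "S j \<omega>"] by (auto simp: indicator_def A_def)
    qed
    also have "\<dots> = expectation (\<lambda>\<omega>. indicator (A j) \<omega> * \<phi> (S m \<omega>))"
      unfolding Bochner_Integration.integral_diff[OF intA i0] o' by simp
    finally show "expectation (\<lambda>\<omega>. indicator (A j) \<omega> * \<phi> a) \<le> expectation (\<lambda>\<omega>. indicator (A j) \<omega> * \<phi> (S m \<omega>))" .
  qed
  also have "\<dots> = expectation (\<lambda>\<omega>. indicator (\<Union>j\<le>m. A j) \<omega> * \<phi> (S m \<omega>))"
  proof -
    have "(\<lambda>\<omega>. indicator (\<Union>j\<le>m. A j) \<omega> * \<phi> (S m \<omega>)) = (\<lambda>\<omega>. \<Sum>j\<le>m. indicator (A j) \<omega> * \<phi> (S m \<omega>))"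
      by (simp add: indicator_UN_disjoint[OF _ dis] sum_distrib_right)
    then show ?thesis
      by (simp only: Bochner_Integration.integral_sum[OF intA])
  qed
  also have "\<dots> \<le> expectation (\<lambda>\<omega>. \<phi> (S m \<omega>))"
  proof (rule integral_mono)
    show "integrable M (\<lambda>\<omega>. indicator (\<Union>j\<le>m. A j) \<omega> * \<phi> (S m \<omega>))"
      using integrable_real_mult_indicator[OF _ int\<phi>[OF cont(1)], of "\<Union>j\<le>m. A j" m] by (simp add: mult.commute)
  qed (auto simp: indicator_def nonneg int\<phi>[OF cont(1)])
  finally show ?thesis .
qed

text \<open>Induction on \<open>n\<close>, expanding the power of the partial sum plus
  \<open>Y n\<close>. A mixed term with a first power of either factor has mean 0, so only 6 times
  the product of the squares survives at order four; its mean \<open>6 n v^2\<close> is absorbed by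
  the growth of \<open>3 n^2 v^2\<close>.\<close>

lemma (in prob_space) sum_moments:
  fixes Y :: "nat \<Rightarrow> 'a \<Rightarrow> real"
  assumes ind: "indep_vars (\<lambda>_. borel) Y UNIV" and bdd: "\<And>i \<omega>. \<bar>Y i \<omega>\<bar> \<le> b"
    and mean: "\<And>i. expectation (Y i) = 0" and m2: "\<And>i. expectation (\<lambda>\<omega>. (Y i \<omega>)^2) = v"
    and m4: "\<And>i. expectation (\<lambda>\<omega>. (Y i \<omega>)^4) \<le> w"
  shows "expectation (\<lambda>\<omega>. \<Sum>i<n. Y i \<omega>) = 0"
    and "expectation (\<lambda>\<omega>. (\<Sum>i<n. Y i \<omega>)^2) = n * v"
    and "expectation (\<lambda>\<omega>. (\<Sum>i<n. Y i \<omega>)^4) \<le> n * w + 3 * (real n)^2 * v^2"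
proof -
  have Y[measurable]: "Y i \<in> borel_measurable M" for i using ind by (auto simp: indep_vars_def)
  have "0 \<le> b" using bdd[of 0 undefined] by linarith
  have intS: "integrable M (\<lambda>\<omega>. (\<Sum>i<n. Y i \<omega>)^k)" for n k
  proof (rule integrable_const_bound[where B="(n * b)^k"])
    have "\<bar>\<Sum>i<n. Y i \<omega>\<bar> \<le> n * b" for \<omega>
      using order_trans[OF sum_abs sum_bounded_above[of "{..<n}" "\<lambda>i. \<bar>Y i \<omega>\<bar>" b]] bdd by simp
    then show "AE x in M. norm ((\<Sum>i<n. Y i x) ^ k) \<le> (n * b)^k"
      by (auto simp: power_abs intro!: power_mono)
  qed measurable
  have intY: "integrable M (\<lambda>\<omega>. (Y i \<omega>)^k)" for i k
    using bdd[of i] by (intro integrable_const_bound[where B="b^k"]) (auto simp: power_abs intro!: power_mono)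
  have iv: "indep_var borel (\<lambda>\<omega>. (Y n \<omega>)^l) borel (\<lambda>\<omega>. (\<Sum>i<n. Y i \<omega>)^k)" for n k l
  proof -
    have "indep_var borel (Y n) borel (\<lambda>\<omega>. \<Sum>i<n. Y i \<omega>)"
      using indep_vars_sum[OF _ _ indep_vars_subset[OF ind], of "{..<n}" n] by auto
    from indep_var_compose[OF this, of "\<lambda>x. x^l" borel "\<lambda>x. x^k" borel]
    show ?thesis by (simp add: comp_def)
  qed
  have prod: "expectation (\<lambda>\<omega>. (\<Sum>i<n. Y i \<omega>)^k * (Y n \<omega>)^l) = expectation (\<lambda>\<omega>. (\<Sum>i<n. Y i \<omega>)^k) * expectation (\<lambda>\<omega>. (Y n \<omega>)^l)"
    and intp: "integrable M (\<lambda>\<omega>. (\<Sum>i<n. Y i \<omega>)^k * (Y n \<omega>)^l)" for n k l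
    using indep_var_lebesgue_integral[OF iv intY intS] indep_var_integrable[OF iv intY intS] by (auto simp: mult.commute)
  have intY1: "integrable M (Y i)" for i using intY[of i 1] by simp
  have s1: "expectation (\<lambda>\<omega>. \<Sum>i<n. Y i \<omega>) = 0" for n
    using intY1 mean by (simp add: Bochner_Integration.integral_sum)
  show "expectation (\<lambda>\<omega>. \<Sum>i<n. Y i \<omega>) = 0" by (rule s1)
  have s2: "expectation (\<lambda>\<omega>. (\<Sum>i<n. Y i \<omega>)^2) = n * v" for n
  proof (induction n)
    case (Suc n)
    have "(\<lambda>\<omega>. (\<Sum>i<Suc n. Y i \<omega>)^2) = (\<lambda>\<omega>. (\<Sum>i<n. Y i \<omega>)^2 + 2 * ((\<Sum>i<n. Y i \<omega>)^1 * (Y n \<omega>)^1) + (Y n \<omega>)^2)"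
      by (auto simp: power2_eq_square algebra_simps)
    then have "expectation (\<lambda>\<omega>. (\<Sum>i<Suc n. Y i \<omega>)^2) = expectation (\<lambda>\<omega>. (\<Sum>i<n. Y i \<omega>)^2) + 2 * expectation (\<lambda>\<omega>. (\<Sum>i<n. Y i \<omega>)^1 * (Y n \<omega>)^1) + expectation (\<lambda>\<omega>. (Y n \<omega>)^2)"
      using intp[of n 1 1] intS intY by (simp del: power_one_right)
    then show ?case unfolding prod using Suc s1 m2 by (simp add: mean algebra_simps)
  qed simp
  show "expectation (\<lambda>\<omega>. (\<Sum>i<n. Y i \<omega>)^2) = n * v" by (rule s2)
  have v0: "0 \<le> v" unfolding m2[of 0, symmetric] by simp
  show "expectation (\<lambda>\<omega>. (\<Sum>i<n. Y i \<omega>)^4) \<le> n * w + 3 * (real n)^2 * v^2"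
  proof (induction n)
    case (Suc n)
    let ?S = "\<lambda>\<omega>. \<Sum>i<n. Y i \<omega>"
    have "(\<lambda>\<omega>. (\<Sum>i<Suc n. Y i \<omega>)^4) = (\<lambda>\<omega>. (?S \<omega>)^4 + 4 * ((?S \<omega>)^3 * (Y n \<omega>)^1) + 6 * ((?S \<omega>)^2 * (Y n \<omega>)^2) + 4 * ((?S \<omega>)^1 * (Y n \<omega>)^3) + (Y n \<omega>)^4)"
      by (auto simp: eval_nat_numeral algebra_simps)
    then have "expectation (\<lambda>\<omega>. (\<Sum>i<Suc n. Y i \<omega>)^4) = expectation (\<lambda>\<omega>. (?S \<omega>)^4) + 4 * expectation (\<lambda>\<omega>. (?S \<omega>)^3 * (Y n \<omega>)^1)
       + 6 * expectation (\<lambda>\<omega>. (?S \<omega>)^2 * (Y n \<omega>)^2) + 4 * expectation (\<lambda>\<omega>. (?S \<omega>)^1 * (Y n \<omega>)^3) + expectation (\<lambda>\<omega>. (Y n \<omega>)^4)"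
      using intp[of n 3 1] intp[of n 2 2] intp[of n 1 3] intS intY by simp
    also have "\<dots> = expectation (\<lambda>\<omega>. (?S \<omega>)^4) + 6 * (n * v * v) + expectation (\<lambda>\<omega>. (Y n \<omega>)^4)"
      unfolding prod by (simp add: s1 s2 m2 mean)
    also have "\<dots> \<le> n * w + 3 * (real n)^2 * v^2 + 6 * (n * v * v) + w"
      using Suc m4[of n] by simp
    also have "\<dots> \<le> Suc n * w + 3 * (real (Suc n))^2 * v^2"
      using v0 by (simp add: power2_eq_square algebra_simps)
    finally show ?case .
  qed simp
qed

text \<open>Each summand is 1 on \<open>D\<close> and \<open>- p / (1 - p)\<close> off it, hence
  centred with variance \<open>p / (1 - p)\<close>. For \<open>p \<le> 1/2\<close> this is at most
  \<open>2 p\<close>, and so is the fourth moment; the 12 is \<open>3 * 2^2\<close>.\<close>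

lemma (in prob_space) compensated_count_moments:
  fixes U :: "nat \<Rightarrow> 'a \<Rightarrow> real" and D :: "real set" and n :: nat and p :: real
  defines "S \<omega> \<equiv> (\<Sum>i<n. 1 - indicator (- D) (U i \<omega>) / (1 - p))"
  assumes ind: "indep_vars (\<lambda>_. borel) U UNIV" and D: "D \<in> sets borel"
    and p: "\<And>i. prob {\<omega> \<in> space M. U i \<omega> \<in> D} = p" and p2: "p \<le> 1/2"
  shows "expectation (\<lambda>\<omega>. (S \<omega>)^2) \<le> 2 * n * p"
    and "expectation (\<lambda>\<omega>. (S \<omega>)^4) \<le> 2 * n * p + 12 * (n * p)^2"
proof -
  have U[measurable]: "U i \<in> borel_measurable M" for i using ind by (auto simp: indep_vars_def)
  note D[measurable]
  have p0: "0 \<le> p" using p[of 0] measure_nonneg by metis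
  define q where "q = 1 / (1 - p)"
  have q: "1 \<le> q" "q \<le> 2" "q * (1 - p) = 1" using p2 p0 by (auto simp: q_def field_simps)
  define Y where "Y i \<omega> = 1 - indicator (- D) (U i \<omega>) * q" for i \<omega>
  have S: "S = (\<lambda>\<omega>. \<Sum>i<n. Y i \<omega>)" unfolding S_def Y_def q_def by simp
  have iY: "indep_vars (\<lambda>_. borel) Y UNIV"
    unfolding Y_def by (rule indep_vars_compose2[OF ind]) measurable
  have Eind: "expectation (\<lambda>\<omega>. indicator D (U i \<omega>) :: real) = p" and iind: "integrable M (\<lambda>\<omega>. indicator D (U i \<omega>) :: real)" for i
  proof -
    have "(\<lambda>\<omega>. indicator D (U i \<omega>) :: real) = indicator (U i -` D)" by (auto simp: indicator_def)
    then show "expectation (\<lambda>\<omega>. indicator D (U i \<omega>) :: real) = p"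
      unfolding p[of i, symmetric] by (auto intro!: arg_cong[where f=prob])
    show "integrable M (\<lambda>\<omega>. indicator D (U i \<omega>) :: real)" by (intro integrable_const_bound[where B=1]) auto
  qed
  \<comment> \<open>\<open>Y i\<close> takes only the values 1 and \<open>1 - q\<close>, so each of
    its powers is affine in the indicator of \<open>D\<close>.\<close>
  have pw: "(Y i \<omega>)^k = (1 - q)^k + (1 - (1 - q)^k) * indicator D (U i \<omega>)" if "k > 0" for i k \<omega>
    using that by (auto simp: Y_def indicator_def)
  have EY: "expectation (\<lambda>\<omega>. (Y i \<omega>)^k) = (1 - q)^k * (1 - p) + p" if "k > 0" for i k
    unfolding pw[OF that] using iind Eind by (simp add: prob_space algebra_simps)
  have q1: "q - 1 = q * p" using q(3) by (simp add: algebra_simps)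
  have e1: "expectation (Y i) = 0" for i
    using EY[of 1 i] q(3) by (simp add: algebra_simps)
  have "(1 - q)^2 = (q - 1) * (q * p)" unfolding q1[symmetric] by (simp add: power2_eq_square algebra_simps)
  then have "(1 - q)^2 * (1 - p) + p = (q - 1) * (q * (1 - p)) * p + p" by (simp only: mult_ac)
  also have "\<dots> = q * p" unfolding q(3) using q1 by (simp add: algebra_simps)
  finally have v: "(1 - q)^2 * (1 - p) + p = q * p" .
  have "(1 - q)^4 * (1 - p) + p = (q - 1)^2 * ((1 - q)^2 * (1 - p)) + p" by (simp add: power2_eq_square power4_eq_xxxx algebra_simps)
  also have "\<dots> \<le> 1 * (q * p - p) + p"
    using q v p0 p2 power_mono[of "q - 1" 1 2] by (intro add_mono mult_mono) auto
  also have "\<dots> \<le> 2 * p" using mult_right_mono[OF q(2) p0] by simp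
  finally have w: "(1 - q)^4 * (1 - p) + p \<le> 2 * p" .
  have b: "\<bar>Y i \<omega>\<bar> \<le> 1" for i \<omega> using q by (auto simp: Y_def indicator_def)
  note mom = sum_moments[OF iY b e1, where v="q * p" and w="2 * p"]
  have "expectation (\<lambda>\<omega>. (S \<omega>)^2) = n * (q * p)"
    unfolding S by (rule mom(2)) (use EY v w in auto)
  also have "\<dots> \<le> 2 * n * p" using mult_right_mono[OF q(2) p0] mult_left_mono[of "q*p" "2*p" n] by (simp add: mult_ac)
  finally show "expectation (\<lambda>\<omega>. (S \<omega>)^2) \<le> 2 * n * p" .
  have "expectation (\<lambda>\<omega>. (S \<omega>)^4) \<le> n * (2 * p) + 3 * (real n)^2 * (q * p)^2"
    unfolding S by (rule mom(3)) (use EY v w in auto)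
  also have "\<dots> \<le> n * (2 * p) + 3 * (real n)^2 * (2 * p)^2"
    using mult_right_mono[OF q(2) p0] q p0 by (intro add_mono mult_left_mono power_mono) auto
  also have "\<dots> = 2 * n * p + 12 * (n * p)^2" by (simp add: power_mult_distrib)
  finally show "expectation (\<lambda>\<omega>. (S \<omega>)^4) \<le> 2 * n * p + 12 * (n * p)^2" .
qed

lemma tangent_power4: "(x::real)^4 + 4 * x^3 * (y - x) \<le> y^4"
proof -
  have "y^4 - (x^4 + 4 * x^3 * (y - x)) = (y - x)^2 * ((x + y)^2 + 2 * x^2)"
    by (simp add: eval_nat_numeral algebra_simps)
  moreover have "0 \<le> (y - x)^2 * ((x + y)^2 + 2 * x^2)" by (intro mult_nonneg_nonneg) auto
  ultimately show ?thesis by linarith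
qed

lemma tangent_power2: "(x::real)^2 + 2 * x * (y - x) \<le> y^2"
  using zero_le_power2[of "y - x"] by (simp add: power2_eq_square algebra_simps)

text \<open>
  Monotonicity in \<open>t\<close> of both the counts and their means reduces the supremum over \<open>[0, h]\<close>
  to one over a grid that may depend on \<open>n\<close>.
\<close>
lemma (in prob_space) increasing_sets_maximal:
  fixes U :: "nat \<Rightarrow> 'a \<Rightarrow> real" and C :: "real \<Rightarrow> real set"
  assumes ind: "indep_vars (\<lambda>_. borel) U UNIV"
    and h: "0 < h" "h \<le> 1/2" and a: "0 < a" and n: "0 < n"
    and C: "\<And>t. t \<in> {0..h} \<Longrightarrow> C t \<in> sets borel"
    and mono: "\<And>s t. 0 \<le> s \<Longrightarrow> s \<le> t \<Longrightarrow> t \<le> h \<Longrightarrow> C s \<subseteq> C t"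
    and p: "\<And>i t. t \<in> {0..h} \<Longrightarrow> prob {\<omega> \<in> space M. U i \<omega> \<in> C t} = t"
  obtains E where "E \<in> events" "prob E \<le> 8 * h / a^2" "prob E \<le> 32 * (h / n + 6 * h^2) / a^4"
    "\<And>\<omega> t. \<omega> \<in> space M - E \<Longrightarrow> t \<in> {0..h} \<Longrightarrow> \<bar>(\<Sum>i<n. indicator (C t) (U i \<omega>)) - real n * t\<bar> \<le> sqrt n * a"
proof -
  \<comment> \<open>Half of the admissible deviation \<open>sqrt n * a\<close> is spent at the grid
    points, the other half on the change of the mean inside one grid cell; \<open>m\<close> is
    chosen so large that \<open>n h / m\<close> stays below \<open>b\<close>.\<close>
  define b where "b = sqrt n * (a / 2)"
  have b0: "0 < b" using a n by (simp add: b_def)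
  obtain m :: nat where m: "n * h / b < m" using reals_Archimedean2 by blast
  have m0: "0 < m" using m h b0 by (intro gr0I) (auto simp: divide_less_0_iff mult_less_0_iff)
  \<comment> \<open>The cap at \<open>m\<close> gives a chain defined for all indices, constant from
    \<open>m\<close> on, as \<open>chain_count_maximal\<close> asks for.\<close>
  define c where "c k = h * min k m / m" for k :: nat
  have c: "c k \<in> {0..h}" for k
    using h m0 by (auto simp: c_def field_simps)
  have c_mono: "c k \<le> c l" if "k \<le> l" for k l
    unfolding c_def using h that by (intro divide_right_mono mult_left_mono) auto
  define S where "S k \<omega> = (\<Sum>i<n. 1 - indicator (- C (c k)) (U i \<omega>) / (1 - c k))" for k \<omega>
  define E where "E = {\<omega> \<in> space M. \<exists>k\<le>m. b \<le> \<bar>S k \<omega>\<bar>}"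
  have U[measurable]: "U i \<in> borel_measurable M" for i using ind by (auto simp: indep_vars_def)
  have Sm[measurable]: "S k \<in> borel_measurable M" for k unfolding S_def using C[OF c] by measurable
  have ev: "E \<in> events" unfolding E_def by measurable
  have cm: "c m = h" using m0 by (simp add: c_def)
  have c1: "c k < 1" for k using c[of k] h by auto
  have sub: "C (c k) \<subseteq> C (c l)" if "k \<le> l" for k l
    using mono[of "c k" "c l"] c_mono[OF that] c[of k] c[of l] by auto
  \<comment> \<open>The same exceptional event is estimated with \<open>x^2\<close> and with
    \<open>x^4\<close>: the first bound serves the weighted tails, the second the
    increments.\<close>
  have 2: "b^2 * prob E \<le> expectation (\<lambda>\<omega>. (S m \<omega>)^2)"
    unfolding E_def S_def
  proof (rule chain_count_maximal[OF ind C[OF c] sub p[OF c] c1, where \<phi>="\<lambda>x. x^2" and \<phi>'="\<lambda>x. 2 * x"])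
    show "b^2 \<le> x^2" if "b \<le> \<bar>x\<bar>" for x using power_mono[OF that, of 2] b0 by simp
  qed (auto intro!: continuous_intros tangent_power2)
  have 4: "b^4 * prob E \<le> expectation (\<lambda>\<omega>. (S m \<omega>)^4)"
    unfolding E_def S_def
  proof (rule chain_count_maximal[OF ind C[OF c] sub p[OF c] c1, where \<phi>="\<lambda>x. x^4" and \<phi>'="\<lambda>x. 4 * x^3"])
    show "b^4 \<le> x^4" if "b \<le> \<bar>x\<bar>" for x using power_mono[OF that, of 4] b0 by simp
  qed (auto intro!: continuous_intros tangent_power4)
  have "expectation (\<lambda>\<omega>. (S m \<omega>)^2) \<le> 2 * n * h"
    unfolding S_def cm by (rule compensated_count_moments) (use ind C h p in auto)
  with 2 have "prob E \<le> 2 * n * h / b^2" using b0 by (simp add: field_simps)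
  also have "\<dots> = 8 * h / a^2" using n a by (simp add: b_def power_mult_distrib power_divide field_simps)
  finally have e2: "prob E \<le> 8 * h / a^2" .
  have "expectation (\<lambda>\<omega>. (S m \<omega>)^4) \<le> 2 * n * h + 12 * (n * h)^2"
    unfolding S_def cm by (rule compensated_count_moments) (use ind C h p in auto)
  with 4 have "prob E \<le> (2 * n * h + 12 * (n * h)^2) / b^4" using b0 by (simp add: field_simps)
  also have "b^4 = n^2 * a^4 / 16"
    using power_mult[of "sqrt n" 2 2] by (simp add: b_def power_mult_distrib power_divide)
  also have "(2 * n * h + 12 * (n * h)^2) / (n^2 * a^4 / 16) = 32 * (h / n + 6 * h^2) / a^4"
    using n a by (simp add: field_simps power2_eq_square)
  finally have e4: "prob E \<le> 32 * (h / n + 6 * h^2) / a^4" .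
  let ?N = "\<lambda>\<omega> t. \<Sum>i<n. indicator (C t) (U i \<omega>) :: real"
  have grid: "\<bar>?N \<omega> (c k) - n * c k\<bar> \<le> b" if "\<omega> \<in> space M - E" for \<omega> k
  proof -
    have "k \<le> m \<or> c k = c m" unfolding c_def by (cases "k \<le> m") (auto simp: min_absorb2)
    then obtain l where l: "l \<le> m" "c k = c l" by auto
    have c1: "0 < 1 - c l" "1 - c l \<le> 1" using c[of l] h by auto
    \<comment> \<open>Undoing the compensation multiplies \<open>S l\<close> by
      \<open>1 - c l\<close>, which is at most 1, so the level \<open>b\<close> is kept.\<close>
    have "?N \<omega> (c l) - n * c l = (\<Sum>i<n. indicator (C (c l)) (U i \<omega>) - c l)" by (simp add: sum_subtractf)
    also have "\<dots> = (\<Sum>i<n. (1 - c l) * (1 - indicator (- C (c l)) (U i \<omega>) / (1 - c l)))"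
      using c1 by (intro sum.cong refl) (auto simp: indicator_def right_diff_distrib)
    also have "\<dots> = (1 - c l) * S l \<omega>" by (simp add: S_def sum_distrib_left)
    finally have "\<bar>?N \<omega> (c l) - n * c l\<bar> = (1 - c l) * \<bar>S l \<omega>\<bar>" using c1 by (simp add: abs_mult)
    also have "\<dots> \<le> 1 * \<bar>S l \<omega>\<bar>" using c1 by (intro mult_right_mono) auto
    also have "\<dots> \<le> b"
    proof -
      have "\<not> b \<le> \<bar>S l \<omega>\<bar>" using that l(1) unfolding E_def by blast
      then show ?thesis by simp
    qed
    finally show ?thesis unfolding l .
  qed
  have "\<bar>?N \<omega> t - real n * t\<bar> \<le> sqrt n * a" if w: "\<omega> \<in> space M - E" and t: "t \<in> {0..h}" for \<omega> and t :: real
  proof -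
    define k where "k = nat \<lfloor>t * m / h\<rfloor>"
    have "0 \<le> t * m / h" using t h by simp
    then have k1: "real k \<le> t * m / h" "t * m / h < real k + 1"
      unfolding k_def by (simp_all add: of_nat_nat)
    have ck: "c k \<le> t" 
    proof -
      have "c k \<le> h * real k / m" unfolding c_def using h by (intro divide_right_mono mult_left_mono) auto
      also have "\<dots> \<le> t" using k1(1) m0 h by (simp add: le_divide_eq divide_le_eq mult.commute)
      finally show ?thesis .
    qed
    have ck1: "t \<le> c (Suc k)"
    proof (cases "Suc k \<le> m")
      case True
      have "t * m < (real k + 1) * h" using k1(2) h by (simp add: divide_less_eq)
      then have "t \<le> h * (real k + 1) / m" using m0 by (simp add: le_divide_eq mult.commute)
      then show ?thesis using True by (simp add: c_def min_absorb1 add.commute)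
    next
      case False
      then have "c (Suc k) = h" using m0 by (simp add: c_def min_absorb2)
      then show ?thesis using t by simp
    qed
    have "c (Suc k) - c k = h / m * (real (min (Suc k) m) - real (min k m))"
      by (simp add: c_def algebra_simps diff_divide_distrib)
    also have "\<dots> \<le> h / m * 1" using h by (intro mult_left_mono) auto
    finally have "n * (c (Suc k) - c k) \<le> n * (h / m)" by (intro mult_left_mono) auto
    also have "\<dots> \<le> b"
    proof -
      have "n * h < m * b" using m b0 by (simp add: divide_less_eq)
      then show ?thesis using m0 by (simp add: divide_le_eq mult.commute)
    qed
    finally have d: "n * c (Suc k) - n * c k \<le> b" by (simp add: algebra_simps)
    have mN: "?N \<omega> s \<le> ?N \<omega> s'" if "0 \<le> s" "s \<le> s'" "s' \<le> h" for s s'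
      using mono[OF that] by (intro sum_mono) (auto simp: indicator_def)
    have "?N \<omega> (c k) \<le> ?N \<omega> t" "?N \<omega> t \<le> ?N \<omega> (c (Suc k))"
      using ck ck1 c[of k] c[of "Suc k"] t by (auto intro!: mN)
    moreover have "n * c k \<le> n * t" "n * t \<le> n * c (Suc k)" using ck ck1 by (auto intro!: mult_left_mono)
    moreover have "sqrt n * a = b + b" by (simp add: b_def)
    ultimately show ?thesis using grid[OF w, of k] grid[OF w, of "Suc k"] d by linarith
  qed
  then show ?thesis using that ev e2 e4 by blast
qed

section \<open>Convergence of finite-dimensional distributions\<close>

text \<open>Trigonometric polynomials with real frequencies in the first \<open>m\<close>
  coordinates. The free phase \<open>c\<close> provides sines and constants, and closure under
  products makes Stone-Weierstrass applicable. Their expectations reduce to those of single cosines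
  of linear forms, which is what the Cramer-Wold device controls.\<close>

inductive_set trig_sums :: "nat \<Rightarrow> ((nat \<Rightarrow> real) \<Rightarrow> real) set" for m where
  cos: "(\<lambda>x. a * cos ((\<Sum>i<m. v i * x i) + c)) \<in> trig_sums m"
| add: "f \<in> trig_sums m \<Longrightarrow> g \<in> trig_sums m \<Longrightarrow> (\<lambda>x. f x + g x) \<in> trig_sums m"

text \<open>Product-to-sum formula for two cosines; the two nested inductions extend it
  bilinearly.\<close>

lemma trig_sums_mult:
  assumes "f \<in> trig_sums m" "g \<in> trig_sums m"
  shows "(\<lambda>x. f x * g x) \<in> trig_sums m"
  using assms
proof (induction f)
  case (cos a v c)
  from cos show ?case
  proof (induction g)
    case (cos b w d)
    have "(\<lambda>x. a * cos ((\<Sum>i<m. v i * x i) + c) * (b * cos ((\<Sum>i<m. w i * x i) + d))) =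
      (\<lambda>x. (a * b / 2) * cos ((\<Sum>i<m. (v i - w i) * x i) + (c - d)) + (a * b / 2) * cos ((\<Sum>i<m. (v i + w i) * x i) + (c + d)))"
    proof
      fix x
      let ?A = "(\<Sum>i<m. v i * x i) + c" and ?B = "(\<Sum>i<m. w i * x i) + d"
      have "(\<Sum>i<m. (v i - w i) * x i) + (c - d) = ?A - ?B" "(\<Sum>i<m. (v i + w i) * x i) + (c + d) = ?A + ?B"
        by (simp_all add: algebra_simps sum.distrib sum_subtractf)
      then show "a * cos ?A * (b * cos ?B) = (a * b / 2) * cos ((\<Sum>i<m. (v i - w i) * x i) + (c - d)) + (a * b / 2) * cos ((\<Sum>i<m. (v i + w i) * x i) + (c + d))"
        by (simp only: cos_add cos_diff) (simp add: algebra_simps)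
    qed
    then show ?case by (simp only:) (intro trig_sums.intros)
  next
    case (add g1 g2)
    then show ?case unfolding distrib_left by (auto intro: trig_sums.add)
  qed
next
  case (add f1 f2)
  then show ?case unfolding distrib_right by (auto intro: trig_sums.add)
qed

lemma trig_sums_const: "(\<lambda>x. c) \<in> trig_sums m"
  using trig_sums.cos[of c "\<lambda>_. 0" m 0] by simp

lemma trig_sums_sin:
  assumes "i < m"
  shows "(\<lambda>x. sin (x i / r)) \<in> trig_sums m"
proof -
  have "(\<lambda>x. sin (x i / r)) = (\<lambda>x. 1 * cos ((\<Sum>j<m. (if j = i then 1 / r else 0) * x j) + (- pi / 2)))"
  proof
    fix x :: "nat \<Rightarrow> real"
    have "(\<Sum>j<m. (if j = i then 1 / r else 0) * x j) = (\<Sum>j<m. if j = i then x j / r else 0)" by (intro sum.cong) auto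
    also have "\<dots> = x i / r" using assms by (simp add: sum.delta)
    finally show "sin (x i / r) = 1 * cos ((\<Sum>j<m. (if j = i then 1 / r else 0) * x j) + (- pi / 2))"
      by (simp add: sin_cos_eq) (metis cos_minus minus_diff_eq)
  qed
  then show ?thesis using trig_sums.cos[of 1 "\<lambda>j. if j = i then 1 / r else 0" m "- pi / 2"] by simp
qed

lemma trig_sums_bounded: "f \<in> trig_sums m \<Longrightarrow> \<exists>b. \<forall>x. \<bar>f x\<bar> \<le> b"
proof (induction rule: trig_sums.induct)
  case (cos a v c)
  show ?case by (rule exI[of _ "\<bar>a\<bar>"]) (auto simp: abs_mult mult_left_le)
next
  case (add f g)
  then obtain b c where "\<forall>x. \<bar>f x\<bar> \<le> b" "\<forall>x. \<bar>g x\<bar> \<le> c" by auto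
  then show ?case
    by (intro exI[of _ "b + c"] allI order_trans[OF abs_triangle_ineq] add_mono) auto
qed

lemma trig_sums_measurable:
  assumes "f \<in> trig_sums m" "\<And>i. i < m \<Longrightarrow> X i \<in> borel_measurable M"
  shows "(\<lambda>\<omega>. f (\<lambda>i. X i \<omega>)) \<in> borel_measurable M"
  using assms(1)
proof (induction rule: trig_sums.induct)
  case (cos a v c)
  have "(\<lambda>\<omega>. \<Sum>i<m. v i * X i \<omega>) \<in> borel_measurable M"
    by (intro borel_measurable_sum borel_measurable_times) (use assms(2) in auto)
  then show ?case by measurable
qed simp

text \<open>
  Composing with \<open>x \<mapsto> r * arcsin (sin (x / r))\<close>, which is periodic and the identity near 0, makes
  a function uniformly approximable on the whole space without changing it on a large cube.
\<close>
lemma Lipschitz_trig_approximation: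
  fixes f :: "(nat \<Rightarrow> real) \<Rightarrow> real"
  assumes lip: "\<And>x y. \<bar>f x - f y\<bar> \<le> K * (\<Sum>i<m. \<bar>x i - y i\<bar>)" and r: "0 < r" and e: "0 < e"
    and bdd: "\<And>x. \<bar>f x\<bar> \<le> b"
  obtains g where "g \<in> trig_sums m" "\<And>x. (\<And>i. i < m \<Longrightarrow> \<bar>x i\<bar> \<le> r) \<Longrightarrow> \<bar>f x - g x\<bar> < e"
    "\<And>x. \<bar>g x\<bar> < b + e"
proof -
  \<comment> \<open>Padding with zeros beyond \<open>m\<close> makes the cube compact in the product
    topology on all of \<open>nat \<Rightarrow> real\<close>, while the coordinates below
    \<open>m\<close> still separate its points.\<close>
  define S :: "(nat \<Rightarrow> real) set" where "S = (\<Pi>\<^sub>E i\<in>UNIV. if i < m then {-1..1} else {0})"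
  define \<tau> where "\<tau> x = (\<lambda>i. if i < m then sin (x i / r) else 0)" for x :: "nat \<Rightarrow> real"
  define H where "H s = f (\<lambda>i. r * arcsin (s i))" for s
  have S_iff: "s \<in> S \<longleftrightarrow> (\<forall>i<m. s i \<in> {-1..1}) \<and> (\<forall>i\<ge>m. s i = 0)" for s
  proof -
    have "s \<in> S \<longleftrightarrow> (\<forall>i. s i \<in> (if i < m then {-1..1} else {0}))" by (simp add: S_def PiE_iff)
    also have "\<dots> \<longleftrightarrow> (\<forall>i<m. s i \<in> (if i < m then {-1..1} else {0})) \<and> (\<forall>i\<ge>m. s i \<in> (if i < m then {-1..1} else {0}))"
      by (meson not_le)
    also have "\<dots> \<longleftrightarrow> (\<forall>i<m. s i \<in> {-1..1}) \<and> (\<forall>i\<ge>m. s i = 0)" by simp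
    finally show ?thesis .
  qed
  have "compactin (product_topology (\<lambda>i. euclidean) UNIV) S"
    unfolding S_def by (subst compactin_PiE) auto
  then have cS: "compact S" by (simp add: euclidean_product_topology)
  have coord: "continuous_on S (\<lambda>s. s i)" for i
    by (rule continuous_on_subset[OF continuous_on_product_coordinates]) simp
  have sb: "\<forall>s\<in>S. -1 \<le> s i \<and> s i \<le> 1" for i
    using S_iff by (cases "i < m") auto
  have "continuous_on S H"
    unfolding continuous_on_def
  proof
    fix s assume s: "s \<in> S"
    have "continuous_on S (\<lambda>t. K * (\<Sum>i<m. \<bar>r * arcsin (t i) - r * arcsin (s i)\<bar>))"
      by (intro continuous_intros continuous_on_arcsin coord) (use sb in auto)
    then have "((\<lambda>t. K * (\<Sum>i<m. \<bar>r * arcsin (t i) - r * arcsin (s i)\<bar>)) \<longlongrightarrow> K * (\<Sum>i<m. \<bar>r * arcsin (s i) - r * arcsin (s i)\<bar>)) (at s within S)"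
      using s unfolding continuous_on_def by (rule bspec)
    then have z: "((\<lambda>t. K * (\<Sum>i<m. \<bar>r * arcsin (t i) - r * arcsin (s i)\<bar>)) \<longlongrightarrow> 0) (at s within S)" by simp
    have "((\<lambda>t. H t - H s) \<longlongrightarrow> 0) (at s within S)"
      by (rule Lim_null_comparison[OF _ z]) (simp add: H_def lip)
    then show "(H \<longlongrightarrow> H s) (at s within S)" by (simp add: LIM_zero_iff)
  qed
  \<comment> \<open>Stone-Weierstrass for the algebra of continuous \<open>p\<close> whose
    composition with \<open>\<tau>\<close> is a trigonometric sum; the coordinates belong to it
    because they become sines.\<close>
  have "\<exists>p. (continuous_on S p \<and> (\<lambda>x. p (\<tau> x)) \<in> trig_sums m) \<and> (\<forall>s\<in>S. \<bar>H s - p s\<bar> < e)"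
  proof (rule Stone_Weierstrass_HOL[OF cS _ _ _ _ _ \<open>continuous_on S H\<close> e])
    fix x y assume xy: "x \<in> S \<and> y \<in> S \<and> x \<noteq> y"
    then obtain i where i: "x i \<noteq> y i" by auto
    with xy have "i < m" using S_iff[of x] S_iff[of y] not_less by force
    then show "\<exists>p. (continuous_on S p \<and> (\<lambda>x. p (\<tau> x)) \<in> trig_sums m) \<and> p x \<noteq> p y"
      using i coord trig_sums_sin by (intro exI[of _ "\<lambda>s. s i"]) (auto simp: \<tau>_def)
  qed (auto intro: trig_sums_const trig_sums.add trig_sums_mult continuous_intros)
  then obtain p where p: "(\<lambda>x. p (\<tau> x)) \<in> trig_sums m" "\<And>s. s \<in> S \<Longrightarrow> \<bar>H s - p s\<bar> < e" by blast
  have \<tau>S: "\<tau> x \<in> S" for x unfolding S_iff by (auto simp: \<tau>_def)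
  show ?thesis
  proof (rule that[OF p(1)])
    fix x :: "nat \<Rightarrow> real"
    show "\<bar>p (\<tau> x)\<bar> < b + e" using p(2)[OF \<tau>S[of x]] bdd[of "\<lambda>i. r * arcsin (\<tau> x i)"] by (simp add: H_def)
    assume x: "\<And>i. i < m \<Longrightarrow> \<bar>x i\<bar> \<le> r"
    have "r * arcsin (\<tau> x i) = x i" if "i < m" for i
    proof -
      have "\<bar>x i / r\<bar> \<le> 1" using x[OF that] r by simp
      then have "- (pi / 2) \<le> x i / r" "x i / r \<le> pi / 2" using pi_gt3 by linarith+
      then show ?thesis using that r by (simp add: \<tau>_def arcsin_sin)
    qed
    then have "\<bar>f (\<lambda>i. r * arcsin (\<tau> x i)) - f x\<bar> \<le> 0"
      using lip[of "\<lambda>i. r * arcsin (\<tau> x i)" x] by simp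
    then show "\<bar>f x - p (\<tau> x)\<bar> < e" using p(2)[OF \<tau>S[of x]] by (simp add: H_def)
  qed
qed

text \<open>Cosines of all linear forms yield all trigonometric sums. These approximate
  \<open>f\<close> on the cube of radius \<open>k + 1\<close>, and the uniform second moments
  control the mass outside. Measurability of \<open>f\<close> along the coordinates comes from the
  same pointwise approximation.\<close>

lemma Cramer_Wold_Lipschitz:
  fixes X :: "nat \<Rightarrow> nat \<Rightarrow> 'a \<Rightarrow> real" and Y :: "nat \<Rightarrow> 'b \<Rightarrow> real"
  assumes "prob_space M" "prob_space N"
    and X: "\<And>n i. i < m \<Longrightarrow> X n i \<in> borel_measurable M" and Y: "\<And>i. i < m \<Longrightarrow> Y i \<in> borel_measurable N"
    and cos: "\<And>v c. (\<lambda>n. \<integral>\<omega>. cos ((\<Sum>i<m. v i * X n i \<omega>) + c) \<partial>M) \<longlonglongrightarrow> (\<integral>\<omega>. cos ((\<Sum>i<m. v i * Y i \<omega>) + c) \<partial>N)"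
    and m2: "\<And>n i. i < m \<Longrightarrow> integrable M (\<lambda>\<omega>. (X n i \<omega>)^2)" "\<And>n i. i < m \<Longrightarrow> (\<integral>\<omega>. (X n i \<omega>)^2 \<partial>M) \<le> V"
    and lip: "\<And>x y. \<bar>f x - f y\<bar> \<le> K * (\<Sum>i<m. \<bar>x i - y i\<bar>)" and bdd: "\<And>x. \<bar>f x\<bar> \<le> b"
  shows "(\<lambda>n. \<integral>\<omega>. f (\<lambda>i. X n i \<omega>) \<partial>M) \<longlonglongrightarrow> (\<integral>\<omega>. f (\<lambda>i. Y i \<omega>) \<partial>N)"
    and "\<And>n. (\<lambda>\<omega>. f (\<lambda>i. X n i \<omega>)) \<in> borel_measurable M"
    and "(\<lambda>\<omega>. f (\<lambda>i. Y i \<omega>)) \<in> borel_measurable N"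
proof -
  interpret M: prob_space M by fact
  interpret N: prob_space N by fact
  have "\<exists>g. \<forall>k. g k \<in> trig_sums m \<and> (\<forall>x. (\<forall>i<m. \<bar>x i\<bar> \<le> real (Suc k)) \<longrightarrow> \<bar>f x - g k x\<bar> < 1 / real (Suc k)) \<and> (\<forall>x. \<bar>g k x\<bar> < b + 1 / real (Suc k))"
  proof (rule choice, rule allI)
    fix k
    have "0 < real (Suc k)" "0 < 1 / real (Suc k)" by simp_all
    from Lipschitz_trig_approximation[OF lip this bdd] obtain g where "g \<in> trig_sums m"
      "\<And>x. (\<And>i. i < m \<Longrightarrow> \<bar>x i\<bar> \<le> real (Suc k)) \<Longrightarrow> \<bar>f x - g x\<bar> < 1 / real (Suc k)" "\<And>x. \<bar>g x\<bar> < b + 1 / real (Suc k)"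
      by blast
    then show "\<exists>g. g \<in> trig_sums m \<and> (\<forall>x. (\<forall>i<m. \<bar>x i\<bar> \<le> real (Suc k)) \<longrightarrow> \<bar>f x - g x\<bar> < 1 / real (Suc k)) \<and> (\<forall>x. \<bar>g x\<bar> < b + 1 / real (Suc k))"
      by (intro exI[of _ g]) simp
  qed
  then obtain g where g: "\<And>k. g k \<in> trig_sums m"
    "\<And>k x. (\<And>i. i < m \<Longrightarrow> \<bar>x i\<bar> \<le> real (Suc k)) \<Longrightarrow> \<bar>f x - g k x\<bar> < 1 / real (Suc k)" "\<And>k x. \<bar>g k x\<bar> < b + 1 / real (Suc k)"
    by blast
  have gb: "\<bar>g k x\<bar> \<le> b + 1" for k x
    using g(3)[of k x] by (smt (verit) divide_le_eq_1 of_nat_0_le_iff of_nat_Suc)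
  have lim: "(\<lambda>k. g k x) \<longlonglongrightarrow> f x" for x
  proof -
    obtain k0 :: nat where k0: "(\<Sum>i<m. \<bar>x i\<bar>) < k0" using reals_Archimedean2 by blast
    have xi: "\<bar>x i\<bar> < k0" if "i < m" for i
      using member_le_sum[of i "{..<m}" "\<lambda>i. \<bar>x i\<bar>"] that k0 by auto
    have "eventually (\<lambda>k. norm (g k x - f x) \<le> 1 / real (Suc k)) sequentially"
      using eventually_ge_at_top[of k0]
    proof eventually_elim
      case (elim k)
      then have "\<bar>f x - g k x\<bar> < 1 / real (Suc k)" using xi by (intro g(2)) force
      then show ?case by simp
    qed
    then have "(\<lambda>k. g k x - f x) \<longlonglongrightarrow> 0"
      by (rule Lim_null_comparison) (use LIMSEQ_inverse_real_of_nat in \<open>simp add: inverse_eq_divide\<close>)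
    then show ?thesis by (simp add: LIM_zero_iff)
  qed
  have mX: "(\<lambda>\<omega>. g k (\<lambda>i. X n i \<omega>)) \<in> borel_measurable M" for k n by (rule trig_sums_measurable[OF g(1)]) (rule X)
  have mY: "(\<lambda>\<omega>. g k (\<lambda>i. Y i \<omega>)) \<in> borel_measurable N" for k by (rule trig_sums_measurable[OF g(1)]) (rule Y)
  show fX: "(\<lambda>\<omega>. f (\<lambda>i. X n i \<omega>)) \<in> borel_measurable M" for n
    by (rule borel_measurable_LIMSEQ_real[OF lim mX])
  show fY: "(\<lambda>\<omega>. f (\<lambda>i. Y i \<omega>)) \<in> borel_measurable N"
    by (rule borel_measurable_LIMSEQ_real[OF lim mY])
  have trig: "(\<lambda>n. \<integral>\<omega>. h (\<lambda>i. X n i \<omega>) \<partial>M) \<longlonglongrightarrow> (\<integral>\<omega>. h (\<lambda>i. Y i \<omega>) \<partial>N)" if "h \<in> trig_sums m" for h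
    using that
  proof induction
    case (cos a v c)
    then show ?case using tendsto_mult_left[OF assms(5), of a v c] by simp
  next
    case (add h1 h2)
    have "integrable M (\<lambda>\<omega>. h (\<lambda>i. X n i \<omega>))" "integrable N (\<lambda>\<omega>. h (\<lambda>i. Y i \<omega>))" if h: "h \<in> trig_sums m" for h n
    proof -
      obtain B where "\<forall>x. \<bar>h x\<bar> \<le> B" using trig_sums_bounded[OF h] by auto
      then show "integrable M (\<lambda>\<omega>. h (\<lambda>i. X n i \<omega>))" "integrable N (\<lambda>\<omega>. h (\<lambda>i. Y i \<omega>))"
        by (auto intro!: M.integrable_const_bound[where B=B] N.integrable_const_bound[where B=B] trig_sums_measurable[OF h] X Y)
    qed
    then show ?case using add tendsto_add[OF add.IH] by simp
  qed
  have limN: "(\<lambda>k. \<integral>\<omega>. g k (\<lambda>i. Y i \<omega>) \<partial>N) \<longlonglongrightarrow> (\<integral>\<omega>. f (\<lambda>i. Y i \<omega>) \<partial>N)"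
    by (rule integral_dominated_convergence[where w="\<lambda>_. b + 1"]) (use gb lim mY fY in auto)
  have if': "integrable M (\<lambda>\<omega>. f (\<lambda>i. X n i \<omega>))" for n using bdd fX by (intro M.integrable_const_bound[where B=b]) auto
  have ig: "integrable M (\<lambda>\<omega>. g k (\<lambda>i. X n i \<omega>))" for n k using gb mX by (intro M.integrable_const_bound[where B="b+1"]) auto
  have unif: "\<bar>(\<integral>\<omega>. f (\<lambda>i. X n i \<omega>) \<partial>M) - (\<integral>\<omega>. g k (\<lambda>i. X n i \<omega>) \<partial>M)\<bar> \<le> 1 / real (Suc k) + (2 * b + 1) * (m * V) / (real (Suc k))^2" for n k
  proof -
    let ?d = "\<lambda>\<omega>. 1 / real (Suc k) + (2 * b + 1) * (\<Sum>i<m. (X n i \<omega>)^2) / (real (Suc k))^2"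
    have i3: "integrable M (\<lambda>\<omega>. (2 * b + 1) * (\<Sum>i<m. (X n i \<omega>)^2) / (real (Suc k))^2)"
      using m2(1) by (intro integrable_divide integrable_mult_right Bochner_Integration.integrable_sum) simp
    have i2: "integrable M ?d"
      by (rule Bochner_Integration.integrable_add[OF _ i3]) simp
    \<comment> \<open>Outside the cube the sum of squares exceeds \<open>(k + 1)^2\<close>, so the
      crude bound \<open>2 b + 1\<close> may be multiplied by their ratio: Chebyshev's inequality
      written pointwise.\<close>
    have pt: "\<bar>f x - g k x\<bar> \<le> 1 / real (Suc k) + (2 * b + 1) * (\<Sum>i<m. (x i)^2) / (real (Suc k))^2" for x
    proof (cases "\<forall>i<m. \<bar>x i\<bar> \<le> real (Suc k)")
      case True
      have "0 \<le> b" using bdd[of undefined] by linarith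
      then have "0 \<le> (2 * b + 1) * (\<Sum>i<m. (x i)^2) / (real (Suc k))^2" by (auto intro!: sum_nonneg divide_nonneg_nonneg mult_nonneg_nonneg)
      then show ?thesis using g(2)[of x k] True by fastforce
    next
      case False
      then obtain i where i: "i < m" "real (Suc k) < \<bar>x i\<bar>" by (auto simp: not_le)
      have "(real (Suc k))^2 \<le> (x i)^2" using power_mono[of "real (Suc k)" "\<bar>x i\<bar>" 2] i(2) by simp
      also have "\<dots> \<le> (\<Sum>i<m. (x i)^2)" using member_le_sum[of i "{..<m}" "\<lambda>i. (x i)^2"] i(1) by auto
      finally have "1 \<le> (\<Sum>i<m. (x i)^2) / (real (Suc k))^2" by (subst le_divide_eq) auto
      moreover have "0 \<le> b" using bdd[of undefined] by linarith
      ultimately have "(2 * b + 1) * 1 \<le> (2 * b + 1) * ((\<Sum>i<m. (x i)^2) / (real (Suc k))^2)" by (intro mult_left_mono) auto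
      then have "2 * b + 1 \<le> (2 * b + 1) * (\<Sum>i<m. (x i)^2) / (real (Suc k))^2" by simp
      moreover have "0 < 1 / real (Suc k)" by simp
      ultimately show ?thesis using bdd[of x] gb[of k x] by linarith
    qed
    have "\<bar>(\<integral>\<omega>. f (\<lambda>i. X n i \<omega>) \<partial>M) - (\<integral>\<omega>. g k (\<lambda>i. X n i \<omega>) \<partial>M)\<bar> = \<bar>\<integral>\<omega>. f (\<lambda>i. X n i \<omega>) - g k (\<lambda>i. X n i \<omega>) \<partial>M\<bar>"
      using if' ig by simp
    also have "\<dots> \<le> (\<integral>\<omega>. \<bar>f (\<lambda>i. X n i \<omega>) - g k (\<lambda>i. X n i \<omega>)\<bar> \<partial>M)" by (rule integral_abs_bound)
    also have "\<dots> \<le> (\<integral>\<omega>. ?d \<omega> \<partial>M)"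
      using if' ig i2 pt by (intro integral_mono) auto
    also have "\<dots> = 1 / real (Suc k) + (2 * b + 1) * (\<Sum>i<m. \<integral>\<omega>. (X n i \<omega>)^2 \<partial>M) / (real (Suc k))^2"
      using m2(1) by (subst Bochner_Integration.integral_add[OF _ i3]) (simp_all add: M.prob_space)
    also have "\<dots> \<le> 1 / real (Suc k) + (2 * b + 1) * (m * V) / (real (Suc k))^2"
    proof -
      have "(\<Sum>i<m. \<integral>\<omega>. (X n i \<omega>)^2 \<partial>M) \<le> m * V" using sum_bounded_above[of "{..<m}" "\<lambda>i. \<integral>\<omega>. (X n i \<omega>)^2 \<partial>M" V] m2(2) by simp
      moreover have "0 \<le> b" using bdd[of undefined] by linarith
      ultimately show ?thesis by (intro add_left_mono divide_right_mono mult_left_mono) auto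
    qed
    finally show ?thesis .
  qed
  have err: "(\<lambda>k. 1 / real (Suc k) + (2 * b + 1) * (m * V) / (real (Suc k))^2) \<longlonglongrightarrow> 0"
  proof -
    have a: "(\<lambda>k. inverse (real (Suc k))) \<longlonglongrightarrow> 0" by (rule LIMSEQ_inverse_real_of_nat)
    have "(\<lambda>k. inverse (real (Suc k)) + (2 * b + 1) * (m * V) * (inverse (real (Suc k)))^2) \<longlonglongrightarrow> 0 + (2 * b + 1) * (m * V) * 0^2"
      by (intro tendsto_intros a)
    then show ?thesis by (simp add: inverse_eq_divide power_divide)
  qed
  show "(\<lambda>n. \<integral>\<omega>. f (\<lambda>i. X n i \<omega>) \<partial>M) \<longlonglongrightarrow> (\<integral>\<omega>. f (\<lambda>i. Y i \<omega>) \<partial>N)"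
  proof (rule LIMSEQ_I)
    fix e :: real assume e: "0 < e"
    have e3: "0 < e / 3" using e by simp
    obtain k1 where k1: "\<And>k. k \<ge> k1 \<Longrightarrow> norm (1 / real (Suc k) + (2 * b + 1) * (m * V) / (real (Suc k))^2 - 0) < e / 3"
      using LIMSEQ_D[OF err e3] by blast
    obtain k2 where k2: "\<And>k. k \<ge> k2 \<Longrightarrow> norm ((\<integral>\<omega>. g k (\<lambda>i. Y i \<omega>) \<partial>N) - (\<integral>\<omega>. f (\<lambda>i. Y i \<omega>) \<partial>N)) < e / 3"
      using LIMSEQ_D[OF limN e3] by blast
    define k where "k = max k1 k2"
    have k: "\<bar>1 / real (Suc k) + (2 * b + 1) * (m * V) / (real (Suc k))^2\<bar> < e / 3"
        "\<bar>(\<integral>\<omega>. g k (\<lambda>i. Y i \<omega>) \<partial>N) - (\<integral>\<omega>. f (\<lambda>i. Y i \<omega>) \<partial>N)\<bar> < e / 3"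
      using k1[of k] k2[of k] unfolding k_def by (simp_all del: of_nat_Suc)
    obtain n0 where n0: "\<And>n. n \<ge> n0 \<Longrightarrow> norm ((\<integral>\<omega>. g k (\<lambda>i. X n i \<omega>) \<partial>M) - (\<integral>\<omega>. g k (\<lambda>i. Y i \<omega>) \<partial>N)) < e / 3"
      using LIMSEQ_D[OF trig[OF g(1)] e3] by blast
    have *: "\<bar>x - y\<bar> < e" if "\<bar>x - z\<bar> \<le> d" "\<bar>d\<bar> < e / 3" "\<bar>z - w\<bar> < e / 3" "\<bar>w - y\<bar> < e / 3" for x y z w d :: real
      using that by linarith
    have "norm ((\<integral>\<omega>. f (\<lambda>i. X n i \<omega>) \<partial>M) - (\<integral>\<omega>. f (\<lambda>i. Y i \<omega>) \<partial>N)) < e" if "n \<ge> n0" for n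
      unfolding real_norm_def by (rule *[OF unif k(1) n0[OF that, unfolded real_norm_def] k(2)])
    then show "\<exists>n0. \<forall>n\<ge>n0. norm ((\<integral>\<omega>. f (\<lambda>i. X n i \<omega>) \<partial>M) - (\<integral>\<omega>. f (\<lambda>i. Y i \<omega>) \<partial>N)) < e" by blast
  qed
qed

section \<open>The uniform empirical process\<close>

locale uniform_sample = prob_space +
  fixes U :: "nat \<Rightarrow> 'a \<Rightarrow> real"
  assumes indep: "indep_vars (\<lambda>_. borel) U UNIV"
    and uniform: "\<And>i t. t \<in> {0..1} \<Longrightarrow> prob {\<omega> \<in> space M. U i \<omega> \<le> t} = t"
begin

definition empirical_process :: "nat \<Rightarrow> real \<Rightarrow> 'a \<Rightarrow> real" where
  "empirical_process n t \<omega> = (\<Sum>i<n. indicator {..t} (U i \<omega>) - t) / sqrt n"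

lemma U_measurable[measurable]: "U i \<in> borel_measurable M"
  using indep by (auto simp: indep_vars_def)

lemma empirical_process_measurable[measurable]: "empirical_process n t \<in> borel_measurable M"
  unfolding empirical_process_def by measurable

lemma prob_le: "prob {\<omega> \<in> space M. U i \<omega> \<le> t} = min 1 (max 0 t)"
proof -
  have "prob {\<omega> \<in> space M. U i \<omega> \<le> t} \<le> prob {\<omega> \<in> space M. U i \<omega> \<le> 0}" if "t < 0"
    using that by (intro finite_measure_mono) auto
  moreover have "prob {\<omega> \<in> space M. U i \<omega> \<le> 1} \<le> prob {\<omega> \<in> space M. U i \<omega> \<le> t}" if "1 < t"
    using that by (intro finite_measure_mono) auto
  ultimately show ?thesis
    using uniform[of 0 i] uniform[of 1 i] uniform[of t i] measure_nonneg[of M] prob_le_1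
    by (cases "t < 0"; cases "1 < t") (auto intro: antisym)
qed

lemma identically_distributed: "distr M borel (U i) = distr M borel (U 0)"
proof (rule cdf_unique)
  have "cdf (distr M borel (U i)) t = min 1 (max 0 t)" for i t
    using prob_le[of i t] by (simp add: cdf_def measure_distr vimage_def Int_def conj_commute)
  then show "cdf (distr M borel (U i)) = cdf (distr M borel (U 0))" by auto
qed (auto intro: real_distribution_distr)

lemma expectation_indicator_le: 
  assumes "t \<in> {0..1}"
  shows "expectation (\<lambda>\<omega>. indicator {..t} (U i \<omega>)) = t"
proof -
  have "(\<lambda>\<omega>. indicator {..t} (U i \<omega>) :: real) = indicator (U i -` {..t})" by (auto simp: indicator_def)
  then have "expectation (\<lambda>\<omega>. indicator {..t} (U i \<omega>)) = prob {\<omega> \<in> space M. U i \<omega> \<le> t}"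
    by (auto intro!: arg_cong[where f=prob])
  then show ?thesis using uniform[OF assms] by simp
qed

lemma integrable_indicator_le[simp]: "integrable M (\<lambda>\<omega>. indicator {..t} (U i \<omega>) :: real)"
  by (intro integrable_const_bound[where B=1]) auto

lemma covariance_indicator_le:
  assumes "s \<in> {0..1}" "t \<in> {0..1}"
  shows "expectation (\<lambda>\<omega>. (indicator {..s} (U i \<omega>) - s) * (indicator {..t} (U i \<omega>) - t)) = min s t - s * t"
proof -
  have "(\<lambda>\<omega>. (indicator {..s} (U i \<omega>) - s) * (indicator {..t} (U i \<omega>) - t)) =
    (\<lambda>\<omega>. indicator {..min s t} (U i \<omega>) - t * indicator {..s} (U i \<omega>) - s * indicator {..t} (U i \<omega>) + s * t)"
    by (auto simp: indicator_def algebra_simps min_def split: if_splits)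
  moreover have "min s t \<in> {0..1}" using assms by auto
  ultimately show ?thesis using assms by (simp add: expectation_indicator_le prob_space)
qed

lemma combination_mean_zero:
  assumes "finite I" "I \<subseteq> {0..1}"
  shows "expectation (\<lambda>\<omega>. \<Sum>t\<in>I. c t * (indicator {..t} (U i \<omega>) - t)) = 0"
proof -
  have "expectation (\<lambda>\<omega>. \<Sum>t\<in>I. c t * (indicator {..t} (U i \<omega>) - t)) =
    (\<Sum>t\<in>I. c t * (expectation (\<lambda>\<omega>. indicator {..t} (U i \<omega>)) - t))"
    by (subst Bochner_Integration.integral_sum) (auto simp: prob_space)
  also have "\<dots> = 0" using assms by (intro sum.neutral) (auto simp: expectation_indicator_le)
  finally show ?thesis .
qed

lemma combination_second_moment:
  assumes "finite I" "I \<subseteq> {0..1}"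
  shows "expectation (\<lambda>\<omega>. (\<Sum>t\<in>I. c t * (indicator {..t} (U i \<omega>) - t))\<^sup>2) =
    (\<Sum>s\<in>I. \<Sum>t\<in>I. c s * c t * (min s t - s * t))"
proof -
  have int: "integrable M (\<lambda>\<omega>. (indicator {..s} (U i \<omega>) - s) * (indicator {..t} (U i \<omega>) - t))"
    if "s \<in> I" "t \<in> I" for s t
  proof (rule integrable_const_bound[where B=1], rule AE_I2)
    have "\<bar>indicator {..r} (U i \<omega>) - r\<bar> \<le> 1" if "r \<in> I" for r \<omega>
      using that assms by (auto simp: indicator_def)
    then show "norm ((indicator {..s} (U i \<omega>) - s) * (indicator {..t} (U i \<omega>) - t)) \<le> 1" for \<omega>
      using that unfolding real_norm_def abs_mult by (intro mult_le_one) auto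
  qed measurable
  have "(\<lambda>\<omega>. (\<Sum>t\<in>I. c t * (indicator {..t} (U i \<omega>) - t))\<^sup>2) =
    (\<lambda>\<omega>. \<Sum>s\<in>I. \<Sum>t\<in>I. c s * c t * ((indicator {..s} (U i \<omega>) - s) * (indicator {..t} (U i \<omega>) - t)))"
    by (auto simp: power2_eq_square sum_product mult_ac intro!: ext sum.cong)
  then have "expectation (\<lambda>\<omega>. (\<Sum>t\<in>I. c t * (indicator {..t} (U i \<omega>) - t))\<^sup>2) =
    (\<Sum>s\<in>I. \<Sum>t\<in>I. c s * c t * expectation (\<lambda>\<omega>. (indicator {..s} (U i \<omega>) - s) * (indicator {..t} (U i \<omega>) - t)))"
    using int by (simp add: Bochner_Integration.integral_sum)
  also have "\<dots> = (\<Sum>s\<in>I. \<Sum>t\<in>I. c s * c t * (min s t - s * t))"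
    by (intro sum.cong refl arg_cong2[where f="(*)"] covariance_indicator_le) (use assms in auto)
  finally show ?thesis .
qed

lemma empirical_process_combination:
  "(\<Sum>t\<in>I. c t * empirical_process n t \<omega>) = (\<Sum>i<n. \<Sum>t\<in>I. c t * (indicator {..t} (U i \<omega>) - t)) / sqrt n"
  unfolding empirical_process_def
  by (subst sum.swap) (simp add: sum_distrib_left sum_divide_distrib)

lemma empirical_process_second_moment:
  assumes "t \<in> {0..1}"
  shows "integrable M (\<lambda>\<omega>. (empirical_process n t \<omega>)\<^sup>2)"
    "expectation (\<lambda>\<omega>. (empirical_process n t \<omega>)\<^sup>2) \<le> 1"
proof -
  have ci: "\<bar>(\<Sum>i<n. indicator {..t} (U i \<omega>) - t)\<bar> \<le> n" for \<omega>
    using assms by (intro order_trans[OF sum_abs] order_trans[OF sum_bounded_above[where K=1]]) (auto simp: indicator_def)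
  show "integrable M (\<lambda>\<omega>. (empirical_process n t \<omega>)\<^sup>2)"
  proof (rule integrable_const_bound[where B="(n / sqrt n)\<^sup>2"], rule AE_I2)
    fix \<omega> show "norm ((empirical_process n t \<omega>)\<^sup>2) \<le> (n / sqrt n)\<^sup>2"
      unfolding empirical_process_def norm_power using ci[of \<omega>]
      by (intro power_mono) (auto intro!: divide_right_mono)
  qed measurable
  define Y where "Y i \<omega> = indicator {..t} (U i \<omega>) - t" for i \<omega>
  have iY: "indep_vars (\<lambda>_. borel) Y UNIV" unfolding Y_def by (rule indep_vars_compose2[OF indep]) measurable
  have v: "expectation (\<lambda>\<omega>. (Y i \<omega>)\<^sup>2) = t - t * t" "expectation (Y i) = 0" for i
    using expectation_indicator_le[OF assms, of i] combination_second_moment[of "{t}" "\<lambda>_. 1" i] assms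
    by (auto simp: Y_def[abs_def] prob_space)
  have b: "\<bar>Y i \<omega>\<bar> \<le> 1" for i \<omega> using assms by (auto simp: Y_def indicator_def)
  have Ym[measurable]: "Y i \<in> borel_measurable M" for i unfolding Y_def by measurable
  have m4: "expectation (\<lambda>\<omega>. (Y i \<omega>)^4) \<le> 1" for i
  proof -
    have "norm ((Y i \<omega>)^4) \<le> 1" for \<omega> using power_le_one[OF abs_ge_zero b[of i \<omega>], of 4] by simp
    then have "integrable M (\<lambda>\<omega>. (Y i \<omega>)^4)" by (intro integrable_const_bound[where B=1] AE_I2) measurable
    from integral_mono[OF this integrable_const, of 1] show ?thesis
      using \<open>\<And>\<omega>. norm ((Y i \<omega>)^4) \<le> 1\<close> by (simp add: prob_space)
  qed
  have *: "expectation (\<lambda>\<omega>. (\<Sum>i<n. Y i \<omega>)\<^sup>2) = n * (t - t * t)"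
    by (rule sum_moments(2)[OF iY b v(2) _ m4]) (use v in simp)
  have "(\<lambda>\<omega>. (empirical_process n t \<omega>)\<^sup>2) = (\<lambda>\<omega>. (\<Sum>i<n. Y i \<omega>)\<^sup>2 / n)"
    by (auto simp: empirical_process_def Y_def power_divide)
  then have "expectation (\<lambda>\<omega>. (empirical_process n t \<omega>)\<^sup>2) = n * (t - t * t) / n" by (simp add: *)
  also have "\<dots> \<le> 1"
  proof -
    have "0 \<le> t * t" "t \<le> 1" using assms by auto
    then have "t - t * t \<le> 1" by linarith
    then show ?thesis by (cases "n = 0") simp_all
  qed
  finally show "expectation (\<lambda>\<omega>. (empirical_process n t \<omega>)\<^sup>2) \<le> 1" .
qed

text \<open>A fixed linear combination of the process is a normalised sum of bounded, centred,
  independent and identically distributed variables, so the one-dimensional central limit theorem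
  applies.\<close>

lemma combination_cos_tendsto:
  fixes c :: "real \<Rightarrow> real"
  assumes I: "finite I" "I \<subseteq> {0..1}"
  defines "v \<equiv> \<Sum>s\<in>I. \<Sum>t\<in>I. c s * c t * (min s t - s * t)"
  shows "(\<lambda>n. expectation (\<lambda>\<omega>. cos ((\<Sum>t\<in>I. c t * empirical_process n t \<omega>) + d)))
    \<longlonglongrightarrow> (\<integral>x. cos (x + d) \<partial>centered_normal v)"
proof -
  define Y where "Y i \<omega> = (\<Sum>t\<in>I. c t * (indicator {..t} (U i \<omega>) - t))" for i \<omega>
  have comb: "(\<Sum>t\<in>I. c t * empirical_process n t \<omega>) = (\<Sum>i<n. Y i \<omega>) / sqrt n" for n \<omega>
    unfolding Y_def by (rule empirical_process_combination)
  have Ym[measurable]: "Y i \<in> borel_measurable M" for i unfolding Y_def by measurable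
  have mean: "expectation (Y i) = 0" for i unfolding Y_def by (rule combination_mean_zero[OF I])
  have sec: "expectation (\<lambda>\<omega>. (Y i \<omega>)\<^sup>2) = v" for i unfolding Y_def v_def by (rule combination_second_moment[OF I])
  have Yb: "\<bar>Y i \<omega>\<bar> \<le> (\<Sum>t\<in>I. \<bar>c t\<bar>)" for i \<omega>
    unfolding Y_def using I(2)
    by (intro order_trans[OF sum_abs] sum_mono) (auto simp: abs_mult indicator_def intro!: mult_left_le)
  have sq: "integrable M (\<lambda>\<omega>. (Y i \<omega>)\<^sup>2)" for i
  proof (rule integrable_const_bound[where B="(\<Sum>t\<in>I. \<bar>c t\<bar>)\<^sup>2"], rule AE_I2)
    fix \<omega> show "norm ((Y i \<omega>)\<^sup>2) \<le> (\<Sum>t\<in>I. \<bar>c t\<bar>)\<^sup>2" using power_mono[OF Yb, of i \<omega> 2] by simp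
  qed measurable
  have v0: "0 \<le> v" unfolding sec[of 0, symmetric] by simp
  show ?thesis
  proof (cases "v = 0")
    \<comment> \<open>The central limit theorem needs a positive variance. For \<open>v = 0\<close>
      the combination vanishes almost surely and the limit law is the point mass at 0.\<close>
    case True
    have "AE \<omega> in M. Y i \<omega> = 0" for i
    proof -
      have "AE \<omega> in M. (Y i \<omega>)\<^sup>2 = 0"
        using integral_nonneg_eq_0_iff_AE[OF sq, of i] sec[of i] True by simp
      then show ?thesis by simp
    qed
    then have "AE \<omega> in M. \<forall>i. Y i \<omega> = 0" by (simp add: AE_all_countable)
    then have "expectation (\<lambda>\<omega>. cos ((\<Sum>i<n. Y i \<omega>) / sqrt n + d)) = expectation (\<lambda>\<omega>. cos d)" for n
    proof (intro integral_cong_AE)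
      assume *: "AE \<omega> in M. \<forall>i. Y i \<omega> = 0"
      show "AE \<omega> in M. cos ((\<Sum>i<n. Y i \<omega>) / sqrt n + d) = cos d"
        using * by eventually_elim simp
    qed measurable
    moreover have "(\<integral>x. cos (x + d) \<partial>centered_normal v) = cos d"
      using True by (simp add: centered_normal_def integral_return)
    ultimately show ?thesis unfolding comb by (simp add: prob_space)
  next
    case False
    define \<sigma> where "\<sigma> = sqrt v"
    have \<sigma>: "0 < \<sigma>" "\<sigma>\<^sup>2 = v" using False v0 by (auto simp: \<sigma>_def)
    have iY: "indep_vars (\<lambda>_. borel) Y UNIV"
      unfolding Y_def by (rule indep_vars_compose2[OF indep]) measurable
    have d1: "distr M borel (Y n) = distr (distr M borel (U n)) borel (\<lambda>u. \<Sum>t\<in>I. c t * (indicator {..t} u - t))" for n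
      unfolding Y_def by (subst distr_distr) (auto simp: comp_def)
    have dY: "distr M borel (Y n) = distr M borel (Y 0)" for n
      unfolding d1[of n] d1[of 0] identically_distributed[of n] ..
    have wc: "weak_conv_m (\<lambda>n. distr M borel (\<lambda>x. (\<Sum>i<n. Y i x) / sqrt (n * \<sigma>\<^sup>2))) std_normal_distribution"
      by (rule central_limit_theorem_zero_mean[OF iY mean \<sigma>(1) sq _ dY]) (simp add: mean sec \<sigma>)
    have "(\<lambda>n. \<integral>x. cos (\<sigma> * x + d) \<partial>distr M borel (\<lambda>x. (\<Sum>i<n. Y i x) / sqrt (n * \<sigma>\<^sup>2)))
        \<longlonglongrightarrow> (\<integral>x. cos (\<sigma> * x + d) \<partial>std_normal_distribution)"
      by (rule weak_conv_imp_integral_bdd_continuous_conv[OF _ real_dist_normal_dist wc, where B=1])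
        (auto intro!: real_distribution_distr)
    moreover have "(\<integral>x. cos (\<sigma> * x + d) \<partial>distr M borel (\<lambda>x. (\<Sum>i<n. Y i x) / sqrt (n * \<sigma>\<^sup>2))) =
        expectation (\<lambda>\<omega>. cos ((\<Sum>t\<in>I. c t * empirical_process n t \<omega>) + d))" for n
      using \<sigma>(1) by (subst integral_distr) (auto simp: comb real_sqrt_mult)
    moreover have "(\<integral>x. cos (\<sigma> * x + d) \<partial>std_normal_distribution) = (\<integral>x. cos (x + d) \<partial>centered_normal v)"
    proof -
      interpret S: prob_space std_normal_distribution by (rule prob_space_normal_density) simp
      have "distributed std_normal_distribution lborel (\<lambda>x. x) (normal_density 0 1)"
        unfolding distributed_def by (auto simp: distr_id2)
      from S.normal_density_affine[OF this, of \<sigma> 0] \<sigma>(1)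
      have "distributed std_normal_distribution lborel (\<lambda>x. \<sigma> * x) (normal_density 0 \<sigma>)" by simp
      then have e: "distr std_normal_distribution lborel (\<lambda>x. \<sigma> * x) = centered_normal v"
        using False by (simp add: distributed_def centered_normal_def \<sigma>_def)
      show ?thesis unfolding e[symmetric] by (subst integral_distr) auto
    qed
    ultimately show ?thesis by simp
  qed
qed

end

section \<open>Maximal inequalities for the empirical process and their transfer to the
  bridge\<close>

context uniform_sample begin

lemma prob_between:
  assumes "0 \<le> s" "s \<le> t" "t \<le> 1"
  shows "prob {\<omega> \<in> space M. U i \<omega> \<in> {s<..t}} = t - s"
proof -
  have "{\<omega> \<in> space M. U i \<omega> \<in> {s<..t}} = {\<omega> \<in> space M. U i \<omega> \<le> t} - {\<omega> \<in> space M. U i \<omega> \<le> s}" by auto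
  also have "prob \<dots> = prob {\<omega> \<in> space M. U i \<omega> \<le> t} - prob {\<omega> \<in> space M. U i \<omega> \<le> s}"
    using assms by (intro finite_measure_Diff) auto
  finally show ?thesis using assms uniform by simp
qed

lemma empirical_process_eq: "(\<Sum>i<n. indicator {..t} (U i \<omega>)) - real n * t = sqrt n * empirical_process n t \<omega>"
  by (simp add: empirical_process_def sum_subtractf)

lemma maximal_low:
  assumes h: "0 < h" "h \<le> 1/2" and a: "0 < a" and n: "0 < n"
  obtains E where "E \<in> events" "prob E \<le> 8 * h / a^2"
    "\<And>\<omega> t. \<omega> \<in> space M - E \<Longrightarrow> t \<in> {0..h} \<Longrightarrow> \<bar>empirical_process n t \<omega>\<bar> \<le> a"
proof -
  have p: "prob {\<omega> \<in> space M. U i \<omega> \<in> {..t}} = t" if "t \<in> {0..h}" for i t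
    using uniform[of t i] that h by auto
  obtain E where E: "E \<in> events" "prob E \<le> 8 * h / a^2"
    "\<And>\<omega> t. \<omega> \<in> space M - E \<Longrightarrow> t \<in> {0..h} \<Longrightarrow> \<bar>(\<Sum>i<n. indicator ({..t}) (U i \<omega>)) - real n * t\<bar> \<le> sqrt n * a"
  proof (rule increasing_sets_maximal[OF indep h a n, of "\<lambda>t. {..t}"], goal_cases)
    case 2 then show ?case by auto
  next
    case 3 from 3(2) show ?case by (rule p)
  next
    case (4 E) show ?case using 4(1)[OF 4(2,3,5)] by blast
  qed simp
  show ?thesis
  proof (rule that[OF E(1,2)])
    fix \<omega> t assume "\<omega> \<in> space M - E" "t \<in> {0..h}"
    from E(3)[OF this] show "\<bar>empirical_process n t \<omega>\<bar> \<le> a"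
      using n by (simp add: empirical_process_eq abs_mult)
  qed
qed

text \<open>At the upper end the increasing chain is \<open>{1 - t<..}\<close>, whose centred count
  is minus that of \<open>{..1 - t}\<close>; hence the same constant as at the lower end.\<close>

lemma maximal_high:
  assumes h: "0 < h" "h \<le> 1/2" and a: "0 < a" and n: "0 < n"
  obtains E where "E \<in> events" "prob E \<le> 8 * h / a^2"
    "\<And>\<omega> t. \<omega> \<in> space M - E \<Longrightarrow> t \<in> {0..h} \<Longrightarrow> \<bar>empirical_process n (1 - t) \<omega>\<bar> \<le> a"
proof -
  have p: "prob {\<omega> \<in> space M. U i \<omega> \<in> {1 - t<..}} = t" if "t \<in> {0..h}" for i t
  proof -
    have "prob {\<omega> \<in> space M. \<not> U i \<omega> \<le> 1 - t} = 1 - (1 - t)"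
      using prob_neg[of "\<lambda>\<omega>. U i \<omega> \<le> 1 - t"] uniform[of "1 - t" i] that h by auto
    then show ?thesis by (simp add: not_le)
  qed
  obtain E where E: "E \<in> events" "prob E \<le> 8 * h / a^2"
    "\<And>\<omega> t. \<omega> \<in> space M - E \<Longrightarrow> t \<in> {0..h} \<Longrightarrow> \<bar>(\<Sum>i<n. indicator ({1 - t<..}) (U i \<omega>)) - real n * t\<bar> \<le> sqrt n * a"
  proof (rule increasing_sets_maximal[OF indep h a n, of "\<lambda>t. {1 - t<..}"], goal_cases)
    case 2 then show ?case by auto
  next
    case 3 from 3(2) show ?case by (rule p)
  next
    case (4 E) show ?case using 4(1)[OF 4(2,3,5)] by blast
  qed simp
  show ?thesis
  proof (rule that[OF E(1,2)])
    fix \<omega> t assume *: "\<omega> \<in> space M - E" "t \<in> {0..h}"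
    have "(\<Sum>i<n. indicator {1 - t<..} (U i \<omega>)) = (\<Sum>i<n. 1 - indicator {..1 - t} (U i \<omega>) :: real)"
      by (intro sum.cong) (auto simp: indicator_def)
    then have "(\<Sum>i<n. indicator {1 - t<..} (U i \<omega>)) - real n * t = - (sqrt n * empirical_process n (1 - t) \<omega>)"
      unfolding empirical_process_eq[symmetric] by (simp add: sum_subtractf algebra_simps)
    with E(3)[OF *] have "\<bar>- (sqrt n * empirical_process n (1 - t) \<omega>)\<bar> \<le> sqrt n * a" by simp
    then show "\<bar>empirical_process n (1 - t) \<omega>\<bar> \<le> a"
      using n by (simp add: abs_mult)
  qed
qed

text \<open>The chain \<open>{s<..s + t}\<close> is empty at \<open>t = 0\<close>, so the general
  inequality applies to increments from any \<open>s\<close>. The fourth-moment bound is kept: being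
  of order \<open>h^2 + h / n\<close>, it stays small when summed over \<open>1 / h\<close> cells
  with \<open>n\<close> at least \<open>1 / h\<close>.\<close>

lemma maximal_increment:
  assumes h: "0 < h" "h \<le> 1/2" and a: "0 < a" and n: "0 < n" and s: "0 \<le> s" "s + h \<le> 1"
  obtains E where "E \<in> events" "prob E \<le> 32 * (h / n + 6 * h^2) / a^4"
    "\<And>\<omega> t. \<omega> \<in> space M - E \<Longrightarrow> t \<in> {0..h} \<Longrightarrow> \<bar>empirical_process n (s + t) \<omega> - empirical_process n s \<omega>\<bar> \<le> a"
proof -
  have p: "prob {\<omega> \<in> space M. U i \<omega> \<in> {s<..s + t}} = t" if "t \<in> {0..h}" for i t
    using prob_between[of s "s + t" i] that s by auto
  have mono: "{s<..s + t} \<subseteq> {s<..s + t'}" if "t \<le> t'" for t t' using that by auto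
  obtain E where E: "E \<in> events" "prob E \<le> 32 * (h / n + 6 * h^2) / a^4"
    "\<And>\<omega> t. \<omega> \<in> space M - E \<Longrightarrow> t \<in> {0..h} \<Longrightarrow> \<bar>(\<Sum>i<n. indicator ({s<..s + t}) (U i \<omega>)) - real n * t\<bar> \<le> sqrt n * a"
  proof (rule increasing_sets_maximal[OF indep h a n, of "\<lambda>t. {s<..s + t}"], goal_cases)
    case 2 then show ?case by auto
  next
    case 3 from 3(2) show ?case by (rule p)
  next
    case (4 E) show ?case using 4(1)[OF 4(2,4,5)] by blast
  qed simp
  show ?thesis
  proof (rule that[OF E(1,2)])
    fix \<omega> t assume *: "\<omega> \<in> space M - E" "t \<in> {0..h}"
    have "(\<Sum>i<n. indicator {s<..s + t} (U i \<omega>)) = (\<Sum>i<n. indicator {..s + t} (U i \<omega>) - indicator {..s} (U i \<omega>) :: real)"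
      using *(2) by (intro sum.cong) (auto simp: indicator_def)
    then have "(\<Sum>i<n. indicator {s<..s + t} (U i \<omega>)) - real n * t = sqrt n * empirical_process n (s + t) \<omega> - sqrt n * empirical_process n s \<omega>"
      unfolding empirical_process_eq[symmetric] by (simp add: sum_subtractf algebra_simps)
    also have "\<dots> = sqrt n * (empirical_process n (s + t) \<omega> - empirical_process n s \<omega>)" by (simp add: algebra_simps)
    finally have "\<bar>sqrt n * (empirical_process n (s + t) \<omega> - empirical_process n s \<omega>)\<bar> \<le> sqrt n * a" using E(3)[OF *] by simp
    then show "\<bar>empirical_process n (s + t) \<omega> - empirical_process n s \<omega>\<bar> \<le> a"
      using n by (simp add: abs_mult)
  qed
qed

lemma finite_dimensional_convergence:
  fixes f :: "(nat \<Rightarrow> real) \<Rightarrow> real"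
  assumes B: "brownian_bridge N B" and \<tau>: "\<And>i. i < m \<Longrightarrow> \<tau> i \<in> {0..1}"
    and lip: "\<And>x y. \<bar>f x - f y\<bar> \<le> K * (\<Sum>i<m. \<bar>x i - y i\<bar>)" and bdd: "\<And>x. \<bar>f x\<bar> \<le> b"
  shows "(\<lambda>n. expectation (\<lambda>\<omega>. f (\<lambda>i. empirical_process n (\<tau> i) \<omega>))) \<longlonglongrightarrow> (\<integral>\<omega>. f (\<lambda>i. B (\<tau> i) \<omega>) \<partial>N)"
    and "\<And>n. (\<lambda>\<omega>. f (\<lambda>i. empirical_process n (\<tau> i) \<omega>)) \<in> borel_measurable M"
    and "(\<lambda>\<omega>. f (\<lambda>i. B (\<tau> i) \<omega>)) \<in> borel_measurable N"
proof -
  have pN: "prob_space N" and Bm: "\<And>t. t \<in> {0..1} \<Longrightarrow> B t \<in> borel_measurable N"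
    and Bd: "\<And>I c. finite I \<Longrightarrow> I \<subseteq> {0..1} \<Longrightarrow>
        distr N borel (\<lambda>\<omega>. \<Sum>t\<in>I. c t * B t \<omega>) = centered_normal (\<Sum>s\<in>I. \<Sum>t\<in>I. c s * c t * (min s t - s * t))"
    using B unfolding brownian_bridge_def by auto
  define I where "I = \<tau> ` {..<m}"
  have I: "finite I" "I \<subseteq> {0..1}" using \<tau> by (auto simp: I_def)
  \<comment> \<open>The points \<open>\<tau> i\<close> may coincide, whereas the law of the bridge
    is given for combinations over a set of points; coefficients of equal points are merged.\<close>
  have group: "(\<Sum>i<m. v i * g (\<tau> i)) = (\<Sum>t\<in>I. (\<Sum>i\<in>{i. i < m \<and> \<tau> i = t}. v i) * g t)" for v g :: "_ \<Rightarrow> real"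
  proof -
    have "(\<Sum>i<m. v i * g (\<tau> i)) = (\<Sum>t\<in>I. \<Sum>i\<in>{i\<in>{..<m}. \<tau> i = t}. v i * g (\<tau> i))"
      unfolding I_def by (rule sum.image_gen) simp
    also have "\<dots> = (\<Sum>t\<in>I. (\<Sum>i\<in>{i. i < m \<and> \<tau> i = t}. v i) * g t)"
      by (intro sum.cong refl) (simp add: sum_distrib_right)
    finally show ?thesis .
  qed
  have cos: "(\<lambda>n. \<integral>\<omega>. cos ((\<Sum>i<m. v i * empirical_process n (\<tau> i) \<omega>) + d) \<partial>M)
      \<longlonglongrightarrow> (\<integral>\<omega>. cos ((\<Sum>i<m. v i * B (\<tau> i) \<omega>) + d) \<partial>N)" for v d
  proof -
    let ?c = "\<lambda>t. \<Sum>i\<in>{i. i < m \<and> \<tau> i = t}. v i"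
    have "(\<lambda>\<omega>. \<Sum>t\<in>I. ?c t * B t \<omega>) \<in> borel_measurable N"
      using I by (intro borel_measurable_sum borel_measurable_times Bm) auto
    then have "(\<integral>x. cos (x + d) \<partial>distr N borel (\<lambda>\<omega>. \<Sum>t\<in>I. ?c t * B t \<omega>)) = (\<integral>\<omega>. cos ((\<Sum>t\<in>I. ?c t * B t \<omega>) + d) \<partial>N)"
      by (subst integral_distr) auto
    then show ?thesis
      using combination_cos_tendsto[OF I, of ?c d] unfolding Bd[OF I]
        group[of v "\<lambda>t. empirical_process n t \<omega>" for n \<omega>] group[of v "\<lambda>t. B t \<omega>" for \<omega>] by simp
  qed
  have Xm: "empirical_process n (\<tau> i) \<in> borel_measurable M" if "i < m" for n i by measurable
  have Ym: "B (\<tau> i) \<in> borel_measurable N" if "i < m" for i using Bm \<tau>[OF that] by blast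
  note CW = Cramer_Wold_Lipschitz[where X="\<lambda>n i. empirical_process n (\<tau> i)" and Y="\<lambda>i. B (\<tau> i)",
      OF prob_space_axioms pN Xm Ym cos empirical_process_second_moment(1)[OF \<tau>] empirical_process_second_moment(2)[OF \<tau>] lip bdd]
  show "(\<lambda>n. expectation (\<lambda>\<omega>. f (\<lambda>i. empirical_process n (\<tau> i) \<omega>))) \<longlonglongrightarrow> (\<integral>\<omega>. f (\<lambda>i. B (\<tau> i) \<omega>) \<partial>N)"
    using CW(1) by simp
  show "(\<lambda>\<omega>. f (\<lambda>i. empirical_process n (\<tau> i) \<omega>)) \<in> borel_measurable M" for n
    using CW(2) by simp
  show "(\<lambda>\<omega>. f (\<lambda>i. B (\<tau> i) \<omega>)) \<in> borel_measurable N"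
    using CW(3) by simp
qed

text \<open>The halved level for the empirical process leaves room for a continuous test function,
  so convergence of expectations carries the bound to finitely many points of \<open>D\<close>.
  Continuity of the measure from below then gives all of \<open>D\<close>.\<close>

lemma bridge_maximal:
  assumes B: "brownian_bridge N B" and D: "countable D" "D \<subseteq> {0..1}" and a: "0 < a"
    and max: "\<And>n. 0 < n \<Longrightarrow> \<exists>E\<in>events. prob E \<le> p \<and> (\<forall>\<omega>\<in>space M - E. \<forall>t\<in>D. \<bar>empirical_process n t \<omega>\<bar> \<le> a / 2)"
  shows "measure N {\<omega> \<in> space N. \<exists>t\<in>D. a < \<bar>B t \<omega>\<bar>} \<le> p"
proof (cases "D = {}")
  case True
  obtain E where "prob E \<le> p" using max[of 1] by auto
  then have "0 \<le> p" using measure_nonneg[of M E] by linarith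
  then show ?thesis using True by simp
next
  case False
  interpret N: prob_space N using B by (simp add: brownian_bridge_def)
  define \<tau> where "\<tau> = from_nat_into D"
  have \<tau>: "\<tau> i \<in> D" for i unfolding \<tau>_def by (rule from_nat_into[OF False])
  have D\<tau>: "D = range \<tau>" unfolding \<tau>_def using D(1) False by (simp add: range_from_nat_into)
  have \<tau>1: "\<tau> i \<in> {0..1}" for i using \<tau>[of i] D(2) by blast
  have Bm[measurable]: "B (\<tau> i) \<in> borel_measurable N" for i using B \<tau>1 by (simp add: brownian_bridge_def)
  define A where "A m = {\<omega> \<in> space N. \<exists>i<m. a < \<bar>B (\<tau> i) \<omega>\<bar>}" for m
  have Am[measurable]: "A m \<in> sets N" for m unfolding A_def by measurable
  have "range A \<subseteq> sets N" using Am by blast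
  moreover have "incseq A" unfolding A_def by (auto simp: incseq_def intro: less_le_trans)
  moreover have "(\<Union>m. A m) = {\<omega> \<in> space N. \<exists>t\<in>D. a < \<bar>B t \<omega>\<bar>}" unfolding A_def D\<tau> by auto
  ultimately have lim: "(\<lambda>m. measure N (A m)) \<longlonglongrightarrow> measure N {\<omega> \<in> space N. \<exists>t\<in>D. a < \<bar>B t \<omega>\<bar>}"
    using N.finite_Lim_measure_incseq[of A] by simp
  have "measure N (A m) \<le> p" for m
  proof -
    \<comment> \<open>The ramp is 0 for \<open>\<bar>y\<bar> \<le> a / 2\<close> and reaches 1 at
      \<open>\<bar>y\<bar> = a\<close>. Hence \<open>f\<close> is 0 if no coordinate passes
      \<open>a / 2\<close> and 1 as soon as one passes \<open>a\<close>.\<close>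
    define g where "g y = max 0 (2 / a * \<bar>y\<bar> - 1)" for y :: real
    define f where "f x = min 1 (\<Sum>i<m. g (x i))" for x :: "nat \<Rightarrow> real"
    have g0: "0 \<le> g y" for y by (simp add: g_def)
    have gl: "\<bar>g x - g y\<bar> \<le> 2 / a * \<bar>x - y\<bar>" for x y
    proof -
      have c: "0 < 2 / a" using a by simp
      have "\<bar>g x - g y\<bar> \<le> \<bar>2 / a * \<bar>x\<bar> - 2 / a * \<bar>y\<bar>\<bar>" unfolding g_def by linarith
      also have "\<dots> = 2 / a * \<bar>\<bar>x\<bar> - \<bar>y\<bar>\<bar>"
        by (simp only: right_diff_distrib[symmetric] abs_mult abs_of_pos[OF c])
      also have "\<dots> \<le> 2 / a * \<bar>x - y\<bar>" using a by (intro mult_left_mono) auto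
      finally show ?thesis .
    qed
    have lip: "\<bar>f x - f y\<bar> \<le> 2 / a * (\<Sum>i<m. \<bar>x i - y i\<bar>)" for x y
    proof -
      have "\<bar>f x - f y\<bar> \<le> \<bar>(\<Sum>i<m. g (x i)) - (\<Sum>i<m. g (y i))\<bar>" unfolding f_def by linarith
      also have "\<dots> = \<bar>\<Sum>i<m. g (x i) - g (y i)\<bar>" by (simp add: sum_subtractf)
      also have "\<dots> \<le> (\<Sum>i<m. 2 / a * \<bar>x i - y i\<bar>)" by (intro order_trans[OF sum_abs] sum_mono gl)
      finally show ?thesis by (simp add: sum_distrib_left)
    qed
    have f01: "0 \<le> f x" "f x \<le> 1" for x unfolding f_def using g0 by (auto intro: sum_nonneg)
    then have bdd: "\<bar>f x\<bar> \<le> 1" for x by simp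
    note FD = finite_dimensional_convergence[OF B, of m \<tau> f, OF \<tau>1 lip bdd]
    have le: "expectation (\<lambda>\<omega>. f (\<lambda>i. empirical_process n (\<tau> i) \<omega>)) \<le> p" if n0: "0 < n" for n
    proof -
      obtain E where E: "E \<in> events" "prob E \<le> p" "\<And>\<omega> t. \<omega> \<in> space M - E \<Longrightarrow> t \<in> D \<Longrightarrow> \<bar>empirical_process n t \<omega>\<bar> \<le> a / 2"
        using max[OF n0] by blast
      have "f (\<lambda>i. empirical_process n (\<tau> i) \<omega>) \<le> indicator E \<omega>" if "\<omega> \<in> space M" for \<omega>
      proof (cases "\<omega> \<in> E")
        case False
        have "g (empirical_process n (\<tau> i) \<omega>) = 0" for i
        proof -
          have "2 / a * \<bar>empirical_process n (\<tau> i) \<omega>\<bar> \<le> 2 / a * (a / 2)"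
            using E(3)[of \<omega> "\<tau> i"] False that \<tau> a by (intro mult_left_mono) auto
          then show ?thesis using a by (simp add: g_def)
        qed
        then show ?thesis by (simp add: f_def)
      qed (simp add: f01)
      then have "expectation (\<lambda>\<omega>. f (\<lambda>i. empirical_process n (\<tau> i) \<omega>)) \<le> expectation (indicator E)"
        using FD(2) f01 E(1) by (intro integral_mono integrable_const_bound[where B=1]) (auto simp: indicator_def)
      then show ?thesis using E(1,2) by simp
    qed
    have "(\<integral>\<omega>. f (\<lambda>i. B (\<tau> i) \<omega>) \<partial>N) \<le> p"
      by (rule LIMSEQ_le_const2[OF FD(1)]) (use le in \<open>auto intro!: exI[of _ 1]\<close>)
    moreover have "measure N (A m) \<le> (\<integral>\<omega>. f (\<lambda>i. B (\<tau> i) \<omega>) \<partial>N)"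
    proof -
      have "indicator (A m) \<omega> \<le> f (\<lambda>i. B (\<tau> i) \<omega>)" for \<omega>
      proof (cases "\<omega> \<in> A m")
        case True
        then obtain i where i: "i < m" "a < \<bar>B (\<tau> i) \<omega>\<bar>" by (auto simp: A_def)
        have "2 / a * a \<le> 2 / a * \<bar>B (\<tau> i) \<omega>\<bar>" using i(2) a by (intro mult_left_mono) auto
        then have "1 \<le> g (B (\<tau> i) \<omega>)" using a by (simp add: g_def)
        also have "\<dots> \<le> (\<Sum>i<m. g (B (\<tau> i) \<omega>))" using member_le_sum[of i "{..<m}" "\<lambda>i. g (B (\<tau> i) \<omega>)"] i(1) g0 by auto
        finally show ?thesis using True by (simp add: f_def)
      qed (simp add: f01)
      then have "(\<integral>\<omega>. indicator (A m) \<omega> \<partial>N) \<le> (\<integral>\<omega>. f (\<lambda>i. B (\<tau> i) \<omega>) \<partial>N)"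
        using FD(3) f01 by (intro integral_mono N.integrable_const_bound[where B=1]) (auto simp: indicator_def)
      then show ?thesis by simp
    qed
    ultimately show ?thesis by simp
  qed
  then show ?thesis by (intro LIMSEQ_le_const2[OF lim]) auto
qed

end

section \<open>Bounds for the Bernoulli divergence; weighted tails, equicontinuity and the null
  statistic\<close>

lemma bern_KL_le_chi_square:
  assumes "0 \<le> p" "p \<le> 1" "0 < f" "f < 1"
  shows "bern_KL p f \<le> (p - f)\<^sup>2 / (f * (1 - f))"
proof -
  have *: "x * ln (x / y) \<le> x * (x / y - 1)" if "0 \<le> x" "0 < y" for x y :: real
    using that ln_le_minus_one[of "x / y"] by (cases "x = 0") (auto intro!: mult_left_mono)
  have "bern_KL p f \<le> p * (p / f - 1) + (1 - p) * ((1 - p) / (1 - f) - 1)"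
    unfolding bern_KL_def using assms by (intro add_mono *) auto
  also have "\<dots> = (p - f)\<^sup>2 / (f * (1 - f))"
    using assms by (simp add: divide_simps power2_eq_square) (simp add: algebra_simps)
  finally show ?thesis .
qed

text \<open>From \<open>ln z \<le> z - 1\<close> at \<open>z = y / x\<close> one gets
  \<open>x * ln (x / y) \<ge> x - y\<close>; the lower bounds for the two summands add up to
  0.\<close>

lemma bern_KL_nonneg:
  assumes "0 \<le> p" "p \<le> 1" "0 < f" "f < 1"
  shows "0 \<le> bern_KL p f"
proof -
  have *: "x - y \<le> x * ln (x / y)" if "0 \<le> x" "0 < y" for x y :: real
  proof (cases "x = 0")
    case False
    then have "x * ln (y / x) \<le> x * (y / x - 1)"
      using that ln_le_minus_one[of "y / x"] by (intro mult_left_mono) auto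
    then show ?thesis using that False by (simp add: ln_div algebra_simps)
  qed (use that in simp)
  show ?thesis
    unfolding bern_KL_def using *[of p f] *[of "1 - p" "1 - f"] assms by linarith
qed

lemma dyadic_block:
  fixes t :: real
  assumes "0 < t" "t \<le> 1/2"
  obtains k where "1 \<le> k" "1 / 2^(k + 1) < t" "t \<le> 1 / 2^k"
proof -
  define P where "P j \<longleftrightarrow> (1/2)^j < t" for j :: nat
  obtain j where "P j" using real_arch_pow_inv[OF assms(1), of "1/2"] by (auto simp: P_def)
  then have L: "P (LEAST j. P j)" by (rule LeastI)
  have "(LEAST j. P j) \<noteq> 0" "(LEAST j. P j) \<noteq> 1" using L assms by (auto simp: P_def intro: ccontr)
  then obtain k where k: "(LEAST j. P j) = Suc k" "1 \<le> k" by (metis One_nat_def Suc_le_eq not0_implies_Suc not_gr_zero)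
  have "\<not> P k" using not_less_Least[of k P] k(1) by simp
  then show ?thesis using that[of k] k L by (simp add: P_def power_one_over)
qed

context uniform_sample begin

text \<open>Union bound over the scales \<open>k \<ge> K\<close>: both ends together contribute
  \<open>16 w_k^2 2^-k / a^2\<close>, so the sum is the tail of a convergent series. The estimate on
  each scale is uniform in \<open>n\<close>, hence so is \<open>K\<close>.\<close>

lemma weighted_tail:
  assumes w: "\<And>k. 0 < w k" and sum: "summable (\<lambda>k. (w k)^2 / 2^k)" and a: "0 < a" and d: "0 < d"
  shows "\<exists>K\<ge>1. \<forall>n>0. \<exists>E\<in>events. prob E \<le> d \<and> (\<forall>\<omega>\<in>space M - E. \<forall>k\<ge>K. \<forall>t\<in>{0..1/2^k}.
    \<bar>empirical_process n t \<omega>\<bar> * w k \<le> a \<and> \<bar>empirical_process n (1 - t) \<omega>\<bar> * w k \<le> a)"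
proof -
  define c where "c k = 16 * ((w k)^2 / 2^k) / a^2" for k
  have c: "summable c" unfolding c_def using sum by (intro summable_divide summable_mult)
  obtain K0 where K0: "\<And>n. n \<ge> K0 \<Longrightarrow> norm (\<Sum>i. c (i + n)) < d" using suminf_exist_split[OF d c] by blast
  define K where "K = max 1 K0"
  have K: "1 \<le> K" "(\<Sum>i. c (i + K)) \<le> d" using K0[of K] by (auto simp: K_def)
  have "\<exists>E\<in>events. prob E \<le> d \<and> (\<forall>\<omega>\<in>space M - E. \<forall>k\<ge>K. \<forall>t\<in>{0..1/2^k}.
    \<bar>empirical_process n t \<omega>\<bar> * w k \<le> a \<and> \<bar>empirical_process n (1 - t) \<omega>\<bar> * w k \<le> a)" if n: "0 < n" for n
  proof -
    have "\<exists>E. E \<in> events \<and> prob E \<le> c k \<and> (\<forall>\<omega>\<in>space M - E. \<forall>t\<in>{0..1/2^k}.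
      \<bar>empirical_process n t \<omega>\<bar> * w k \<le> a \<and> \<bar>empirical_process n (1 - t) \<omega>\<bar> * w k \<le> a)" if "1 \<le> k" for k
    proof -
      have "(2::real)^1 \<le> 2^k" using that by (intro power_increasing) auto
      then have h: "0 < 1 / (2::real)^k" "1 / (2::real)^k \<le> 1/2" by (auto simp: divide_simps)
      have ak: "0 < a / w k" using a w by simp
      obtain E1 where E1: "E1 \<in> events" "prob E1 \<le> 8 * (1 / 2^k) / (a / w k)^2"
        "\<And>\<omega> t. \<omega> \<in> space M - E1 \<Longrightarrow> t \<in> {0..1/2^k} \<Longrightarrow> \<bar>empirical_process n t \<omega>\<bar> \<le> a / w k"
        using maximal_low[OF h ak n] by blast
      obtain E2 where E2: "E2 \<in> events" "prob E2 \<le> 8 * (1 / 2^k) / (a / w k)^2"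
        "\<And>\<omega> t. \<omega> \<in> space M - E2 \<Longrightarrow> t \<in> {0..1/2^k} \<Longrightarrow> \<bar>empirical_process n (1 - t) \<omega>\<bar> \<le> a / w k"
        using maximal_high[OF h ak n] by blast
      have "prob (E1 \<union> E2) \<le> prob E1 + prob E2" by (rule measure_Un_le[OF E1(1) E2(1)])
      also have "\<dots> \<le> 8 * (1 / 2^k) / (a / w k)^2 + 8 * (1 / 2^k) / (a / w k)^2" by (rule add_mono[OF E1(2) E2(2)])
      also have "\<dots> = c k" using a w[of k] by (simp add: c_def power_divide)
      finally have "prob (E1 \<union> E2) \<le> c k" .
      moreover have "x * w k \<le> a" if "x \<le> a / w k" for x using that w[of k] by (simp add: pos_le_divide_eq)
      ultimately show ?thesis using E1(1,3) E2(1,3) by (intro exI[of _ "E1 \<union> E2"]) auto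
    qed
    then have "\<forall>k. \<exists>E. 1 \<le> k \<longrightarrow> E \<in> events \<and> prob E \<le> c k \<and> (\<forall>\<omega>\<in>space M - E. \<forall>t\<in>{0..1/2^k}.
      \<bar>empirical_process n t \<omega>\<bar> * w k \<le> a \<and> \<bar>empirical_process n (1 - t) \<omega>\<bar> * w k \<le> a)" by blast
    then obtain E where E: "\<And>k. 1 \<le> k \<Longrightarrow> E k \<in> events" "\<And>k. 1 \<le> k \<Longrightarrow> prob (E k) \<le> c k"
      "\<And>k \<omega> t. 1 \<le> k \<Longrightarrow> \<omega> \<in> space M - E k \<Longrightarrow> t \<in> {0..1/2^k} \<Longrightarrow>
        \<bar>empirical_process n t \<omega>\<bar> * w k \<le> a \<and> \<bar>empirical_process n (1 - t) \<omega>\<bar> * w k \<le> a"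
      unfolding choice_iff by blast
    have cK: "summable (\<lambda>i. c (i + K))" using c by (rule summable_ignore_initial_segment)
    have eK: "E (i + K) \<in> events" "prob (E (i + K)) \<le> c (i + K)" for i using E(1,2)[of "i + K"] K(1) by auto
    have sE: "summable (\<lambda>i. prob (E (i + K)))"
      by (rule summable_comparison_test'[OF cK]) (use eK(2) in auto)
    have "prob (\<Union>i. E (i + K)) \<le> (\<Sum>i. prob (E (i + K)))"
      by (rule finite_measure_subadditive_countably[OF _ sE]) (use eK in auto)
    also have "\<dots> \<le> (\<Sum>i. c (i + K))" by (rule suminf_le[OF eK(2) sE cK])
    also have "\<dots> \<le> d" by (rule K(2))
    finally have "prob (\<Union>i. E (i + K)) \<le> d" .
    moreover have "\<bar>empirical_process n t \<omega>\<bar> * w k \<le> a \<and> \<bar>empirical_process n (1 - t) \<omega>\<bar> * w k \<le> a"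
      if "\<omega> \<in> space M - (\<Union>i. E (i + K))" "K \<le> k" "t \<in> {0..1/2^k}" for \<omega> k t
    proof -
      have "\<omega> \<notin> E (k - K + K)" using that(1) by blast
      then show ?thesis using E(3)[of k \<omega> t] that K(1) by auto
    qed
    ultimately show ?thesis using eK(1) by (intro bexI[of _ "\<Union>i. E (i + K)"]) auto
  qed
  then show ?thesis using K(1) by blast
qed

lemma equicontinuity:
  assumes a: "0 < a" and d: "0 < d"
  shows "\<exists>N0. \<forall>N::nat\<ge>N0. \<forall>n::nat\<ge>N. \<exists>E\<in>events. prob E \<le> d \<and> (\<forall>\<omega>\<in>space M - E. \<forall>j<N. \<forall>t\<in>{0..1/N}.
    \<bar>empirical_process n (j / N + t) \<omega> - empirical_process n (j / N) \<omega>\<bar> \<le> a)"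
proof -
  obtain N1 :: nat where N1: "224 / (a^4 * d) < N1" using reals_Archimedean2 by blast
  have "\<exists>E\<in>events. prob E \<le> d \<and> (\<forall>\<omega>\<in>space M - E. \<forall>j<N. \<forall>t\<in>{0..1/N}.
    \<bar>empirical_process n (j / N + t) \<omega> - empirical_process n (j / N) \<omega>\<bar> \<le> a)" if N: "max 2 N1 \<le> N" and n: "N \<le> n" for N n :: nat
  proof -
    have N2: "2 \<le> N" "N1 \<le> N" "0 < n" using N n by auto
    have h: "0 < 1 / real N" "1 / real N \<le> 1/2" using N2 by (auto simp: divide_simps)
    define p where "p = 32 * ((1 / N) / n + 6 * (1 / N)^2) / a^4"
    have "\<exists>E. E \<in> events \<and> prob E \<le> p \<and> (\<forall>\<omega>\<in>space M - E. \<forall>t\<in>{0..1/N}.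
       \<bar>empirical_process n (j / N + t) \<omega> - empirical_process n (j / N) \<omega>\<bar> \<le> a)" if "j < N" for j :: nat
    proof -
      have s: "0 \<le> real j / N" "real j / N + 1 / N \<le> 1" using that by (auto simp: field_simps)
      obtain E where "E \<in> events" "prob E \<le> p"
        "\<And>\<omega> t. \<omega> \<in> space M - E \<Longrightarrow> t \<in> {0..1/N} \<Longrightarrow>
          \<bar>empirical_process n (j / N + t) \<omega> - empirical_process n (j / N) \<omega>\<bar> \<le> a"
        using maximal_increment[OF h a N2(3) s] unfolding p_def by blast
      then show ?thesis by blast
    qed
    then have "\<forall>j. \<exists>E. j < N \<longrightarrow> E \<in> events \<and> prob E \<le> p \<and> (\<forall>\<omega>\<in>space M - E. \<forall>t\<in>{0..1/N}.
       \<bar>empirical_process n (j / N + t) \<omega> - empirical_process n (j / N) \<omega>\<bar> \<le> a)" by blast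
    then obtain E where E: "\<And>j. j < N \<Longrightarrow> E j \<in> events" "\<And>j. j < N \<Longrightarrow> prob (E j) \<le> p"
      "\<And>j \<omega> t. j < N \<Longrightarrow> \<omega> \<in> space M - E j \<Longrightarrow> t \<in> {0..1/N} \<Longrightarrow>
        \<bar>empirical_process n (j / N + t) \<omega> - empirical_process n (j / N) \<omega>\<bar> \<le> a"
      unfolding choice_iff by blast
    have "prob (\<Union>j<N. E j) \<le> (\<Sum>j<N. prob (E j))" using E(1) by (intro finite_measure_subadditive_finite) auto
    also have "\<dots> \<le> N * p" using sum_bounded_above[of "{..<N}" "\<lambda>j. prob (E j)" p] E(2) by simp
    also have "N * p \<le> N * (32 * ((1 / N) / N + 6 * (1 / N)^2) / a^4)"
      unfolding p_def using N2 n a by (intro mult_left_mono divide_right_mono add_mono) (auto intro!: divide_left_mono mult_pos_pos)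
    also have "\<dots> = 224 / (N * a^4)" using N2 a by (simp add: field_simps power2_eq_square)
    also have "\<dots> \<le> d"
    proof -
      have "224 / (a^4 * d) < N" using N1 N2(2) by linarith
      then have "224 < N * (a^4 * d)" using a d by (simp add: divide_less_eq)
      then show ?thesis using N2 a by (simp add: divide_le_eq mult_ac)
    qed
    finally have "prob (\<Union>j<N. E j) \<le> d" .
    then show ?thesis using E(1,3) by (intro bexI[of _ "\<Union>j<N. E j"]) auto
  qed
  then show ?thesis by blast
qed

lemma empirical_fraction:
  assumes "0 < n"
  shows "t + empirical_process n t \<omega> / sqrt n = (\<Sum>i<n. indicator {..t} (U i \<omega>)) / n"
proof -
  have "sqrt n * sqrt n = real n" by simp
  then have "empirical_process n t \<omega> / sqrt n = (\<Sum>i<n. indicator {..t} (U i \<omega>) - t) / n"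
    unfolding empirical_process_def by (simp only: divide_divide_eq_left)
  then show ?thesis using assms by (simp add: sum_subtractf diff_divide_distrib)
qed

text \<open>
  Dyadic blocks down to \<open>1 / n\<^sup>2\<close>, of which there are \<open>O(log n)\<close>, are handled by the maximal inequality; beyond
  them there are no observations.
\<close>
lemma null_statistic_negligible:
  assumes a: "0 < a" and d: "0 < d"
  shows "\<exists>n0. \<forall>n\<ge>n0. \<exists>E\<in>events. prob E \<le> d \<and> (\<forall>\<omega>\<in>space M - E. \<forall>t\<in>{0<..<1}.
    sqrt n * bern_KL (t + empirical_process n t \<omega> / sqrt n) t \<le> a)"
proof -
  \<comment> \<open>The number of dyadic scales down to \<open>1 / n^2\<close>.\<close>
  define kn where "kn n = nat \<lceil>2 * log 2 (real n)\<rceil>" for n :: nat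
  have "(\<lambda>n. 64 * (2 * log 2 (real n) + 1) / (a * sqrt n) + 2 / real n) \<longlonglongrightarrow> 0" using a by real_asymp
  from order_tendstoD(2)[OF this d] have ev1: "eventually (\<lambda>n. 64 * (2 * log 2 (real n) + 1) / (a * sqrt n) + 2 / real n < d) sequentially" .
  have "(\<lambda>n. 2 * sqrt n / (real n)^2) \<longlonglongrightarrow> 0" by real_asymp
  from order_tendstoD(2)[OF this a] have ev2: "eventually (\<lambda>n. 2 * sqrt n / (real n)^2 < a) sequentially" .
  obtain n0 where n0: "\<And>n. n \<ge> n0 \<Longrightarrow> 64 * (2 * log 2 (real n) + 1) / (a * sqrt n) + 2 / real n < d \<and> 2 * sqrt n / (real n)^2 < a"
    using eventually_conj[OF ev1 ev2] unfolding eventually_sequentially by blast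
  have "\<exists>E\<in>events. prob E \<le> d \<and> (\<forall>\<omega>\<in>space M - E. \<forall>t\<in>{0<..<1}.
    sqrt n * bern_KL (t + empirical_process n t \<omega> / sqrt n) t \<le> a)" if n: "max 2 n0 \<le> n" for n
  proof -
    have n2: "0 < n" "2 \<le> n" "n0 \<le> n" using n by auto
    define K where "K = kn n"
    have Kn: "K \<le> 2 * log 2 (real n) + 1" "2 * log 2 (real n) \<le> K"
    proof -
      have "0 \<le> 2 * log 2 (real n)" using n2 by simp
      then have "real K = of_int \<lceil>2 * log 2 (real n)\<rceil>" unfolding K_def kn_def by (simp add: of_nat_nat)
      then show "K \<le> 2 * log 2 (real n) + 1" "2 * log 2 (real n) \<le> K" by linarith+
    qed
    have "(real n)^2 = (2 powr log 2 (real n)) powr 2" using n2 by (simp add: powr_numeral)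
    also have "\<dots> = 2 powr (2 * log 2 (real n))" by (simp only: powr_powr mult.commute)
    also have "\<dots> \<le> 2 powr K" using Kn(2) by (intro powr_mono) auto
    finally have K2: "(real n)^2 \<le> 2^K" by (simp add: powr_realpow)
    \<comment> \<open>On scale \<open>k\<close> the level \<open>a sqrt n / 2^(k+2)\<close> for the
      square is what the chi-square bound tolerates there, and it makes the failure probability of
      one end equal to \<open>p\<close>, whatever \<open>k\<close> is.\<close>
    define p where "p = 32 / (a * sqrt n)"
    have "\<exists>E. E \<in> events \<and> prob E \<le> 2 * p \<and> (\<forall>\<omega>\<in>space M - E. \<forall>t\<in>{0..1/2^k}.
      (empirical_process n t \<omega>)\<^sup>2 \<le> a * sqrt n / 2^(k + 2) \<and> (empirical_process n (1 - t) \<omega>)\<^sup>2 \<le> a * sqrt n / 2^(k + 2))" if k: "1 \<le> k" for k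
    proof -
      have "(2::real)^1 \<le> 2^k" using k by (intro power_increasing) auto
      then have h: "0 < 1 / (2::real)^k" "1 / (2::real)^k \<le> 1/2" by (auto simp: divide_simps)
      define b where "b = sqrt (a * sqrt n / 2^(k + 2))"
      have b: "0 < b" "b^2 = a * sqrt n / 2^(k + 2)" using a n2 by (auto simp: b_def)
      have pb: "8 * (1 / 2^k) / b^2 = p" using a n2 unfolding b(2) p_def by (simp add: field_simps)
      obtain E1 where E1: "E1 \<in> events" "prob E1 \<le> p"
        "\<And>\<omega> t. \<omega> \<in> space M - E1 \<Longrightarrow> t \<in> {0..1/2^k} \<Longrightarrow> \<bar>empirical_process n t \<omega>\<bar> \<le> b"
        using maximal_low[OF h b(1) n2(1)] unfolding pb by blast
      obtain E2 where E2: "E2 \<in> events" "prob E2 \<le> p"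
        "\<And>\<omega> t. \<omega> \<in> space M - E2 \<Longrightarrow> t \<in> {0..1/2^k} \<Longrightarrow> \<bar>empirical_process n (1 - t) \<omega>\<bar> \<le> b"
        using maximal_high[OF h b(1) n2(1)] unfolding pb by blast
      have "prob (E1 \<union> E2) \<le> 2 * p" using measure_Un_le[OF E1(1) E2(1)] E1(2) E2(2) by linarith
      moreover have "x^2 \<le> a * sqrt n / 2^(k + 2)" if "\<bar>x\<bar> \<le> b" for x
        using power_mono[OF that, of 2] unfolding b(2) by simp
      ultimately show ?thesis using E1(1,3) E2(1,3) by (intro exI[of _ "E1 \<union> E2"]) auto
    qed
    then have "\<forall>k. \<exists>E. 1 \<le> k \<longrightarrow> E \<in> events \<and> prob E \<le> 2 * p \<and> (\<forall>\<omega>\<in>space M - E. \<forall>t\<in>{0..1/2^k}.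
      (empirical_process n t \<omega>)\<^sup>2 \<le> a * sqrt n / 2^(k + 2) \<and> (empirical_process n (1 - t) \<omega>)\<^sup>2 \<le> a * sqrt n / 2^(k + 2))" by blast
    then obtain E where E: "\<And>k. 1 \<le> k \<Longrightarrow> E k \<in> events" "\<And>k. 1 \<le> k \<Longrightarrow> prob (E k) \<le> 2 * p"
      "\<And>k \<omega> t. 1 \<le> k \<Longrightarrow> \<omega> \<in> space M - E k \<Longrightarrow> t \<in> {0..1/2^k} \<Longrightarrow>
       (empirical_process n t \<omega>)\<^sup>2 \<le> a * sqrt n / 2^(k + 2) \<and> (empirical_process n (1 - t) \<omega>)\<^sup>2 \<le> a * sqrt n / 2^(k + 2)"
      unfolding choice_iff by blast
    \<comment> \<open>Among \<open>n\<close> observations, one within \<open>r\<close> of an end has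
      probability at most \<open>2 n r = 2 / n\<close>.\<close>
    define r where "r = 1 / (real n)^2"
    have "2^2 \<le> (real n)^2" using n2 by (intro power_mono) auto
    then have r: "0 < r" "r \<le> 1/2" using n2 by (auto simp: r_def divide_simps)
    define L where "L i = {\<omega> \<in> space M. U i \<omega> \<in> {..r}}" for i
    define H where "H i = {\<omega> \<in> space M. \<not> U i \<omega> \<le> 1 - r}" for i
    have LH: "L i \<in> events" "H i \<in> events" for i unfolding L_def H_def by measurable
    have pL: "prob (L i) = r" for i using uniform[of r i] r by (simp add: L_def)
    have pH: "prob (H i) = r" for i using prob_neg[of "\<lambda>\<omega>. U i \<omega> \<le> 1 - r"] uniform[of "1 - r" i] r by (simp add: H_def)
    define E' where "E' = (\<Union>k\<in>{1..K}. E k) \<union> ((\<Union>i<n. L i) \<union> (\<Union>i<n. H i))"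
    have ev: "(\<Union>k\<in>{1..K}. E k) \<in> events" "(\<Union>i<n. L i) \<in> events" "(\<Union>i<n. H i) \<in> events"
      using E(1) LH by auto
    have "prob E' \<le> prob (\<Union>k\<in>{1..K}. E k) + (prob (\<Union>i<n. L i) + prob (\<Union>i<n. H i))"
      unfolding E'_def using measure_Un_le[OF ev(1), of "(\<Union>i<n. L i) \<union> (\<Union>i<n. H i)"] measure_Un_le[OF ev(2,3)] ev by auto
    also have "prob (\<Union>k\<in>{1..K}. E k) \<le> (\<Sum>k\<in>{1..K}. prob (E k))"
      using E(1) by (intro finite_measure_subadditive_finite) auto
    also have "(\<Sum>k\<in>{1..K}. prob (E k)) \<le> K * (2 * p)"
      using sum_bounded_above[of "{1..K}" "\<lambda>k. prob (E k)" "2 * p"] E(2) by simp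
    also have "prob (\<Union>i<n. L i) \<le> (\<Sum>i<n. prob (L i))" using LH by (intro finite_measure_subadditive_finite) auto
    also have "prob (\<Union>i<n. H i) \<le> (\<Sum>i<n. prob (H i))" using LH by (intro finite_measure_subadditive_finite) auto
    finally have "prob E' \<le> K * (2 * p) + 2 * (n * r)" by (simp add: pL pH mult.commute)
    also have "\<dots> \<le> (2 * log 2 (real n) + 1) * (2 * p) + 2 * (n * r)"
      using Kn(1) a r by (intro add_mono mult_right_mono) (auto simp: p_def)
    also have "\<dots> = 64 * (2 * log 2 (real n) + 1) / (a * sqrt n) + 2 / real n"
      using n2 by (simp add: p_def r_def power2_eq_square)
    also have "\<dots> \<le> d" using n0[OF n2(3)] by simp
    finally have pE': "prob E' \<le> d" .
    have "sqrt n * bern_KL (t + empirical_process n t \<omega> / sqrt n) t \<le> a" if w: "\<omega> \<in> space M - E'" and t: "t \<in> {0<..<1}" for \<omega> t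
    proof -
      define s where "s = min t (1 - t)"
      have s: "0 < s" "s \<le> 1/2" "s = t \<or> t = 1 - s" using t by (auto simp: s_def min_def)
      have ts: "t * (1 - t) = s * (1 - s)" using s(3) by (auto simp: mult.commute)
      define u where "u = empirical_process n t \<omega>"
      define q where "q = t + u / sqrt n"
      have q: "q = (\<Sum>i<n. indicator {..t} (U i \<omega>)) / n" unfolding q_def u_def by (rule empirical_fraction[OF n2(1)])
      have "(\<Sum>i<n. indicator {..t} (U i \<omega>)) \<le> (\<Sum>i<n. 1 :: real)" by (intro sum_mono) (simp add: indicator_def)
      then have q01: "0 \<le> q" "q \<le> 1" unfolding q using n2 by (auto intro!: divide_nonneg_nonneg sum_nonneg)
      have "bern_KL q t \<le> (q - t)\<^sup>2 / (s * (1 - s))"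
        using bern_KL_le_chi_square[OF q01, of t] t unfolding ts[symmetric] by simp
      also have "\<dots> \<le> (q - t)\<^sup>2 / (s * (1 / 2))"
        using s by (intro divide_left_mono mult_left_mono mult_pos_pos) auto
      finally have KL: "bern_KL q t \<le> 2 * (q - t)\<^sup>2 / s" by (simp add: mult.commute)
      have "sqrt n * (2 * (q - t)\<^sup>2 / s) \<le> a"
      proof (cases "r < s")
        case True
        obtain k where k: "1 \<le> k" "1 / 2^(k + 1) < s" "s \<le> 1 / 2^k" using dyadic_block[OF s(1,2)] by blast
        have "1 / 2^K \<le> r" unfolding r_def using K2 n2 by (intro divide_left_mono) auto
        then have "1 / 2^K < 1 / (2::real)^k" using True k(3) by linarith
        then have "(2::real)^k < 2^K" by (simp add: divide_simps)
        then have "k < K" by (simp add: power_less_imp_less_exp)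
        then have "\<omega> \<notin> E k" using w k(1) unfolding E'_def by auto
        then have "u\<^sup>2 \<le> a * sqrt n / 2^(k + 2)"
          using E(3)[OF k(1), of \<omega> s] w s k(3) unfolding u_def by auto
        moreover have qt: "(q - t)\<^sup>2 = u\<^sup>2 / n" by (simp add: q_def power_divide)
        ultimately have "(q - t)\<^sup>2 \<le> a * sqrt n / 2^(k + 2) / n" unfolding qt by (intro divide_right_mono) auto
        then have "sqrt n * (2 * (q - t)\<^sup>2 / s) \<le> sqrt n * (2 * (a * sqrt n / 2^(k + 2) / n) / s)"
          using s(1) by (intro mult_left_mono divide_right_mono) auto
        also have "\<dots> \<le> sqrt n * (2 * (a * sqrt n / 2^(k + 2) / n) / (1 / 2^(k+1)))"
          using s k a by (intro mult_left_mono divide_left_mono) auto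
        also have "\<dots> = a" using n2 by (simp add: field_simps)
        finally show ?thesis .
      next
        \<comment> \<open>No observation lies between \<open>t\<close> and the nearer end, so
          \<open>q\<close> is that end and \<open>\<bar>q - t\<bar>\<close> is at most
          \<open>s\<close>. The chi-square bound is then at most \<open>2 s\<close>, hence at most
          \<open>2 r\<close>.\<close>
        case False
        have "\<bar>q - t\<bar> \<le> s"
        proof (cases "s = t")
          case True
          have "indicator {..t} (U i \<omega>) = (0::real)" if "i < n" for i
            using w that False True unfolding E'_def L_def by (force simp: indicator_def)
          then have "q = 0" unfolding q by simp
          then show ?thesis using True t by simp
        next
          case False
          then have t': "t = 1 - s" using s(3) by auto
          have "indicator {..t} (U i \<omega>) = (1::real)" if "i < n" for i
            using w that \<open>\<not> r < s\<close> unfolding t' E'_def H_def by (force simp: indicator_def)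
          then have "q = 1" unfolding q using n2 by simp
          then show ?thesis using t' s by simp
        qed
        then have "(q - t)\<^sup>2 \<le> s\<^sup>2" using power_mono[of "\<bar>q - t\<bar>" s 2] by simp
        then have "sqrt n * (2 * (q - t)\<^sup>2 / s) \<le> sqrt n * (2 * s\<^sup>2 / s)"
          using s by (intro mult_left_mono divide_right_mono) auto
        also have "\<dots> \<le> sqrt n * (2 * r)" using False s by (intro mult_left_mono) (auto simp: power2_eq_square)
        also have "\<dots> \<le> a" using n0[OF n2(3)] by (simp add: r_def mult.commute)
        finally show ?thesis .
      qed
      moreover have "sqrt n * bern_KL q t \<le> sqrt n * (2 * (q - t)\<^sup>2 / s)" using KL by (intro mult_left_mono) auto
      ultimately show ?thesis unfolding q_def u_def by linarith
    qed
    then show ?thesis using pE' ev by (intro bexI[of _ E']) (auto simp: E'_def)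
  qed
  then show ?thesis by blast
qed

end

section \<open>Tails and continuity of the Brownian bridge\<close>

context uniform_sample begin

text \<open>The series argument of \<open>weighted_tail\<close> repeated for the bridge. On each
  scale \<open>bridge_maximal\<close> is applied to a countable dense set and path continuity fills
  the interval; the halved level there turns the factor 16 into 64.\<close>

lemma bridge_weighted_tail_prob:
  assumes B: "brownian_bridge N B"
    and w: "\<And>k. 0 < w k" and sum: "summable (\<lambda>k. (w k)^2 / 2^k)" and a: "0 < a" and d: "0 < d"
  shows "\<exists>K. \<exists>E\<in>sets N. measure N E \<le> d \<and> (\<forall>\<omega>\<in>space N - E. \<forall>k\<ge>K. \<forall>t\<in>{0..1/2^k}.
    \<bar>B t \<omega>\<bar> * w k \<le> a \<and> \<bar>B (1 - t) \<omega>\<bar> * w k \<le> a)"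
proof -
  interpret N: prob_space N using B by (simp add: brownian_bridge_def)
  have Bm: "B t \<in> borel_measurable N" if "t \<in> {0..1}" for t using B that by (simp add: brownian_bridge_def)
  have Bc: "continuous_on {0..1} (\<lambda>t. B t \<omega>)" if "\<omega> \<in> space N" for \<omega> using B that by (simp add: brownian_bridge_def)
    have "\<exists>D. countable D \<and> D \<subseteq> {0..1/(2::real)^Suc k} \<and> {0..1/2^Suc k} \<subseteq> closure D" for k :: nat
      using separable[of "{0..1/(2::real)^Suc k}"] by metis
    then obtain D where D: "\<And>k. countable (D k)" "\<And>k. D k \<subseteq> {0..1/(2::real)^Suc k}" "\<And>k. {0..1/2^Suc k} \<subseteq> closure (D k)"
      by metis
    have h: "0 < 1 / (2::real)^Suc k" "1 / (2::real)^Suc k \<le> 1/2" for k :: nat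
      by (auto simp: divide_simps)
    have D01: "D k \<subseteq> {0..1}" "(\<lambda>t. 1 - t) ` D k \<subseteq> {0..1}" for k
    proof -
      have "t \<in> {0..1}" if "t \<in> D k" for t using subsetD[OF D(2) that] h(2)[of k] unfolding atLeastAtMost_iff by linarith
      then show "D k \<subseteq> {0..1}" "(\<lambda>t. 1 - t) ` D k \<subseteq> {0..1}" by force+
    qed
    \<comment> \<open>The index is shifted by one so that every interval has length at most 1/2, as
      the maximal inequalities require.\<close>
    define A where "A k = {\<omega> \<in> space N. \<exists>t\<in>D k. a / w (Suc k) < \<bar>B t \<omega>\<bar>} \<union> {\<omega> \<in> space N. \<exists>t\<in>(\<lambda>t. 1 - t) ` D k. a / w (Suc k) < \<bar>B t \<omega>\<bar>}" for k
    have ev: "{\<omega> \<in> space N. \<exists>t\<in>E. c < \<bar>B t \<omega>\<bar>} \<in> sets N" if "countable E" "E \<subseteq> {0..1}" for E c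
    proof -
      have "{\<omega> \<in> space N. \<exists>t\<in>E. c < \<bar>B t \<omega>\<bar>} = (\<Union>t\<in>E. {\<omega> \<in> space N. c < \<bar>B t \<omega>\<bar>})" by auto
      also have "\<dots> \<in> sets N" using that Bm by (intro sets.countable_UN'') (auto intro!: borel_measurable_less borel_measurable_abs)
      finally show ?thesis .
    qed
    have Am: "A k \<in> sets N" for k unfolding A_def using D(1) D01 by (intro sets.Un ev) auto
    define p where "p k = 8 * (1 / 2^Suc k) / (a / w (Suc k) / 2)^2" for k
    have "measure N (A k) \<le> 2 * p k" for k
    proof -
      have ak: "0 < a / w (Suc k)" using a w by simp
      have ak2: "0 < a / w (Suc k) / 2" using ak by simp
      have "measure N {\<omega> \<in> space N. \<exists>t\<in>D k. a / w (Suc k) < \<bar>B t \<omega>\<bar>} \<le> p k"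
      proof (rule bridge_maximal[OF B D(1) D01(1) ak])
        fix n :: nat assume n: "0 < n"
        show "\<exists>E\<in>events. prob E \<le> p k \<and> (\<forall>\<omega>\<in>space M - E. \<forall>t\<in>D k. \<bar>empirical_process n t \<omega>\<bar> \<le> a / w (Suc k) / 2)"
          by (rule maximal_low[OF h(1,2)[of k] ak2 n]) (use D(2)[of k] in \<open>auto simp: p_def intro!: bexI\<close>)
      qed
      moreover have "measure N {\<omega> \<in> space N. \<exists>t\<in>(\<lambda>t. 1 - t) ` D k. a / w (Suc k) < \<bar>B t \<omega>\<bar>} \<le> p k"
      proof (rule bridge_maximal[OF B countable_image[OF D(1)] D01(2) ak])
        fix n :: nat assume n: "0 < n"
        show "\<exists>E\<in>events. prob E \<le> p k \<and> (\<forall>\<omega>\<in>space M - E. \<forall>t\<in>(\<lambda>t. 1 - t) ` D k. \<bar>empirical_process n t \<omega>\<bar> \<le> a / w (Suc k) / 2)"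
          by (rule maximal_high[OF h(1,2)[of k] ak2 n]) (use D(2)[of k] in \<open>auto simp: p_def intro!: bexI\<close>)
      qed
      ultimately show ?thesis
        unfolding A_def using measure_Un_le[OF ev[OF D(1) D01(1)] ev[OF countable_image[OF D(1)] D01(2)], of k "a / w (Suc k)" k "a / w (Suc k)"] by linarith
    qed
    moreover have "summable (\<lambda>k. 2 * p k)"
    proof -
      have "2 * p k = (64 / a^2) * ((w (Suc k))^2 / 2^Suc k)" for k
        using a w[of "Suc k"] by (simp add: p_def power_divide field_simps)
      then show ?thesis using summable_mult[of "\<lambda>k. (w (Suc k))^2 / 2^Suc k" "64 / a^2"] sum
        by (simp add: summable_Suc_iff[of "\<lambda>k. (w k)^2 / 2^k"] del: power_Suc)
    qed
    ultimately have sA: "summable (\<lambda>k. measure N (A k))"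
      by (intro summable_comparison_test'[of "\<lambda>k. 2 * p k" 0 "\<lambda>k. measure N (A k)"]) auto
    obtain K where K: "\<And>n. n \<ge> K \<Longrightarrow> norm (\<Sum>i. measure N (A (i + n))) < d" using suminf_exist_split[OF d sA] by blast
    define E where "E = (\<Union>i. A (i + K))"
    have "measure N E \<le> (\<Sum>i. measure N (A (i + K)))"
      unfolding E_def by (rule N.finite_measure_subadditive_countably) (use Am summable_ignore_initial_segment[OF sA] in auto)
    also have "\<dots> \<le> d" using K[of K] by simp
    finally have Ed: "measure N E \<le> d" .
    have Em: "E \<in> sets N" unfolding E_def using Am by auto
      have "\<bar>B t \<omega>\<bar> * w k \<le> a \<and> \<bar>B (1 - t) \<omega>\<bar> * w k \<le> a" if \<omega>: "\<omega> \<in> space N - E" and k: "Suc K \<le> k" and t: "t \<in> {0..1/2^k}" for \<omega> k t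
      proof -
        obtain l where l: "k = Suc l" "K \<le> l" using k by (cases k) auto
        have "\<omega> \<notin> A (l - K + K)" using \<omega> unfolding E_def by blast
        then have w': "\<omega> \<in> space N" "\<omega> \<notin> A l" using \<omega> l(2) by auto
        have le: "\<bar>B s \<omega>\<bar> \<le> a / w k" "\<bar>B (1 - s) \<omega>\<bar> \<le> a / w k" if "s \<in> D l" for s
          using w' that unfolding A_def l by (auto simp: not_less)
        have cl: "closure (D l) \<subseteq> {0..1}" using D01(1) closure_minimal[of "D l" "{0..1}"] by auto
        have tc: "t \<in> closure (D l)" using D(3)[of l] t l(1) by auto
        have c1: "continuous_on (closure (D l)) (\<lambda>t. \<bar>B t \<omega>\<bar>)"
          using continuous_on_subset[OF Bc[OF w'(1)] cl] by (intro continuous_on_rabs)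
        have c2: "continuous_on (closure (D l)) (\<lambda>t. \<bar>B (1 - t) \<omega>\<bar>)"
          using cl by (intro continuous_on_rabs continuous_on_compose2[OF Bc[OF w'(1)]] continuous_intros) auto
        have "\<bar>B t \<omega>\<bar> \<le> a / w k" by (rule continuous_le_on_closure[OF c1 tc le(1)])
        moreover have "\<bar>B (1 - t) \<omega>\<bar> \<le> a / w k" by (rule continuous_le_on_closure[OF c2 tc le(2)])
        ultimately show ?thesis using w[of k] by (simp add: pos_le_divide_eq)
      qed
      then show ?thesis using Ed Em by (intro exI[of _ "Suc K"] bexI[of _ E]) auto
qed

text \<open>For a fixed level the exceptional sets of probability at most \<open>1 / (j + 1)\<close>
  intersect in a null set; the levels \<open>1 / (j + 1)\<close> then cover all
  \<open>a > 0\<close>.\<close>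

lemma bridge_weighted_tail:
  assumes B: "brownian_bridge N B"
    and w: "\<And>k. 0 < w k" and sum: "summable (\<lambda>k. (w k)^2 / 2^k)"
  shows "AE \<omega> in N. \<forall>a>0. \<exists>K. \<forall>k\<ge>K. \<forall>t\<in>{0..1/2^k}. \<bar>B t \<omega>\<bar> * w k \<le> a \<and> \<bar>B (1 - t) \<omega>\<bar> * w k \<le> a"
proof -
  interpret N: prob_space N using B by (simp add: brownian_bridge_def)
  define Q where "Q a \<omega> \<longleftrightarrow> (\<exists>K. \<forall>k\<ge>K. \<forall>t\<in>{0..1/2^k}. \<bar>B t \<omega>\<bar> * w k \<le> a \<and> \<bar>B (1 - t) \<omega>\<bar> * w k \<le> a)" for a \<omega>
  have "AE \<omega> in N. Q a \<omega>" if a: "0 < a" for a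
  proof -
    have "\<exists>E. E \<in> sets N \<and> measure N E \<le> 1 / Suc j \<and> (\<forall>\<omega>\<in>space N - E. Q a \<omega>)" for j
      using bridge_weighted_tail_prob[OF B w sum a, of "1 / Suc j"] unfolding Q_def by fastforce
    then obtain E where E: "\<And>j. E j \<in> sets N" "\<And>j. measure N (E j) \<le> 1 / Suc j" "\<And>j \<omega>. \<omega> \<in> space N - E j \<Longrightarrow> Q a \<omega>"
      by metis
    have Em: "(\<Inter>j. E j) \<in> sets N" using E(1) by auto
    have "measure N (\<Inter>j. E j) \<le> 0"
    proof (rule field_le_epsilon)
      fix e :: real assume "0 < e"
      then obtain j where "1 / Suc j < e" using nat_approx_posE by blast
      moreover have "measure N (\<Inter>j. E j) \<le> measure N (E j)" using E(1) by (intro N.finite_measure_mono) auto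
      ultimately show "measure N (\<Inter>j. E j) \<le> 0 + e" using E(2)[of j] by linarith
    qed
    then have "measure N (\<Inter>j. E j) = 0" using measure_nonneg[of N "\<Inter>j. E j"] by linarith
    then have "emeasure N (\<Inter>j. E j) = 0" by (simp add: N.emeasure_eq_measure)
    then have "(\<Inter>j. E j) \<in> null_sets N" using Em by (rule null_setsI)
    then show ?thesis by (rule AE_I') (use E(3) in auto)
  qed
  then have "AE \<omega> in N. \<forall>j::nat. Q (1 / Suc j) \<omega>"
    unfolding AE_all_countable by simp
  then show ?thesis
  proof eventually_elim
    case (elim \<omega>)
    show ?case
    proof (intro allI impI)
      fix a :: real assume "0 < a"
      then obtain j where j: "1 / Suc j < a" using nat_approx_posE by blast
      obtain K where "\<forall>k\<ge>K. \<forall>t\<in>{0..1/2^k}. \<bar>B t \<omega>\<bar> * w k \<le> 1 / Suc j \<and> \<bar>B (1 - t) \<omega>\<bar> * w k \<le> 1 / Suc j"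
        using elim unfolding Q_def by blast
      then show "\<exists>K. \<forall>k\<ge>K. \<forall>t\<in>{0..1/2^k}. \<bar>B t \<omega>\<bar> * w k \<le> a \<and> \<bar>B (1 - t) \<omega>\<bar> * w k \<le> a"
        using j by (intro exI[of _ K]) force
    qed
  qed
qed

end

text \<open>Paths are uniformly continuous on \<open>[0, 1]\<close>, so the indicator of a large
  oscillation tends to 0 at every point and dominated convergence gives the probability. A countable
  dense set of increments keeps the events measurable.\<close>

lemma bridge_equicontinuity:
  assumes B: "brownian_bridge N B" and a: "0 < a" and d: "0 < d"
  shows "\<exists>N0. \<forall>m::nat\<ge>N0. \<exists>E\<in>sets N. measure N E \<le> d \<and> (\<forall>\<omega>\<in>space N - E. \<forall>j<m. \<forall>t\<in>{0..1/m}.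
    \<bar>B (j / m + t) \<omega> - B (j / m) \<omega>\<bar> \<le> a)"
proof -
  interpret N: prob_space N using B by (simp add: brownian_bridge_def)
  have Bm: "B t \<in> borel_measurable N" if "t \<in> {0..1}" for t using B that by (simp add: brownian_bridge_def)
  have Bc: "continuous_on {0..1} (\<lambda>t. B t \<omega>)" if "\<omega> \<in> space N" for \<omega> using B that by (simp add: brownian_bridge_def)
  have "\<exists>D. countable D \<and> D \<subseteq> {0..1/real m} \<and> {0..1/real m} \<subseteq> closure D" for m :: nat
    using separable[of "{0..1/real m}"] by metis
  then obtain D where D: "\<And>m. countable (D m)" "\<And>m. D m \<subseteq> {0..1/real m}" "\<And>m. {0..1/real m} \<subseteq> closure (D m)"
    by metis
  define A where "A m = {\<omega> \<in> space N. \<exists>j<m. \<exists>t\<in>D m. a < \<bar>B (j / m + t) \<omega> - B (j / m) \<omega>\<bar>}" for m :: nat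
  have in01: "real j / m + t \<in> {0..1}" "real j / m \<in> {0..1}" if "j < m" "t \<in> {0..1/real m}" for j m t
  proof -
    have "real j / m + 1 / m \<le> 1" "0 \<le> real j / m" using that(1) by (auto simp: field_simps)
    then show "real j / m + t \<in> {0..1}" "real j / m \<in> {0..1}" using that(2) by auto
  qed
  have Am: "A m \<in> sets N" for m
  proof -
    have "A m = (\<Union>j\<in>{..<m}. \<Union>t\<in>D m. {\<omega> \<in> space N. a < \<bar>B (j / m + t) \<omega> - B (j / m) \<omega>\<bar>})"
      unfolding A_def by auto
    also have "\<dots> \<in> sets N"
    proof (intro sets.countable_UN'' D(1))
      fix j t assume "j \<in> {..<m}" "t \<in> D m"
      then have "real j / m + t \<in> {0..1}" "real j / m \<in> {0..1}" using in01[of j m t] D(2)[of m] by auto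
      then show "{\<omega> \<in> space N. a < \<bar>B (j / m + t) \<omega> - B (j / m) \<omega>\<bar>} \<in> sets N"
        by (intro borel_measurable_less borel_measurable_abs borel_measurable_diff Bm) auto
    qed simp
    finally show ?thesis .
  qed
  have "(\<lambda>m. \<integral>\<omega>. indicator (A m) \<omega> \<partial>N) \<longlonglongrightarrow> (\<integral>\<omega>. (0::real) \<partial>N)"
  proof (rule integral_dominated_convergence[where w="\<lambda>_. 1"])
    show "AE \<omega> in N. (\<lambda>m. indicator (A m) \<omega> :: real) \<longlonglongrightarrow> 0"
    proof (rule AE_I2)
      fix \<omega> assume \<omega>: "\<omega> \<in> space N"
      have "uniformly_continuous_on {0..1} (\<lambda>t. B t \<omega>)"
        by (rule compact_uniformly_continuous[OF Bc[OF \<omega>]]) simp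
      then obtain e where e: "0 < e" "\<And>s t. s \<in> {0..1} \<Longrightarrow> t \<in> {0..1} \<Longrightarrow> dist t s < e \<Longrightarrow> dist (B t \<omega>) (B s \<omega>) < a"
        using a unfolding uniformly_continuous_on_def by metis
      obtain m0 :: nat where m0: "1 / e < m0" using reals_Archimedean2 by blast
      have "\<omega> \<notin> A m" if "m0 \<le> m" for m
      proof
        assume "\<omega> \<in> A m"
        then obtain j t where jt: "j < m" "t \<in> D m" "a < \<bar>B (j / m + t) \<omega> - B (j / m) \<omega>\<bar>" unfolding A_def by auto
        have t: "t \<in> {0..1/real m}" using jt(2) D(2) by blast
        have "1 / e < real m" using m0 that by linarith
        then have "1 / real m < e" using jt(1) e(1) by (simp add: field_simps)
        then have "dist (real j / m + t) (real j / m) < e" using t by (simp add: dist_real_def)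
        from e(2)[OF in01(2)[OF jt(1) t] in01(1)[OF jt(1) t] this] jt(3) show False by (simp add: dist_real_def)
      qed
      then have "eventually (\<lambda>m. indicator (A m) \<omega> = (0::real)) sequentially"
        unfolding eventually_sequentially by (intro exI[of _ m0]) simp
      then show "(\<lambda>m. indicator (A m) \<omega> :: real) \<longlonglongrightarrow> 0" by (rule tendsto_eventually)
    qed
  qed (use Am in auto)
  then have "(\<lambda>m. measure N (A m)) \<longlonglongrightarrow> 0" using Am by simp
  from order_tendstoD(2)[OF this d] obtain N0 where N0: "\<And>m. m \<ge> N0 \<Longrightarrow> measure N (A m) < d"
    unfolding eventually_sequentially by blast
  have "\<bar>B (j / m + t) \<omega> - B (j / m) \<omega>\<bar> \<le> a" if \<omega>: "\<omega> \<in> space N - A m" and j: "j < m" and t: "t \<in> {0..1/real m}" for \<omega> j t and m :: nat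
  proof -
    have cl: "closure (D m) \<subseteq> {0..1/real m}" using D(2) by (intro closure_minimal) auto
    have "continuous_on (closure (D m)) (\<lambda>t. \<bar>B (j / m + t) \<omega> - B (j / m) \<omega>\<bar>)"
      using \<omega> by (intro continuous_on_rabs continuous_on_diff continuous_on_const continuous_on_compose2[OF Bc] continuous_intros)
        (use cl in01(1)[OF j] in auto)
    moreover have "t \<in> closure (D m)" using t D(3) by blast
    moreover have "\<bar>B (j / m + s) \<omega> - B (j / m) \<omega>\<bar> \<le> a" if "s \<in> D m" for s
    proof -
      have "\<not> a < \<bar>B (j / m + s) \<omega> - B (j / m) \<omega>\<bar>" using \<omega> j that unfolding A_def by blast
      then show ?thesis by simp
    qed
    ultimately show ?thesis by (rule continuous_le_on_closure)
  qed
  then have "\<forall>m::nat\<ge>N0. \<exists>E\<in>sets N. measure N E \<le> d \<and> (\<forall>\<omega>\<in>space N - E. \<forall>j<m. \<forall>t\<in>{0..1/real m}.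
    \<bar>B (j / m + t) \<omega> - B (j / m) \<omega>\<bar> \<le> a)"
    using N0 Am by (meson less_imp_le)
  then show ?thesis by blast
qed

section \<open>The log-ratio of two distribution functions\<close>

locale square_integrable_log_ratio =
  fixes P Q :: "real measure" and F G :: "real \<Rightarrow> real"
  assumes P: "real_distribution P" and F: "F = cdf P" and F_cont: "continuous_on UNIV F"
    and Q: "real_distribution Q" and G: "G = cdf Q" and G_cont: "continuous_on UNIV G"
    and integral_finite: "(\<integral>\<^sup>+ t. log_ratio_sq (F t) (G t) \<partial>P) < \<infinity>"
begin

sublocale P: real_distribution P by (rule P)
sublocale Q: real_distribution Q by (rule Q)

abbreviation L :: "real \<Rightarrow> real" where "L x \<equiv> log_ratio (F x) (G x)"

lemma F_mono: "x \<le> y \<Longrightarrow> F x \<le> F y" unfolding F by (rule P.cdf_nondecreasing)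
lemma G_mono: "x \<le> y \<Longrightarrow> G x \<le> G y" unfolding G by (rule Q.cdf_nondecreasing)
lemma F_less_imp: "F x < F y \<Longrightarrow> x < y" using F_mono[of y x] by (meson not_le)
lemma F_bounds: "0 \<le> F x" "F x \<le> 1" unfolding F by (auto simp: P.cdf_nonneg P.cdf_bounded_prob)
lemma G_bounds: "0 \<le> G x" "G x \<le> 1" unfolding G by (auto simp: Q.cdf_nonneg Q.cdf_bounded_prob)
lemma F_lim: "(F \<longlongrightarrow> 0) at_bot" "(F \<longlongrightarrow> 1) at_top"
  unfolding F by (rule P.cdf_lim_at_bot P.cdf_lim_at_top_prob)+
lemma G_lim: "(G \<longlongrightarrow> 0) at_bot" "(G \<longlongrightarrow> 1) at_top"
  unfolding G by (rule Q.cdf_lim_at_bot Q.cdf_lim_at_top_prob)+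
lemma F_isCont[simp]: "isCont F x" using F_cont by (simp add: continuous_on_eq_continuous_at)
lemma G_isCont[simp]: "isCont G x" using G_cont by (simp add: continuous_on_eq_continuous_at)
lemma FG_measurable[measurable]: "F \<in> borel_measurable borel" "G \<in> borel_measurable borel"
  using F_cont G_cont by (auto intro: borel_measurable_continuous_onI)
lemma sets_P[measurable_cong]: "sets P = sets borel" by (rule P.events_eq_borel)

lemma F_attains:
  assumes "0 < t" "t < 1"
  obtains x where "F x = t"
proof -
  have "eventually (\<lambda>x. F x < t) at_bot" "eventually (\<lambda>x. t < F x) at_top"
    using order_tendstoD(2)[OF F_lim(1) assms(1)] order_tendstoD(1)[OF F_lim(2) assms(2)] by auto
  then obtain a b where ab: "F a < t" "t < F b"
    by (metis eventually_at_bot_linorder eventually_at_top_linorder order_refl)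
  then have "a \<le> b" using F_less_imp[of a b] by simp
  then obtain x where "F x = t" using IVT'[of F a t b] ab continuous_on_subset[OF F_cont] by auto
  then show ?thesis by (rule that)
qed

text \<open>Probability integral transform. \<open>F\<close> may be flat, so the set is enclosed
  from above by half-lines ending where \<open>F\<close> takes a value \<open>s > t\<close>, and
  from below by one ending where \<open>F\<close> equals \<open>t\<close>.\<close>

lemma prob_F_le:
  assumes t: "t \<in> {0..1}"
  shows "measure P {x. F x \<le> t} = t"
proof (rule antisym)
  have ev: "{x. F x \<le> t} \<in> sets P" for t by measurable
  show "measure P {x. F x \<le> t} \<le> t"
  proof (rule dense_ge)
    fix s assume s: "t < s"
    show "measure P {x. F x \<le> t} \<le> s"
    proof (cases "s < 1")
      case True
      obtain x where x: "F x = s" using F_attains[of s] True s t by auto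
      have "y \<le> x" if "F y \<le> t" for y using F_less_imp[of y x] x s that by simp
      then have "measure P {x. F x \<le> t} \<le> measure P {..x}" by (intro P.finite_measure_mono) auto
      then show ?thesis using x by (simp add: F cdf_def)
    qed (use P.prob_le_1[of "{x. F x \<le> t}"] in linarith)
  qed
  show "t \<le> measure P {x. F x \<le> t}"
  proof (cases "0 < t \<and> t < 1")
    case True
    then obtain x where x: "F x = t" using F_attains[of t] by auto
    then have "measure P {..x} \<le> measure P {x. F x \<le> t}"
      using F_mono by (intro P.finite_measure_mono) auto
    then show ?thesis using x by (simp add: F cdf_def)
  next
    case False
    then consider "t = 0" | "t = 1" using t by force
    then show ?thesis
    proof cases
      case 2
      then have "{x. F x \<le> t} = space P" using F_bounds by auto
      then show ?thesis using 2 P.prob_space by simp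
    qed simp
  qed
qed

lemma prob_F_between:
  assumes "0 \<le> s" "s \<le> t" "t \<le> 1"
  shows "measure P {x. s < F x \<and> F x \<le> t} = t - s"
proof -
  have "{x. s < F x \<and> F x \<le> t} = {x. F x \<le> t} - {x. F x \<le> s}" by auto
  also have "measure P \<dots> = measure P {x. F x \<le> t} - measure P {x. F x \<le> s}"
    using assms by (intro P.finite_measure_Diff) auto
  finally show ?thesis using assms by (simp add: prob_F_le)
qed

text \<open>The condition reads \<open>1 - t \<le> F x < 1 - s\<close>, closed and open at the
  opposite ends from \<open>prob_F_between\<close>. Shrinking the range by \<open>e\<close> from
  inside gives the lower bound.\<close>

lemma prob_F_co_between:
  assumes "0 \<le> s" "s \<le> t" "t \<le> 1"
  shows "t - s \<le> measure P {x. s < 1 - F x \<and> 1 - F x \<le> t}"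
proof (rule field_le_epsilon)
  fix e :: real assume e: "0 < e"
  have "measure P {x. 1 - t < F x \<and> F x \<le> max (1 - t) (1 - s - e)} = max (1 - t) (1 - s - e) - (1 - t)"
    using assms e by (intro prob_F_between) auto
  moreover have "measure P {x. 1 - t < F x \<and> F x \<le> max (1 - t) (1 - s - e)} \<le> measure P {x. s < 1 - F x \<and> 1 - F x \<le> t}"
    using e by (intro P.finite_measure_mono) auto
  ultimately show "t - s \<le> measure P {x. s < 1 - F x \<and> 1 - F x \<le> t} + e" by linarith
qed

text \<open>If \<open>G\<close> were 0 at \<open>x\<close>, it would be 0 on all of
  \<open>{..x}\<close>, a set of mass \<open>F x > 0\<close> on which the extended integrand is
  infinite. The value 1 is excluded in the same way on \<open>{x<..}\<close>.\<close>

lemma G_interior: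
  assumes "0 < F x" "F x < 1"
  shows "0 < G x" "G x < 1"
proof -
  have inf: False if "A \<in> sets borel" "0 < measure P A" "\<And>y. y \<in> A \<Longrightarrow> log_ratio_sq (F y) (G y) = \<infinity>" for A
  proof -
    have "\<infinity> * emeasure P A = (\<integral>\<^sup>+ y. \<infinity> * indicator A y \<partial>P)" using that(1) by (subst nn_integral_cmult_indicator) auto
    also have "\<dots> \<le> (\<integral>\<^sup>+ t. log_ratio_sq (F t) (G t) \<partial>P)"
      using that(3) by (intro nn_integral_mono) (auto simp: indicator_def)
    finally have "\<infinity> * emeasure P A < \<infinity>" using integral_finite by (rule le_less_trans)
    moreover have "emeasure P A \<noteq> 0" using that(2) by (simp add: P.emeasure_eq_measure)
    ultimately show False by (simp add: ennreal_top_mult)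
  qed
  show "0 < G x"
  proof (rule ccontr)
    assume "\<not> 0 < G x"
    then have "G y = 0" if "y \<le> x" for y using G_mono[OF that] G_bounds[of y] by auto
    then show False using assms by (intro inf[of "{..x}"]) (auto simp: log_ratio_sq_def F cdf_def)
  qed
  show "G x < 1"
  proof (rule ccontr)
    assume "\<not> G x < 1"
    then have "G y = 1" if "x \<le> y" for y using G_mono[OF that] G_bounds[of y] by auto
    moreover have "measure P {x<..} = 1 - F x" using P.prob_compl[of "{..x}"] by (simp add: F cdf_def Compl_eq_Diff_UNIV[symmetric] Compl_atMost)
    ultimately show False using assms by (intro inf[of "{x<..}"]) (auto simp: log_ratio_sq_def)
  qed
qed

text \<open>Monotonicity of \<open>G\<close> carries \<open>G_interior\<close> over to points with
  \<open>F x = 0\<close>, by comparison with a larger point at which \<open>F\<close> is strictly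
  between 0 and 1.\<close>

lemma G_less_1: "F x < 1 \<Longrightarrow> G x < 1"
proof -
  assume F1: "F x < 1"
  obtain y where y: "F y = (F x + 1) / 2" using F_attains[of "(F x + 1) / 2"] F1 F_bounds(1)[of x] by auto
  then have "x < y" using F1 F_less_imp[of x y] by auto
  then have "G x \<le> G y" by (intro G_mono) simp
  moreover have "G y < 1" using y F1 F_bounds(1)[of x] by (intro G_interior) auto
  ultimately show "G x < 1" by simp
qed

lemma G_pos: "0 < F x \<Longrightarrow> 0 < G x"
proof -
  assume F0: "0 < F x"
  obtain y where y: "F y = F x / 2" using F_attains[of "F x / 2"] F0 F_bounds(2)[of x] by auto
  then have "y < x" using F0 F_less_imp[of y x] by auto
  then have "G y \<le> G x" by (intro G_mono) simp
  moreover have "0 < G y" using y F0 F_bounds(2)[of x] by (intro G_interior) auto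
  ultimately show "0 < G x" by simp
qed

lemma L_eq:
  assumes "0 < F x" "F x < 1"
  shows "L x = (ln (F x) - ln (1 - F x)) - (ln (G x) - ln (1 - G x))"
  using assms G_interior[OF assms] by (simp add: log_ratio_def ln_div ln_mult)

lemma L_zero: "F x = 0 \<or> F x = 1 \<Longrightarrow> L x = 0"
  by (auto simp: log_ratio_def)

lemma isCont_L:
  assumes "0 < F x" "F x < 1"
  shows "isCont L x"
  unfolding log_ratio_def using assms G_interior[OF assms] by (intro continuous_intros) auto

text \<open>Since \<open>G\<close> is increasing, the log-ratio can only increase as fast as the logit of \<open>F\<close>.\<close>
lemma L_one_sided:
  assumes "x \<le> y" "0 < F x" "F y < 1"
  shows "L y - L x \<le> (ln (F y) - ln (1 - F y)) - (ln (F x) - ln (1 - F x))"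
proof -
  have xy: "F x < 1" "0 < F y" using F_mono[OF assms(1)] assms by auto
  note Gx = G_interior[OF assms(2) xy(1)] and Gy = G_interior[OF xy(2) assms(3)]
  have "ln (G x) \<le> ln (G y)" "ln (1 - G y) \<le> ln (1 - G x)"
    using G_mono[OF assms(1)] Gx Gy by (auto simp: ln_le_cancel_iff)
  then show ?thesis unfolding L_eq[OF assms(2) xy(1)] L_eq[OF xy(2) assms(3)] by simp
qed

lemma L_measurable[measurable]: "L \<in> borel_measurable borel"
  unfolding log_ratio_def by measurable

lemma L_square_integrable: "integrable P (\<lambda>x. (L x)\<^sup>2)"
proof (rule integrableI_bounded)
  have "(\<integral>\<^sup>+ x. ennreal (norm ((L x)\<^sup>2)) \<partial>P) \<le> (\<integral>\<^sup>+ t. log_ratio_sq (F t) (G t) \<partial>P)"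
    by (intro nn_integral_mono) (auto simp: log_ratio_sq_def)
  then show "(\<integral>\<^sup>+ x. ennreal (norm ((L x)\<^sup>2)) \<partial>P) < \<infinity>" using integral_finite by (rule le_less_trans)
qed measurable

text \<open>Averaging: \<open>(L x)^2\<close> is at most \<open>2 c^2 + 2 (L y)^2\<close> for each
  \<open>y\<close> in \<open>S\<close>, and this is integrated over \<open>S\<close>. If
  \<open>(L x)^2 - 2 c^2\<close> is negative, replacing the mass of \<open>S\<close> by
  \<open>q\<close> would go the wrong way, but then the claim is trivial.\<close>

lemma L_square_bound_aux:
  assumes S: "S \<in> sets borel" "q \<le> measure P S" "0 < q" and T: "S \<subseteq> T" "T \<in> sets borel"
    and b: "\<And>y. y \<in> S \<Longrightarrow> \<bar>L x\<bar> \<le> c + \<bar>L y\<bar>"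
  shows "(L x)\<^sup>2 \<le> 2 * c\<^sup>2 + 2 * (\<integral>y. indicator T y * (L y)\<^sup>2 \<partial>P) / q"
proof (cases "(L x)\<^sup>2 \<le> 2 * c\<^sup>2")
  case True
  have "0 \<le> (\<integral>y. indicator T y * (L y)\<^sup>2 \<partial>P)" by (intro integral_nonneg_AE) auto
  then show ?thesis using True S(3) by (smt (verit) divide_nonneg_pos)
next
  case False
  have i: "integrable P (\<lambda>y. indicator A y * (L y)\<^sup>2)" if "A \<in> sets borel" for A
    using integrable_real_mult_indicator[OF _ L_square_integrable, of A] that by (simp add: mult.commute)
  have pt: "indicator S y * ((L x)\<^sup>2 - 2 * c\<^sup>2) \<le> 2 * (indicator T y * (L y)\<^sup>2)" for y
  proof (cases "y \<in> S")
    case True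
    have "(L x)\<^sup>2 \<le> (c + \<bar>L y\<bar>)\<^sup>2" using power_mono[OF b[OF True], of 2] by simp
    also have "\<dots> \<le> 2 * c\<^sup>2 + 2 * (L y)\<^sup>2" using zero_le_power2[of "c - \<bar>L y\<bar>"] by (simp add: power2_sum power2_diff)
    finally show ?thesis using True T(1) by auto
  qed (simp add: indicator_def)
  have "q * ((L x)\<^sup>2 - 2 * c\<^sup>2) \<le> measure P S * ((L x)\<^sup>2 - 2 * c\<^sup>2)" using False S(2) by (intro mult_right_mono) auto
  also have "\<dots> = (\<integral>y. indicator S y * ((L x)\<^sup>2 - 2 * c\<^sup>2) \<partial>P)" using S(1) by simp
  also have "\<dots> \<le> (\<integral>y. 2 * (indicator T y * (L y)\<^sup>2) \<partial>P)"
  proof (rule integral_mono[OF _ _ pt])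
    show "integrable P (\<lambda>y. indicator S y * ((L x)\<^sup>2 - 2 * c\<^sup>2))"
      using S(1) by (intro integrable_mult_left P.integrable_const_bound[where B=1]) auto
    show "integrable P (\<lambda>y. 2 * (indicator T y * (L y)\<^sup>2))"
      by (intro integrable_mult_right i T(2))
  qed
  finally have "((L x)\<^sup>2 - 2 * c\<^sup>2) * q \<le> 2 * (\<integral>y. indicator T y * (L y)\<^sup>2 \<partial>P)" by (simp add: mult.commute)
  then have "(L x)\<^sup>2 - 2 * c\<^sup>2 \<le> 2 * (\<integral>y. indicator T y * (L y)\<^sup>2 \<partial>P) / q" using S(3) by (simp add: pos_le_divide_eq)
  then show ?thesis by simp
qed

text \<open>Large positive values persist to the left, large negative ones to the right.\<close>
lemma L_square_bound:
  assumes S1: "S1 \<in> sets borel" "q \<le> measure P S1" and S2: "S2 \<in> sets borel" "q \<le> measure P S2" and "0 < q"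
    and T: "S1 \<subseteq> T" "S2 \<subseteq> T" "T \<in> sets borel"
    and 1: "\<And>y. y \<in> S1 \<Longrightarrow> L x - L y \<le> c" and 2: "\<And>y. y \<in> S2 \<Longrightarrow> L y - L x \<le> c"
  shows "(L x)\<^sup>2 \<le> 2 * c\<^sup>2 + 2 * (\<integral>y. indicator T y * (L y)\<^sup>2 \<partial>P) / q"
proof (cases "0 \<le> L x")
  case True
  have "\<bar>L x\<bar> \<le> c + \<bar>L y\<bar>" if "y \<in> S1" for y using 1[OF that] True by linarith
  then show ?thesis by (intro L_square_bound_aux[OF S1 \<open>0 < q\<close> T(1,3)])
next
  case False
  have "\<bar>L x\<bar> \<le> c + \<bar>L y\<bar>" if "y \<in> S2" for y using 2[OF that] False by linarith
  then show ?thesis by (intro L_square_bound_aux[OF S2 \<open>0 < q\<close> T(2,3)])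
qed

text \<open>The 8 is \<open>4 * 2\<close>: \<open>t / s\<close> is at most 4, and
  \<open>(1 - s) / (1 - t)\<close> is at most 2 because \<open>t \<le> 1/2\<close>.\<close>

lemma logit_increment:
  fixes s t h :: real
  assumes "0 < h" "h \<le> 1/4" "h / 4 < s" "s \<le> 2 * h" "h / 4 < t" "t \<le> 2 * h" "t \<le> 4 * s"
  shows "(ln t - ln (1 - t)) - (ln s - ln (1 - s)) \<le> ln 8"
proof -
  have st: "0 < s" "s \<le> 1/2" "0 < t" "t \<le> 1/2" using assms by auto
  have "(ln t - ln (1 - t)) - (ln s - ln (1 - s)) = ln (t * (1 - s) / (s * (1 - t)))"
    using st by (simp add: ln_div ln_mult)
  also have "\<dots> \<le> ln 8"
  proof (subst ln_le_cancel_iff)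
    have "t * (1 - s) \<le> 4 * s * 1" using st assms(7) by (intro mult_mono) auto
    also have "4 * s \<le> 8 * (s * (1 - t))" using st mult_left_mono[of "1/2" "1 - t" "8 * s"] by simp
    finally show "t * (1 - s) / (s * (1 - t)) \<le> 8" using st by (simp add: divide_le_eq)
  qed (use st in auto)
  finally show ?thesis .
qed

text \<open>A value of \<open>L\<close> on block \<open>k\<close> is compared with its values on the
  two adjacent blocks, each of mass at least \<open>2^-k / 4\<close>. This gives
  \<open>w_k^2 = 2 (ln 8)^2 + 8 2^k J_k\<close>, where \<open>J_k\<close> is the integral of
  \<open>L^2\<close> over the windows at both ends. Divided by \<open>2^k\<close> it is a geometric
  term plus \<open>8 J_k\<close>, and the \<open>J_k\<close> are summable because the windows
  overlap boundedly.\<close>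

lemma L_dyadic_weights:
  obtains w :: "nat \<Rightarrow> real" where "\<And>k. 0 < w k" "summable (\<lambda>k. (w k)\<^sup>2 / 2^k)"
    "\<And>k x. 2 \<le> k \<Longrightarrow> 1 / 2^(k+1) < F x \<Longrightarrow> F x \<le> 1 / 2^k \<Longrightarrow> \<bar>L x\<bar> \<le> w k"
    "\<And>k x. 2 \<le> k \<Longrightarrow> 1 / 2^(k+1) < 1 - F x \<Longrightarrow> 1 - F x \<le> 1 / 2^k \<Longrightarrow> \<bar>L x\<bar> \<le> w k"
proof -
  define W where "W k t \<longleftrightarrow> (1 / 2^k) / 4 < t \<and> t \<le> 2 * (1 / 2^k)" for k :: nat and t :: real
  define T where "T k = {x. W k (F x) \<or> W k (1 - F x)}" for k
  define J where "J k = (\<integral>y. indicator (T k) y * (L y)\<^sup>2 \<partial>P)" for k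
  define w where "w k = sqrt (2 * (ln 8)\<^sup>2 + 2 * J k / (1 / 2^k / 4))" for k
  have Tm: "T k \<in> sets borel" for k unfolding T_def W_def by measurable
  have J0: "0 \<le> J k" for k unfolding J_def by (intro integral_nonneg_AE) auto
  have l8: "0 < ln (8::real)" by simp
  have w2: "(w k)\<^sup>2 = 2 * (ln 8)\<^sup>2 + 2 * J k / (1 / 2^k / 4)" for k
    unfolding w_def using J0[of k] by (intro real_sqrt_pow2) auto
  have "0 < 2 * (ln 8)\<^sup>2 + 2 * J k / (1 / 2^k / 4)" for k
    using J0[of k] l8 by (intro add_pos_nonneg) auto
  then have wpos: "0 < w k" for k unfolding w_def by simp
  have i: "integrable P (\<lambda>y. indicator (T k) y * (L y)\<^sup>2)" for k
    using integrable_real_mult_indicator[OF _ L_square_integrable, of "T k"] Tm by (simp add: mult.commute)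
  \<comment> \<open>A window spans a factor 8, so a point lies in at most three of them; counting
    both ends gives the 6 below.\<close>
  have count: "card {k. k < n \<and> W k t} \<le> 3" for n t
  proof (cases "{k. k < n \<and> W k t} = {}")
    case False
    define m where "m = Min {k. k < n \<and> W k t}"
    have m: "W m t" using Min_in[of "{k. k < n \<and> W k t}"] False by (auto simp: m_def)
    have "k \<in> {m..m+2}" if k: "k < n" "W k t" for k
    proof -
      have "m \<le> k" unfolding m_def using k by (intro Min_le) auto
      moreover have "k < m + 3"
      proof (rule ccontr)
        assume "\<not> k < m + 3"
        then have "(2::real)^(m+3) \<le> 2^k" by (intro power_increasing) auto
        then have "2 * (1 / 2^k) \<le> 2 * (1 / (2::real)^(m+3))" by (intro mult_left_mono divide_left_mono) auto
        also have "\<dots> = (1 / 2^m) / 4" by (simp add: power_add)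
        finally show False using m k(2) unfolding W_def by linarith
      qed
      ultimately show ?thesis by auto
    qed
    then have "card {k. k < n \<and> W k t} \<le> card {m..m+2}" by (intro card_mono) auto
    then show ?thesis by simp
  next
    case True
    show ?thesis unfolding True by simp
  qed
  have sumT: "(\<Sum>k<n. indicator (T k) y :: real) \<le> 6" for n y
  proof -
    have "(\<Sum>k<n. indicator (T k) y :: real) \<le> (\<Sum>k<n. of_bool (W k (F y)) + of_bool (W k (1 - F y)))"
      by (intro sum_mono) (auto simp: indicator_def T_def)
    also have "\<dots> = real (card {k. k < n \<and> W k (F y)}) + real (card {k. k < n \<and> W k (1 - F y)})"
      by (simp add: sum.distrib lessThan_def Int_def)
    also have "\<dots> \<le> 6" using count[of n "F y"] count[of n "1 - F y"] by linarith
    finally show ?thesis .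
  qed
  have "summable J"
  proof (rule summableI_nonneg_bounded[OF J0])
    fix n
    have "(\<Sum>k<n. J k) = (\<integral>y. (\<Sum>k<n. indicator (T k) y * (L y)\<^sup>2) \<partial>P)"
      unfolding J_def by (rule Bochner_Integration.integral_sum[OF i, symmetric])
    also have "\<dots> \<le> (\<integral>y. 6 * (L y)\<^sup>2 \<partial>P)"
    proof (rule integral_mono)
      show "(\<Sum>k<n. indicator (T k) y * (L y)\<^sup>2) \<le> 6 * (L y)\<^sup>2" for y
        unfolding sum_distrib_right[symmetric] using sumT by (intro mult_right_mono) auto
    qed (intro Bochner_Integration.integrable_sum integrable_mult_right i L_square_integrable)+
    finally show "(\<Sum>k<n. J k) \<le> (\<integral>y. 6 * (L y)\<^sup>2 \<partial>P)" .
  qed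
  then have "summable (\<lambda>k. 2 * (ln 8)\<^sup>2 * (1 / 2)^k + 8 * J k)"
    by (intro summable_add summable_mult summable_geometric) auto
  moreover have "(w k)\<^sup>2 / 2^k = 2 * (ln 8)\<^sup>2 * (1 / 2)^k + 8 * J k" for k
    unfolding w2 by (simp add: add_divide_distrib power_one_over)
  ultimately have sum: "summable (\<lambda>k. (w k)\<^sup>2 / 2^k)" by simp
  show ?thesis
  proof (rule that[OF wpos sum])
    fix k :: nat and x assume k: "2 \<le> k"
    define h where "h = 1 / (2::real)^k"
    have "(2::real)^2 \<le> 2^k" using k by (intro power_increasing) auto
    then have h: "0 < h" "h \<le> 1/4" by (auto simp: h_def divide_simps)
    have conv: "\<bar>L x\<bar> \<le> w k" if "(L x)\<^sup>2 \<le> 2 * (ln 8)\<^sup>2 + 2 * J k / (1 / 2^k / 4)"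
      unfolding w_def by (rule real_le_rsqrt) (use that in simp)
    {
      assume x: "1 / 2^(k+1) < F x" "F x \<le> 1 / 2^k"
      then have x': "h / 2 < F x" "F x \<le> h" by (auto simp: h_def)
      have "(L x)\<^sup>2 \<le> 2 * (ln 8)\<^sup>2 + 2 * (\<integral>y. indicator (T k) y * (L y)\<^sup>2 \<partial>P) / (h / 4)"
      proof (rule L_square_bound)
        show "h / 4 \<le> measure P {y. h / 4 < F y \<and> F y \<le> h / 2}" using h by (subst prob_F_between) auto
        show "h / 4 \<le> measure P {y. h < F y \<and> F y \<le> 2 * h}" using h by (subst prob_F_between) auto
        show "L x - L y \<le> ln 8" if "y \<in> {y. h / 4 < F y \<and> F y \<le> h / 2}" for y
        proof -
          have "y < x" using that x' F_less_imp[of y x] by auto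
          then have "L x - L y \<le> (ln (F x) - ln (1 - F x)) - (ln (F y) - ln (1 - F y))"
            using that x' h by (intro L_one_sided) auto
          also have "\<dots> \<le> ln 8" using that x' h by (intro logit_increment[of h]) auto
          finally show ?thesis .
        qed
        show "L y - L x \<le> ln 8" if "y \<in> {y. h < F y \<and> F y \<le> 2 * h}" for y
        proof -
          have "x < y" using that x' F_less_imp[of x y] by auto
          then have "L y - L x \<le> (ln (F y) - ln (1 - F y)) - (ln (F x) - ln (1 - F x))"
            using that x' h by (intro L_one_sided) auto
          also have "\<dots> \<le> ln 8" using that x' h by (intro logit_increment[of h]) auto
          finally show ?thesis .
        qed
      qed (use h Tm in \<open>auto simp: T_def W_def h_def[symmetric]\<close>)
      then show "\<bar>L x\<bar> \<le> w k" by (intro conv) (simp only: J_def h_def)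
    }
    {
      assume x: "1 / 2^(k+1) < 1 - F x" "1 - F x \<le> 1 / 2^k"
      then have x': "h / 2 < 1 - F x" "1 - F x \<le> h" by (auto simp: h_def)
      have "(L x)\<^sup>2 \<le> 2 * (ln 8)\<^sup>2 + 2 * (\<integral>y. indicator (T k) y * (L y)\<^sup>2 \<partial>P) / (h / 4)"
      proof (rule L_square_bound)
        \<comment> \<open>At the upper end \<open>1 - F\<close> decreases, so the neighbour to the
          left is now the outer range \<open>(h, 2 h]\<close> of \<open>1 - F\<close>.\<close>
        show "h / 4 \<le> measure P {y. h < 1 - F y \<and> 1 - F y \<le> 2 * h}" using prob_F_co_between[of h "2 * h"] h by auto
        show "h / 4 \<le> measure P {y. h / 4 < 1 - F y \<and> 1 - F y \<le> h / 2}" using prob_F_co_between[of "h / 4" "h / 2"] h by auto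
        show "L x - L y \<le> ln 8" if "y \<in> {y. h < 1 - F y \<and> 1 - F y \<le> 2 * h}" for y
        proof -
          have "y < x" using that x' F_less_imp[of y x] by auto
          then have "L x - L y \<le> (ln (F x) - ln (1 - F x)) - (ln (F y) - ln (1 - F y))"
            using that x' h by (intro L_one_sided) auto
          \<comment> \<open>The logit changes sign under \<open>t \<mapsto> 1 - t\<close>, so the
            increment is read off from \<open>1 - F\<close> with the two points exchanged.\<close>
          also have "\<dots> \<le> ln 8" using that x' h logit_increment[of h "1 - F x" "1 - F y"] by auto
          finally show ?thesis .
        qed
        show "L y - L x \<le> ln 8" if "y \<in> {y. h / 4 < 1 - F y \<and> 1 - F y \<le> h / 2}" for y
        proof -
          have "x < y" using that x' F_less_imp[of x y] by auto
          then have "L y - L x \<le> (ln (F y) - ln (1 - F y)) - (ln (F x) - ln (1 - F x))"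
            using that x' h by (intro L_one_sided) auto
          also have "\<dots> \<le> ln 8" using that x' h logit_increment[of h "1 - F y" "1 - F x"] by auto
          finally show ?thesis .
        qed
      qed (use h Tm in \<open>auto simp: T_def W_def h_def[symmetric]\<close>)
      then show "\<bar>L x\<bar> \<le> w k" by (intro conv) (simp only: J_def h_def)
    }
  qed
qed

text \<open>\<open>G\<close> is squeezed between its values at \<open>x0\<close> and
  \<open>x1\<close>, which are interior. The levels are halved because \<open>F\<close> may be flat:
  \<open>F x0 < F x\<close> forces \<open>x0 < x\<close>, equality would not.\<close>

lemma L_bounded_center:
  assumes h: "0 < h" "h < 1/2"
  obtains m where "\<And>x. h \<le> F x \<Longrightarrow> F x \<le> 1 - h \<Longrightarrow> \<bar>L x\<bar> \<le> m"
proof -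
  obtain x0 where x0: "F x0 = h / 2" using F_attains[of "h / 2"] h by auto
  obtain x1 where x1: "F x1 = 1 - h / 2" using F_attains[of "1 - h / 2"] h by auto
  note x01 = x0 x1
  have G01: "0 < G x0" "G x1 < 1" using x01 h G_interior[of x0] G_interior[of x1] by auto
  show ?thesis
  proof (rule that)
    fix x assume x: "h \<le> F x" "F x \<le> 1 - h"
    have "x0 \<le> x" "x \<le> x1" using x x01 h F_less_imp[of x0 x] F_less_imp[of x x1] by auto
    then have Gx: "G x0 \<le> G x" "G x \<le> G x1" by (auto intro: G_mono)
    have b: "\<bar>ln t\<bar> \<le> \<bar>ln s\<bar>" if "0 < s" "s \<le> t" "t \<le> 1" for s t :: real
    proof -
      have "ln s \<le> ln t" "ln t \<le> 0" using that by auto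
      then show ?thesis by linarith
    qed
    have "\<bar>ln (F x)\<bar> \<le> \<bar>ln h\<bar>" "\<bar>ln (1 - F x)\<bar> \<le> \<bar>ln h\<bar>" "\<bar>ln (G x)\<bar> \<le> \<bar>ln (G x0)\<bar>" "\<bar>ln (1 - G x)\<bar> \<le> \<bar>ln (1 - G x1)\<bar>"
      using x h Gx G01 F_bounds[of x] G_bounds[of x] by (auto intro!: b)
    moreover have "L x = (ln (F x) - ln (1 - F x)) - (ln (G x) - ln (1 - G x))" using x h by (intro L_eq) auto
    ultimately show "\<bar>L x\<bar> \<le> 2 * \<bar>ln h\<bar> + \<bar>ln (G x0)\<bar> + \<bar>ln (1 - G x1)\<bar>" by linarith
  qed
qed

end

section \<open>Weighted paths near the ends of the support and continuity of the divergence\<close>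

context square_integrable_log_ratio
begin

text \<open>Reads a bound valid on all dyadic scales at the scale that contains \<open>F x\<close>
  or \<open>1 - F x\<close>. It is stated for an arbitrary function \<open>b\<close> so as to serve
  both the empirical process and the bridge.\<close>

lemma weighted_tail_at:
  assumes w: "\<And>k x. 2 \<le> k \<Longrightarrow> 1 / 2^(k+1) < F x \<Longrightarrow> F x \<le> 1 / 2^k \<Longrightarrow> \<bar>L x\<bar> \<le> w k"
    "\<And>k x. 2 \<le> k \<Longrightarrow> 1 / 2^(k+1) < 1 - F x \<Longrightarrow> 1 - F x \<le> 1 / 2^k \<Longrightarrow> \<bar>L x\<bar> \<le> w k"
    and b: "\<And>k t. K \<le> k \<Longrightarrow> t \<in> {0..1/2^k} \<Longrightarrow> \<bar>b t\<bar> * w k \<le> a \<and> \<bar>b (1 - t)\<bar> * w k \<le> a"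
    and K: "2 \<le> K" and x: "F x \<le> 1 / 2^K \<or> 1 - F x \<le> 1 / 2^K" and a: "0 \<le> a"
  shows "\<bar>b (F x) * L x\<bar> \<le> a"
proof (cases "0 < F x \<and> F x < 1")
  case False
  then have "F x = 0 \<or> F x = 1" using F_bounds[of x] by auto
  then show ?thesis using a L_zero[of x] by auto
next
  case True
  have K2: "1 / (2::real)^K \<le> 1/2"
    using power_increasing[of 1 K "2::real"] K by (simp add: divide_simps)
  have block: "\<exists>k\<ge>K. 1 / 2^(k+1) < s \<and> s \<le> 1 / 2^k" if s: "0 < s" "s \<le> 1 / 2^K" for s :: real
  proof -
    obtain k where k: "1 / 2^(k + 1) < s" "s \<le> 1 / 2^k" using dyadic_block[of s] s K2 by auto
    have "1 / (2::real)^(k + 1) < 1 / 2^K" using k(1) s(2) by (rule less_le_trans)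
    then have "(2::real)^K < 2^(k+1)" by (simp add: divide_simps)
    then have "K < k + 1" by (rule power_less_imp_less_exp[rotated]) simp
    then show ?thesis using k by (intro exI[of _ k]) auto
  qed
  from x show ?thesis
  proof
    assume "F x \<le> 1 / 2^K"
    then obtain k where k: "K \<le> k" "1 / 2^(k+1) < F x" "F x \<le> 1 / 2^k" using block True by blast
    have "\<bar>b (F x)\<bar> * \<bar>L x\<bar> \<le> \<bar>b (F x)\<bar> * w k" using w(1)[of k x] k K by (intro mult_left_mono) auto
    also have "\<dots> \<le> a" using b[of k "F x"] k True by auto
    finally show ?thesis by (simp add: abs_mult)
  next
    assume "1 - F x \<le> 1 / 2^K"
    then obtain k where k: "K \<le> k" "1 / 2^(k+1) < 1 - F x" "1 - F x \<le> 1 / 2^k" using block[of "1 - F x"] True by auto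
    have "\<bar>b (F x)\<bar> * \<bar>L x\<bar> \<le> \<bar>b (F x)\<bar> * w k" using w(2)[of k x] k K by (intro mult_left_mono) auto
    also have "\<dots> \<le> a" using b[of k "1 - F x"] k True by auto
    finally show ?thesis by (simp add: abs_mult)
  qed
qed

text \<open>Nearness to an end is measured by \<open>F\<close> and not by \<open>x\<close>, so
  finite end points of the support and infinite ones are covered alike.\<close>

definition vanishing_at_ends :: "(real \<Rightarrow> real) \<Rightarrow> bool" where
  "vanishing_at_ends b \<longleftrightarrow> (\<forall>a>0. \<exists>h>0. \<forall>x. F x \<le> h \<or> 1 - F x \<le> h \<longrightarrow> \<bar>b (F x) * L x\<bar> \<le> a)"

lemma vanishing_at_endsI:
  assumes w: "\<And>k x. 2 \<le> k \<Longrightarrow> 1 / 2^(k+1) < F x \<Longrightarrow> F x \<le> 1 / 2^k \<Longrightarrow> \<bar>L x\<bar> \<le> w k"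
    "\<And>k x. 2 \<le> k \<Longrightarrow> 1 / 2^(k+1) < 1 - F x \<Longrightarrow> 1 - F x \<le> 1 / 2^k \<Longrightarrow> \<bar>L x\<bar> \<le> w k"
    and b: "\<forall>a>0. \<exists>K. \<forall>k\<ge>K. \<forall>t\<in>{0..1/2^k}. \<bar>b t\<bar> * w k \<le> a \<and> \<bar>b (1 - t)\<bar> * w k \<le> a"
  shows "vanishing_at_ends b"
  unfolding vanishing_at_ends_def
proof (intro allI impI)
  fix a :: real assume a: "0 < a"
  then obtain K where K: "\<And>k t. K \<le> k \<Longrightarrow> t \<in> {0..1/2^k} \<Longrightarrow> \<bar>b t\<bar> * w k \<le> a \<and> \<bar>b (1 - t)\<bar> * w k \<le> a"
    using b by blast
  have "\<bar>b (F x) * L x\<bar> \<le> a" if "F x \<le> 1 / 2^(max 2 K) \<or> 1 - F x \<le> 1 / 2^(max 2 K)" for x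
    by (rule weighted_tail_at[where w=w and K="max 2 K", OF w _ _ that]) (use K a in auto)
  then show "\<exists>h>0. \<forall>x. F x \<le> h \<or> 1 - F x \<le> h \<longrightarrow> \<bar>b (F x) * L x\<bar> \<le> a"
    by (intro exI[of _ "1 / 2^(max 2 K)"]) auto
qed

lemma vanishing_tendsto:
  assumes b: "vanishing_at_ends b" and lim: "(F \<longlongrightarrow> 0) A \<or> (F \<longlongrightarrow> 1) A"
  shows "((\<lambda>x. b (F x) * L x) \<longlongrightarrow> 0) A"
proof (rule tendstoI)
  fix e :: real assume e: "0 < e"
  then have "0 < e / 2" by simp
  then obtain h where h: "0 < h" "\<And>x. F x \<le> h \<or> 1 - F x \<le> h \<Longrightarrow> \<bar>b (F x) * L x\<bar> \<le> e / 2"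
    using b unfolding vanishing_at_ends_def by blast
  have "eventually (\<lambda>x. F x < h \<or> 1 - h < F x) A"
    using lim order_tendstoD(2)[of F 0 A h] order_tendstoD(1)[of F 1 A "1 - h"] h(1) by (auto elim: eventually_mono)
  then show "eventually (\<lambda>x. dist (b (F x) * L x) 0 < e) A"
  proof eventually_elim
    case (elim x)
    then have "\<bar>b (F x) * L x\<bar> \<le> e / 2" by (intro h(2)) auto
    then show ?case using e by (simp add: dist_real_def)
  qed
qed

text \<open>\<open>L\<close> itself may be discontinuous where \<open>F\<close> is 0 or 1; there the
  product tends to 0, which agrees with the default value 0 of \<open>L\<close>.\<close>

lemma vanishing_continuous:
  assumes b: "vanishing_at_ends b" and c: "continuous_on {0..1} b"
  shows "continuous_on UNIV (\<lambda>x. b (F x) * L x)"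
  unfolding continuous_on_eq_continuous_at[OF open_UNIV]
proof
  fix x
  have bF: "continuous_on UNIV (\<lambda>x. b (F x))"
    using F_bounds by (intro continuous_on_compose2[OF c F_cont]) auto
  consider "0 < F x" "F x < 1" | "F x = 0 \<or> F x = 1" using F_bounds[of x] by fastforce
  then show "isCont (\<lambda>x. b (F x) * L x) x"
  proof cases
    case 1
    then show ?thesis using bF isCont_L[OF 1] by (intro continuous_mult) (auto simp: continuous_on_eq_continuous_at)
  next
    case 2
    then have "((\<lambda>x. b (F x) * L x) \<longlongrightarrow> 0) (at x)"
      using F_isCont[of x] by (intro vanishing_tendsto[OF b]) (auto simp: isCont_def)
    then show ?thesis using 2 L_zero[of x] by (auto simp: isCont_def)
  qed
qed

text \<open>The terms of the convergent series tend to 0, so \<open>w_k\<close> is of smaller order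
  than \<open>2^(k/2)\<close>, and \<open>t w_k\<close> is small for \<open>t\<close> up to
  \<open>2^-k\<close>. This gives continuity of \<open>K\<close> and its limits at both
  ends.\<close>

lemma vanishing_variance: "vanishing_at_ends (\<lambda>t. t * (1 - t))"
proof -
  obtain w where w: "\<And>k. 0 < w k" "summable (\<lambda>k. (w k)\<^sup>2 / 2^k)"
    "\<And>k x. 2 \<le> k \<Longrightarrow> 1 / 2^(k+1) < F x \<Longrightarrow> F x \<le> 1 / 2^k \<Longrightarrow> \<bar>L x\<bar> \<le> w k"
    "\<And>k x. 2 \<le> k \<Longrightarrow> 1 / 2^(k+1) < 1 - F x \<Longrightarrow> 1 - F x \<le> 1 / 2^k \<Longrightarrow> \<bar>L x\<bar> \<le> w k"
    using L_dyadic_weights by blast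
  show ?thesis
  proof (rule vanishing_at_endsI[where w=w and b="\<lambda>t. t * (1 - t)", OF w(3,4)], assumption+, intro allI impI)
    fix a :: real assume a: "0 < a"
    have "0 < a\<^sup>2" using a by simp
    from order_tendstoD(2)[OF summable_LIMSEQ_zero[OF w(2)] this]
    obtain K where K: "\<And>k. K \<le> k \<Longrightarrow> (w k)\<^sup>2 / 2^k < a\<^sup>2" unfolding eventually_sequentially by blast
    have le: "t * (1 - t) * w k \<le> a" if k: "K \<le> k" and t: "t \<in> {0..1/2^k}" for k t
    proof -
      have p1: "1 \<le> (2::real)^k" by simp
      have t1: "t \<le> 1" using t p1 by (smt (verit) atLeastAtMost_iff divide_le_eq_1)
      have "(t * w k)\<^sup>2 \<le> (1 / 2^k * w k)\<^sup>2" using t w(1)[of k] by (intro power_mono mult_right_mono) auto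
      also have "\<dots> = ((w k)\<^sup>2 / 2^k) / 2^k" by (simp add: power2_eq_square)
      also have "\<dots> \<le> ((w k)\<^sup>2 / 2^k) / 1" using p1 by (intro divide_left_mono) auto
      also have "\<dots> \<le> a\<^sup>2" using K[OF k] by simp
      finally have "(t * w k)\<^sup>2 \<le> a\<^sup>2" .
      then have tw: "t * w k \<le> a" by (rule power2_le_imp_le) (use a in simp)
      have "t * (1 - t) * w k = (1 - t) * (t * w k)" by simp
      also have "\<dots> \<le> 1 * (t * w k)" using t t1 w(1)[of k] by (intro mult_right_mono) auto
      finally show ?thesis using tw by simp
    qed
    have "t * (1 - t) \<ge> 0" if "t \<in> {0..1/2^k}" for k :: nat and t :: real
    proof -
      have "1 / (2::real)^k \<le> 1" by simp
      then show ?thesis using that by (intro mult_nonneg_nonneg) (auto intro: order_trans)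
    qed
    note nn = this
    have "\<bar>t * (1 - t)\<bar> * w k \<le> a \<and> \<bar>(1 - t) * (1 - (1 - t))\<bar> * w k \<le> a" if "K \<le> k" "t \<in> {0..1/2^k}" for k t
    proof -
      have "(1 - t) * (1 - (1 - t)) = t * (1 - t)" by (simp add: algebra_simps)
      moreover have "\<bar>t * (1 - t)\<bar> * w k \<le> a" using le[OF that] by (subst abs_of_nonneg[OF nn[OF that(2)]])
      ultimately show ?thesis by presburger
    qed
    then show "\<exists>K. \<forall>k\<ge>K. \<forall>t\<in>{0..1/2^k}. \<bar>t * (1 - t)\<bar> * w k \<le> a \<and> \<bar>(1 - t) * (1 - (1 - t))\<bar> * w k \<le> a" by blast
  qed
qed

abbreviation K :: "real \<Rightarrow> real" where "K x \<equiv> bern_KL (F x) (G x)"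

text \<open>Isolates the summand that is delicate near \<open>F = 0\<close>; the remaining logarithm
  is harmless there. \<open>K_eq_high\<close> is the counterpart near \<open>F = 1\<close>.\<close>

lemma K_eq_low:
  assumes "F x < 1"
  shows "K x = F x * L x + ln ((1 - F x) / (1 - G x))"
proof (cases "F x = 0")
  case True
  then show ?thesis by (simp add: bern_KL_def)
next
  case False
  then have F0: "0 < F x" using F_bounds(1)[of x] by simp
  show ?thesis
    unfolding bern_KL_def L_eq[OF F0 assms] using F0 assms G_interior[OF F0 assms]
    by (simp add: ln_div algebra_simps)
qed

lemma K_eq_high:
  assumes "0 < F x"
  shows "K x = ln (F x / G x) - (1 - F x) * L x"
proof (cases "F x = 1")
  case True
  then show ?thesis by (simp add: bern_KL_def)
next
  case False
  then have F1: "F x < 1" using F_bounds(2)[of x] by simp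
  show ?thesis
    unfolding bern_KL_def L_eq[OF assms F1] using F1 assms G_interior[OF assms F1]
    by (simp add: ln_div algebra_simps)
qed

lemma FL_tendsto:
  assumes "(F \<longlongrightarrow> 0) A"
  shows "((\<lambda>x. F x * L x) \<longlongrightarrow> 0) A"
proof -
  have "((\<lambda>x. F x * (1 - F x) * L x / (1 - F x)) \<longlongrightarrow> 0 / (1 - 0)) A"
    using vanishing_tendsto[OF vanishing_variance] assms by (intro tendsto_intros) auto
  moreover have "eventually (\<lambda>x. F x < 1) A" using order_tendstoD(2)[OF assms, of 1] by simp
  then have "eventually (\<lambda>x. F x * (1 - F x) * L x / (1 - F x) = F x * L x) A" by eventually_elim simp
  ultimately show ?thesis using Lim_transform_eventually by fastforce
qed

lemma coFL_tendsto:
  assumes "(F \<longlongrightarrow> 1) A"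
  shows "((\<lambda>x. (1 - F x) * L x) \<longlongrightarrow> 0) A"
proof -
  have "((\<lambda>x. F x * (1 - F x) * L x / F x) \<longlongrightarrow> 0 / 1) A"
    using vanishing_tendsto[OF vanishing_variance] assms by (intro tendsto_intros) auto
  moreover have "eventually (\<lambda>x. 0 < F x) A" using order_tendstoD(1)[OF assms, of 0] by simp
  then have "eventually (\<lambda>x. F x * (1 - F x) * L x / F x = (1 - F x) * L x) A" by eventually_elim simp
  ultimately show ?thesis using Lim_transform_eventually by fastforce
qed

lemma K_at_bot: "(K \<longlongrightarrow> 0) at_bot"
proof -
  have "((\<lambda>x. F x * L x + ln ((1 - F x) / (1 - G x))) \<longlongrightarrow> 0 + ln ((1 - 0) / (1 - 0))) at_bot"
    using F_lim(1) G_lim(1) by (intro tendsto_intros FL_tendsto) auto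
  moreover have "eventually (\<lambda>x. F x < 1) at_bot" using order_tendstoD(2)[OF F_lim(1), of 1] by simp
  then have "eventually (\<lambda>x. F x * L x + ln ((1 - F x) / (1 - G x)) = K x) at_bot"
    by eventually_elim (rule K_eq_low[symmetric])
  ultimately show ?thesis using Lim_transform_eventually by fastforce
qed

lemma K_at_top: "(K \<longlongrightarrow> 0) at_top"
proof -
  have "((\<lambda>x. ln (F x / G x) - (1 - F x) * L x) \<longlongrightarrow> ln (1 / 1) - 0) at_top"
    using F_lim(2) G_lim(2) by (intro tendsto_intros coFL_tendsto) auto
  moreover have "eventually (\<lambda>x. 0 < F x) at_top" using order_tendstoD(1)[OF F_lim(2), of 0] by simp
  then have "eventually (\<lambda>x. ln (F x / G x) - (1 - F x) * L x = K x) at_top"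
    by eventually_elim (rule K_eq_high[symmetric])
  ultimately show ?thesis using Lim_transform_eventually by fastforce
qed

lemma isCont_FL: "F x < 1 \<Longrightarrow> isCont (\<lambda>x. F x * L x) x"
proof (cases "F x = 0")
  case True
  then show ?thesis using FL_tendsto[of "at x"] F_isCont[of x] by (simp add: isCont_def)
next
  case False
  assume "F x < 1"
  then show ?thesis using False F_bounds(1)[of x] by (intro continuous_mult isCont_L) auto
qed

lemma isCont_coFL: "0 < F x \<Longrightarrow> isCont (\<lambda>x. (1 - F x) * L x) x"
proof (cases "F x = 1")
  case True
  then show ?thesis using coFL_tendsto[of "at x"] F_isCont[of x] by (simp add: isCont_def)
next
  case False
  assume "0 < F x"
  then show ?thesis using False F_bounds(2)[of x] by (intro continuous_mult continuous_diff isCont_L) auto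
qed

text \<open>Near every point one of the two formulas for \<open>K\<close> is valid, and
  \<open>G_less_1\<close> or \<open>G_pos\<close> keeps its logarithm finite.\<close>

lemma K_continuous: "continuous_on UNIV K"
  unfolding continuous_on_eq_continuous_at[OF open_UNIV]
proof
  fix x
  show "isCont K x"
  proof (cases "F x < 1")
    case True
    have "eventually (\<lambda>y. F y < 1) (nhds x)" using order_tendstoD(2)[of F "F x" "nhds x"] F_isCont[of x] True
      by (simp add: isCont_def tendsto_at_iff_tendsto_nhds)
    then have "eventually (\<lambda>y. F y * L y + ln ((1 - F y) / (1 - G y)) = K y) (nhds x)"
      by eventually_elim (rule K_eq_low[symmetric])
    moreover have "isCont (\<lambda>y. F y * L y + ln ((1 - F y) / (1 - G y))) x"
      using True G_less_1[OF True] by (intro continuous_intros isCont_FL) auto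
    ultimately show ?thesis by (simp cong: isCont_cong)
  next
    case False
    then have F0: "0 < F x" by simp
    have "eventually (\<lambda>y. 0 < F y) (nhds x)" using order_tendstoD(1)[of F "F x" "nhds x"] F_isCont[of x] F0
      by (simp add: isCont_def tendsto_at_iff_tendsto_nhds)
    then have "eventually (\<lambda>y. ln (F y / G y) - (1 - F y) * L y = K y) (nhds x)"
      by eventually_elim (rule K_eq_high[symmetric])
    moreover have "isCont (\<lambda>y. ln (F y / G y) - (1 - F y) * L y) x"
      using F0 G_pos[OF F0] by (intro continuous_intros isCont_coFL) auto
    ultimately show ?thesis by (simp cong: isCont_cong)
  qed
qed

lemma bern_KL_expansion:
  assumes p: "0 \<le> p" "p \<le> 1" and "0 < F x" "F x < 1"
  shows "bern_KL p (G x) = K x + (p - F x) * L x + bern_KL p (F x)"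
proof -
  note Gx = G_interior[OF assms(3,4)]
  have "p * ln (p / G x) = p * ln (p / F x) + p * (ln (F x) - ln (G x))"
    using p assms Gx by (cases "p = 0") (auto simp: ln_div algebra_simps)
  moreover have "(1 - p) * ln ((1 - p) / (1 - G x)) = (1 - p) * ln ((1 - p) / (1 - F x)) + (1 - p) * (ln (1 - F x) - ln (1 - G x))"
    using p assms Gx by (cases "p = 1") (auto simp: ln_div algebra_simps)
  ultimately show ?thesis
    unfolding bern_KL_def L_eq[OF assms(3,4)] using assms Gx by (simp add: ln_div algebra_simps)
qed

end

section \<open>The supremum functional and measurability\<close>

text \<open>The real \<open>Sup\<close> is the least upper bound operator applied without any check
  of boundedness, so it depends on the set of upper bounds alone. Uncountable suprema can thus be
  replaced by countable ones even where they are default values.\<close>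

lemma Sup_real_cong:
  fixes X Y :: "real set"
  assumes "\<And>z. (\<forall>x\<in>X. x \<le> z) \<longleftrightarrow> (\<forall>x\<in>Y. x \<le> z)"
  shows "Sup X = Sup Y"
  unfolding Sup_real_def using assms by simp

lemma borel_measurable_cSUP_real:
  fixes f :: "'i \<Rightarrow> 'a \<Rightarrow> real"
  assumes "countable I" "\<And>i. i \<in> I \<Longrightarrow> f i \<in> borel_measurable M"
  shows "(\<lambda>x. SUP i\<in>I. f i x) \<in> borel_measurable M"
proof -
  have "(SUP i\<in>I. f i x) = - (INF i\<in>I. - f i x)" for x
    unfolding Inf_real_def by (simp add: image_image)
  moreover have "(\<lambda>x. - (INF i\<in>I. - f i x)) \<in> borel_measurable M"
    using assms by (intro borel_measurable_uminus borel_measurable_cINF_real) auto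
  ultimately show ?thesis by simp
qed

text \<open>All functions without a limit share one default value, so \<open>Lim\<close> is constant
  off the event of convergence.\<close>

lemma Lim_not_convergent:
  assumes "\<nexists>l. (f \<longlongrightarrow> l) F"
  shows "Lim F f = (THE l. False)"
  using assms unfolding t2_space_class.Lim_def by simp

text \<open>Measurability is needed on all of \<open>N\<close>, including paths without a limit.
  Convergence is expressed by a Cauchy criterion on a countable dense set \<open>D\<close>, which is
  equivalent by continuity of the paths; on that event the limit is taken along the
  integers.\<close>

lemma borel_measurable_Lim_at_top:
  fixes f :: "real \<Rightarrow> 'b \<Rightarrow> real"
  assumes m: "\<And>x. f x \<in> borel_measurable N" and c: "\<And>\<omega>. \<omega> \<in> space N \<Longrightarrow> continuous_on {c..} (\<lambda>x. f x \<omega>)"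
  shows "(\<lambda>\<omega>. Lim at_top (\<lambda>x. f x \<omega>)) \<in> borel_measurable N"
proof -
  obtain D where D: "countable D" "D \<subseteq> {c<..}" "{c<..} \<subseteq> closure D" using separable[of "{c<..}"] by metis
  define C where "C \<omega> \<longleftrightarrow> (\<forall>k. \<exists>m::nat. \<forall>x\<in>D. \<forall>y\<in>D. real m \<le> x \<longrightarrow> real m \<le> y \<longrightarrow> \<bar>f x \<omega> - f y \<omega>\<bar> \<le> 1 / Suc k)" for \<omega>
  have Cm: "Measurable.pred N C" unfolding C_def using D(1) m by measurable
  have iff: "C \<omega> \<longleftrightarrow> (\<exists>l. ((\<lambda>x. f x \<omega>) \<longlongrightarrow> l) at_top)" if \<omega>: "\<omega> \<in> space N" for \<omega>
  proof
    assume C: "C \<omega>"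
    have near: "\<exists>d\<in>D. real m \<le> d \<and> \<bar>f d \<omega> - f x \<omega>\<bar> < e" if x: "c < x" "real m < x" and e: "0 < e" for x m e
    proof -
      have "isCont (\<lambda>x. f x \<omega>) x" using c[OF \<omega>] x(1) by (intro continuous_on_interior) auto
      then obtain \<delta> where d: "0 < \<delta>" "\<And>y. dist y x < \<delta> \<Longrightarrow> dist (f y \<omega>) (f x \<omega>) < e"
        using e unfolding continuous_at_eps_delta dist_real_def by blast
      have "x \<in> closure D" using D(3) x by auto
      then obtain y where "y \<in> D" "dist y x < min \<delta> (x - m)" using d(1) x unfolding closure_approachable by (metis diff_gt_0_iff_gt min_less_iff_conj)
      then show ?thesis using d(2)[of y] by (intro bexI[of _ y]) (auto simp: dist_real_def)
    qed
    \<comment> \<open>Moving \<open>x\<close> and \<open>y\<close> into \<open>D\<close> costs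
      \<open>1 / Suc k\<close> each, on top of the Cauchy bound; hence the 3.\<close>
    have all: "\<exists>m::nat. \<forall>x>max c m. \<forall>y>max c m. \<bar>f x \<omega> - f y \<omega>\<bar> \<le> 3 / Suc k" for k
    proof -
      obtain m :: nat where m: "\<And>x y. x \<in> D \<Longrightarrow> y \<in> D \<Longrightarrow> real m \<le> x \<Longrightarrow> real m \<le> y \<Longrightarrow> \<bar>f x \<omega> - f y \<omega>\<bar> \<le> 1 / Suc k"
        using C unfolding C_def by blast
      have "\<bar>f x \<omega> - f y \<omega>\<bar> \<le> 3 / Suc k" if xy: "max c m < x" "max c m < y" for x y
      proof -
        obtain a where a: "a \<in> D" "real m \<le> a" "\<bar>f a \<omega> - f x \<omega>\<bar> < 1 / Suc k" using near[of x m "1 / Suc k"] xy by auto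
        obtain b where b: "b \<in> D" "real m \<le> b" "\<bar>f b \<omega> - f y \<omega>\<bar> < 1 / Suc k" using near[of y m "1 / Suc k"] xy by auto
        have "\<bar>f x \<omega> - f y \<omega>\<bar> \<le> 1 / Suc k + 1 / Suc k + 1 / Suc k" using m[OF a(1) b(1) a(2) b(2)] a(3) b(3) by linarith
        then show ?thesis by (simp add: add_divide_distrib[symmetric])
      qed
      then show ?thesis by blast
    qed
    have "\<exists>m. \<forall>x\<ge>m. \<forall>y\<ge>m. dist (f x \<omega>) (f y \<omega>) < e" if e: "0 < e" for e
    proof -
      have "0 < e / 3" using e by simp
      then obtain k where k: "1 / Suc k < e / 3" using nat_approx_posE by blast
      obtain m :: nat where m: "\<And>x y. max c m < x \<Longrightarrow> max c m < y \<Longrightarrow> \<bar>f x \<omega> - f y \<omega>\<bar> \<le> 3 / Suc k" using all[of k] by blast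
      have "dist (f x \<omega>) (f y \<omega>) < e" if "max c m + 1 \<le> x" "max c m + 1 \<le> y" for x y
      proof -
        have "\<bar>f x \<omega> - f y \<omega>\<bar> \<le> 3 / Suc k" using that by (intro m) auto
        also have "3 / Suc k < e" using k by simp
        finally show ?thesis by (simp add: dist_real_def)
      qed
      then show ?thesis by blast
    qed
    note cauchy = this
    have "Cauchy (\<lambda>n::nat. f (real n) \<omega>)"
    proof (rule metric_CauchyI)
      fix e :: real assume "0 < e"
      then obtain m where m: "\<And>x y. m \<le> x \<Longrightarrow> m \<le> y \<Longrightarrow> dist (f x \<omega>) (f y \<omega>) < e" using cauchy by blast
      obtain n0 :: nat where "m \<le> n0" using real_arch_simple by blast
      then show "\<exists>M. \<forall>i\<ge>M. \<forall>n\<ge>M. dist (f (real i) \<omega>) (f (real n) \<omega>) < e"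
        by (intro exI[of _ n0]) (auto intro!: m)
    qed
    then obtain l where l: "(\<lambda>n::nat. f (real n) \<omega>) \<longlonglongrightarrow> l" using Cauchy_convergent convergent_def by blast
    have "((\<lambda>x. f x \<omega>) \<longlongrightarrow> l) at_top"
    proof (rule tendstoI)
      fix e :: real assume "0 < e"
      then have e: "0 < e / 2" by simp
      then obtain m where m: "\<And>x y. m \<le> x \<Longrightarrow> m \<le> y \<Longrightarrow> dist (f x \<omega>) (f y \<omega>) < e / 2" using cauchy by blast
      obtain n0 :: nat where n0: "\<And>n. n0 \<le> n \<Longrightarrow> dist (f (real n) \<omega>) l < e / 2" using metric_LIMSEQ_D[OF l e] by blast
      obtain n1 :: nat where "m \<le> n1" using real_arch_simple by blast
      then have n: "m \<le> real (max n0 n1)" "n0 \<le> max n0 n1" by auto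
      show "eventually (\<lambda>x. dist (f x \<omega>) l < e) at_top"
        using eventually_ge_at_top[of m]
      proof eventually_elim
        case (elim x)
        have "dist (f x \<omega>) l \<le> dist (f x \<omega>) (f (real (max n0 n1)) \<omega>) + dist (f (real (max n0 n1)) \<omega>) l" by (rule dist_triangle)
        also have "\<dots> < e / 2 + e / 2" by (rule add_strict_mono[OF m[OF elim n(1)] n0[OF n(2)]])
        finally show ?case by simp
      qed
    qed
    then show "\<exists>l. ((\<lambda>x. f x \<omega>) \<longlongrightarrow> l) at_top" ..
  next
    assume "\<exists>l. ((\<lambda>x. f x \<omega>) \<longlongrightarrow> l) at_top"
    then obtain l where l: "((\<lambda>x. f x \<omega>) \<longlongrightarrow> l) at_top" ..
    show "C \<omega>"
      unfolding C_def
    proof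
      fix k
      have "eventually (\<lambda>x. dist (f x \<omega>) l < 1 / Suc k / 2) at_top" by (rule tendstoD[OF l]) simp
      then obtain x0 where x0: "\<And>x. x0 \<le> x \<Longrightarrow> dist (f x \<omega>) l < 1 / Suc k / 2" unfolding eventually_at_top_linorder by blast
      obtain m :: nat where m: "x0 \<le> m" using real_arch_simple by blast
      have "\<bar>f x \<omega> - f y \<omega>\<bar> \<le> 1 / Suc k" if "real m \<le> x" "real m \<le> y" for x y
      proof -
        have "x0 \<le> x" "x0 \<le> y" using that m by auto
        from x0[OF this(1)] x0[OF this(2)] have "\<bar>f x \<omega> - l\<bar> < 1 / Suc k / 2" "\<bar>f y \<omega> - l\<bar> < 1 / Suc k / 2"
          unfolding dist_real_def .
        moreover have "\<bar>a - b\<bar> \<le> d" if "\<bar>a - l\<bar> < d / 2" "\<bar>b - l\<bar> < d / 2" for a b d :: real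
          using that by linarith
        ultimately show ?thesis by blast
      qed
      then show "\<exists>m::nat. \<forall>x\<in>D. \<forall>y\<in>D. real m \<le> x \<longrightarrow> real m \<le> y \<longrightarrow> \<bar>f x \<omega> - f y \<omega>\<bar> \<le> 1 / Suc k" by blast
    qed
  qed
  have "Lim at_top (\<lambda>x. f x \<omega>) = (if C \<omega> then lim (\<lambda>n. f (real n) \<omega>) else (THE l. False))" if \<omega>: "\<omega> \<in> space N" for \<omega>
  proof (cases "C \<omega>")
    case True
    then obtain l where l: "((\<lambda>x. f x \<omega>) \<longlongrightarrow> l) at_top" using iff[OF \<omega>] by blast
    have "(\<lambda>n. f (real n) \<omega>) \<longlonglongrightarrow> l" by (rule filterlim_compose[OF l filterlim_real_sequentially])
    then show ?thesis using True l by (simp add: tendsto_Lim limI)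
  next
    case False
    then show ?thesis using iff[OF \<omega>] by (simp add: Lim_not_convergent)
  qed
  moreover have "(\<lambda>\<omega>. if C \<omega> then lim (\<lambda>n. f (real n) \<omega>) else (THE l. False)) \<in> borel_measurable N"
    using Cm m by measurable
  ultimately show ?thesis by (simp cong: measurable_cong)
qed

lemma Lim_at_bot_mirror: "Lim at_bot f = Lim at_top (\<lambda>x::real. f (- x))"
  unfolding t2_space_class.Lim_def at_bot_mirror filterlim_filtermap by simp

lemma borel_measurable_Lim_at_bot:
  fixes f :: "real \<Rightarrow> 'b \<Rightarrow> real"
  assumes m: "\<And>x. f x \<in> borel_measurable N" and c: "\<And>\<omega>. \<omega> \<in> space N \<Longrightarrow> continuous_on {..c} (\<lambda>x. f x \<omega>)"
  shows "(\<lambda>\<omega>. Lim at_bot (\<lambda>x. f x \<omega>)) \<in> borel_measurable N"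
  unfolding Lim_at_bot_mirror
  by (rule borel_measurable_Lim_at_top[where c="-c"])
    (auto intro!: m continuous_on_compose2[OF c] continuous_intros)

lemma extend_simps[simp]:
  "extend f (ereal r) = f r" "extend f \<infinity> = Lim at_top f" "extend f (- \<infinity>) = Lim at_bot f"
  by (simp_all add: extend_def flip: PInfty_eq_infinity MInfty_eq_minfinity)

lemma extend_continuous:
  assumes c: "continuous_on UNIV f" and l: "(f \<longlongrightarrow> l) at_bot" and u: "(f \<longlongrightarrow> u) at_top"
  shows "extend f (- \<infinity>) = l" "extend f \<infinity> = u" "continuous_on UNIV (extend f)"
proof -
  show e: "extend f (- \<infinity>) = l" "extend f \<infinity> = u" using l u by (simp_all add: tendsto_Lim)
  show "continuous_on UNIV (extend f)"
    unfolding continuous_on_eq_continuous_at[OF open_UNIV]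
  proof
    fix x :: ereal
    show "isCont (extend f) x"
    proof (cases x)
      case (real r)
      have "(f \<longlongrightarrow> f r) (at r)" using c by (simp add: continuous_on_eq_continuous_at isCont_def)
      then have "(extend f \<longlongrightarrow> extend f x) (at x)" unfolding real at_ereal filterlim_filtermap by simp
      then show ?thesis by (simp add: isCont_def)
    next
      case PInf
      have "UNIV - {\<infinity>::ereal} = {..<\<infinity>} - {\<infinity>}" by auto
      then have a: "at (\<infinity>::ereal) = at_left \<infinity>" unfolding at_within_def by simp
      have "(extend f \<longlongrightarrow> extend f x) (at x)" unfolding PInf a at_left_PInf filterlim_filtermap e using u by simp
      then show ?thesis by (simp add: isCont_def)
    next
      case MInf
      have "UNIV - {-\<infinity>::ereal} = {-\<infinity><..} - {-\<infinity>}" by auto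
      then have a: "at (-\<infinity>::ereal) = at_right (-\<infinity>)" unfolding at_within_def by simp
      have "(extend f \<longlongrightarrow> extend f x) (at x)" unfolding MInf a at_right_MInf filterlim_filtermap e using l by simp
      then show ?thesis by (simp add: isCont_def)
    qed
  qed
qed

lemma sup_fun_continuous:
  assumes f: "continuous_on UNIV f"
  shows "bdd_above (range f)" "max_set f \<noteq> {}" "f x \<le> sup_fun f" "closed {x. f x \<ge> sup_fun f - e}"
proof -
  obtain x0 where x0: "\<And>x. f x \<le> f x0" using continuous_attains_sup[OF compact_UNIV _ f] by auto
  then show b: "bdd_above (range f)" by (intro bdd_aboveI2[where M="f x0"])
  have "sup_fun f = f x0" unfolding sup_fun_def using x0 by (intro cSup_eq_maximum) auto
  then show "max_set f \<noteq> {}" by (auto simp: max_set_def)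
  show "f x \<le> sup_fun f" unfolding sup_fun_def using b by (intro cSUP_upper) auto
  show "closed {x. f x \<ge> sup_fun f - e}"
    using f by (intro closed_Collect_le) auto
qed

text \<open>No assumption on \<open>g\<close>: an unbounded set has the same (junk) supremum for every level, so the limit always exists.\<close>
lemma sup_fun_deriv_tendsto:
  assumes f: "continuous_on UNIV f"
  shows "((\<lambda>\<epsilon>. SUP x\<in>{x. f x \<ge> sup_fun f - \<epsilon>}. g x) \<longlongrightarrow> sup_fun_deriv f g) (at_right 0)"
proof -
  define S where "S \<epsilon> = {x. f x \<ge> sup_fun f - \<epsilon>}" for \<epsilon>
  define h where "h \<epsilon> = (SUP x\<in>S \<epsilon>. g x)" for \<epsilon>
  obtain x0 where x0: "f x0 = sup_fun f" using sup_fun_continuous(2)[OF f] by (auto simp: max_set_def)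
  have x0S: "x0 \<in> S \<epsilon>" if "0 \<le> \<epsilon>" for \<epsilon> using that x0 by (simp add: S_def)
  have mono: "S \<epsilon> \<subseteq> S \<epsilon>'" if "\<epsilon> \<le> \<epsilon>'" for \<epsilon> \<epsilon>' using that by (auto simp: S_def)
  have "\<exists>l. (h \<longlongrightarrow> l) (at_right 0)"
  proof (cases "\<exists>\<epsilon>>0. bdd_above (g ` S \<epsilon>)")
    case True
    then obtain e0 where e0: "0 < e0" "bdd_above (g ` S e0)" by blast
    have bdd: "bdd_above (g ` S \<epsilon>)" if "\<epsilon> \<le> e0" for \<epsilon> using that by (rule bdd_above_mono[OF e0(2) image_mono[OF mono]])
    have hmono: "h \<epsilon> \<le> h \<epsilon>'" if "0 < \<epsilon>" "\<epsilon> \<le> \<epsilon>'" "\<epsilon>' \<le> e0" for \<epsilon> \<epsilon>'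
      unfolding h_def using that x0S[of \<epsilon>] by (intro cSUP_subset_mono bdd mono) auto
    define l where "l = (INF \<epsilon>\<in>{0<..e0}. h \<epsilon>)"
    have "g x0 \<le> h \<epsilon>" if "0 < \<epsilon>" "\<epsilon> \<le> e0" for \<epsilon>
      unfolding h_def using that by (intro cSUP_upper bdd x0S) auto
    then have bb: "bdd_below (h ` {0<..e0})" by (intro bdd_belowI[of _ "g x0"]) auto
    have "(h \<longlongrightarrow> l) (at_right 0)"
    proof (rule tendstoI)
      fix e :: real assume e: "0 < e"
      have "l < l + e" using e by simp
      then obtain e1 where e1: "0 < e1" "e1 \<le> e0" "h e1 < l + e"
        unfolding l_def using cINF_less_iff[OF _ bb, of "(INF \<epsilon>\<in>{0<..e0}. h \<epsilon>) + e"] e0(1) by auto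
      have "dist (h \<epsilon>) l < e" if "0 < \<epsilon>" "\<epsilon> < e1" for \<epsilon>
      proof -
        have "l \<le> h \<epsilon>" unfolding l_def using that e1 by (intro cINF_lower[OF bb]) auto
        moreover have "h \<epsilon> \<le> h e1" using that e1 by (intro hmono) auto
        ultimately show ?thesis using e1(3) by (simp add: dist_real_def)
      qed
      then show "eventually (\<lambda>\<epsilon>. dist (h \<epsilon>) l < e) (at_right 0)"
        unfolding eventually_at_right_field using e1(1) by blast
    qed
    then show ?thesis ..
  next
    case False
    have h1: "h \<epsilon> = h 1" if "0 < \<epsilon>" for \<epsilon>
      unfolding h_def
    proof (rule Sup_real_cong)
      have *: "\<not> (\<forall>x\<in>g ` S e. x \<le> z)" if "0 < e" for e z using False that unfolding bdd_above_def by blast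
      show "(\<forall>x\<in>g ` S \<epsilon>. x \<le> z) \<longleftrightarrow> (\<forall>x\<in>g ` S 1. x \<le> z)" for z
        using *[OF that, of z] *[of 1 z] by (simp only: zero_less_one simp_thms)
    qed
    have "eventually (\<lambda>\<epsilon>. h \<epsilon> = h 1) (at_right 0)"
      using eventually_at_right_less[of "0::real"] by eventually_elim (rule h1)
    then have "(h \<longlongrightarrow> h 1) (at_right 0)" by (rule tendsto_eventually)
    then show ?thesis ..
  qed
  then obtain l where l: "(h \<longlongrightarrow> l) (at_right 0)" ..
  then have "sup_fun_deriv f g = l" unfolding sup_fun_deriv_def S_def[symmetric] h_def[symmetric] by (intro tendsto_Lim) auto
  then show ?thesis using l unfolding h_def S_def by simp
qed

lemma sup_fun_deriv_LIMSEQ: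
  assumes f: "continuous_on UNIV f"
  shows "(\<lambda>n. SUP x\<in>{x. f x \<ge> sup_fun f - 1 / Suc n}. g x) \<longlonglongrightarrow> sup_fun_deriv f g"
proof -
  have "filterlim (\<lambda>n. 1 / real (Suc n)) (at_right 0) sequentially"
    unfolding filterlim_at using LIMSEQ_inverse_real_of_nat by (auto simp: inverse_eq_divide)
  from filterlim_compose[OF sup_fun_deriv_tendsto[OF f] this] show ?thesis .
qed

text \<open>Compactness of the extended line: if \<open>g\<close> reached \<open>m + e\<close> on
  every level set of \<open>f\<close>, the nested closed sets of such points would have a common
  point, which would be a maximiser of \<open>f\<close>.\<close>

lemma sup_fun_deriv_eq_SUP:
  assumes f: "continuous_on UNIV f" and g: "continuous_on UNIV g"
  shows "sup_fun_deriv f g = (SUP x\<in>max_set f. g x)"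
proof -
  define S where "S n = {x. f x \<ge> sup_fun f - 1 / Suc n}" for n
  define m where "m = (SUP x\<in>max_set f. g x)"
  have bg: "bdd_above (g ` A)" for A by (rule bdd_above_mono[OF sup_fun_continuous(1)[OF g] image_mono]) simp
  have ne: "max_set f \<noteq> {}" by (rule sup_fun_continuous(2)[OF f])
  have sub: "max_set f \<subseteq> S n" for n by (auto simp: max_set_def S_def)
  have dec: "S n \<subseteq> S k" if "k \<le> n" for k n
  proof -
    have "1 / real (Suc n) \<le> 1 / real (Suc k)" using that by (intro divide_left_mono) auto
    then show ?thesis by (auto simp: S_def)
  qed
  have "\<exists>n. \<forall>x\<in>S n. g x < m + e" if e: "0 < e" for e
  proof (rule ccontr)
    assume "\<nexists>n. \<forall>x\<in>S n. g x < m + e"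
    then have nonempty: "S n \<inter> {x. m + e \<le> g x} \<noteq> {}" for n by (force simp: not_less)
    have "UNIV \<inter> (\<Inter>n\<in>UNIV. S n \<inter> {x. m + e \<le> g x}) \<noteq> {}"
    proof (rule compact_imp_fip_image[OF compact_UNIV])
      show "closed (S n \<inter> {x. m + e \<le> g x})" for n
        unfolding S_def by (rule closed_Int[OF sup_fun_continuous(4)[OF f] closed_Collect_le[OF continuous_on_const g]])
      fix I :: "nat set" assume I: "finite I"
      have "S (Max (insert 0 I)) \<inter> {x. m + e \<le> g x} \<subseteq> (\<Inter>n\<in>I. S n \<inter> {x. m + e \<le> g x})"
      proof -
        have "S (Max (insert 0 I)) \<subseteq> S n" if "n \<in> I" for n using I that by (intro dec Max_ge) auto
        then show ?thesis by blast
      qed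
      then show "UNIV \<inter> (\<Inter>n\<in>I. S n \<inter> {x. m + e \<le> g x}) \<noteq> {}" using nonempty by blast
    qed
    then obtain x where x: "\<And>n. x \<in> S n" "m + e \<le> g x" by auto
    have "sup_fun f \<le> f x"
    proof (rule field_le_epsilon)
      fix d :: real assume "0 < d"
      then obtain n where "1 / Suc n < d" using nat_approx_posE by blast
      then show "sup_fun f \<le> f x + d" using x(1)[of n] by (simp add: S_def)
    qed
    then have "x \<in> max_set f" using sup_fun_continuous(3)[OF f, of x] by (simp add: max_set_def)
    then have "g x \<le> m" unfolding m_def by (intro cSUP_upper bg)
    then show False using x(2) e by simp
  qed
  note ex = this
  have "(\<lambda>n. SUP x\<in>S n. g x) \<longlonglongrightarrow> m"
  proof (rule LIMSEQ_I)
    fix e :: real assume e: "0 < e"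
    then have "0 < e / 2" by simp
    then obtain n0 where n0: "\<And>x. x \<in> S n0 \<Longrightarrow> g x < m + e / 2" using ex by blast
    have "norm ((SUP x\<in>S n. g x) - m) < e" if n: "n0 \<le> n" for n
    proof -
      have "m \<le> (SUP x\<in>S n. g x)" unfolding m_def using ne sub bg by (intro cSUP_subset_mono) auto
      moreover have "(SUP x\<in>S n. g x) \<le> m + e / 2"
      proof (rule cSUP_least)
        show "S n \<noteq> {}" using ne sub[of n] by blast
        show "g x \<le> m + e / 2" if "x \<in> S n" for x
          by (rule less_imp_le[OF n0[OF subsetD[OF dec[OF n] that]]])
      qed
      ultimately show ?thesis using e by simp
    qed
    then show "\<exists>n0. \<forall>n\<ge>n0. norm ((SUP x\<in>S n. g x) - m) < e" by blast
  qed
  then show ?thesis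
    using LIMSEQ_unique[OF sup_fun_deriv_LIMSEQ[OF f, of g]] unfolding S_def m_def by simp
qed

section \<open>Measurability of the statistic\<close>

lemma borel_measurable_empirical_cdf:
  assumes X: "\<And>i. X i \<in> borel_measurable M"
  shows "(\<lambda>\<omega>. empirical_cdf X n \<omega> x) \<in> borel_measurable M"
proof -
  have "real (card {i. i < n \<and> X i \<omega> \<le> x}) = (\<Sum>i<n. indicator {..x} (X i \<omega>))" for \<omega>
    by (simp add: indicator_def of_bool_def[symmetric] Int_def lessThan_def)
  then show ?thesis unfolding empirical_cdf_def using X by simp
qed

lemma empirical_cdf_eventually_eq: "eventually (\<lambda>y. empirical_cdf X n \<omega> y = empirical_cdf X n \<omega> x) (at_right x)"
proof -
  have "eventually (\<lambda>y. X i \<omega> \<le> y \<longleftrightarrow> X i \<omega> \<le> x) (at_right x)" for i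
  proof (cases "X i \<omega> \<le> x")
    case True
    then show ?thesis using eventually_at_right_less[of x] by (auto elim: eventually_mono)
  next
    case False
    then have "eventually (\<lambda>y. y < X i \<omega>) (at_right x)"
      unfolding eventually_at_right_field by (intro exI[of _ "X i \<omega>"]) auto
    then show ?thesis using False by (auto elim: eventually_mono)
  qed
  then have "eventually (\<lambda>y. \<forall>i\<in>{..<n}. X i \<omega> \<le> y \<longleftrightarrow> X i \<omega> \<le> x) (at_right x)"
    by (intro eventually_ball_finite) auto
  then show ?thesis
    unfolding empirical_cdf_def by eventually_elim (intro arg_cong2[where f="(/)"] arg_cong[where f="\<lambda>A. real (card A)"], auto)
qed

text \<open>
  The exceptional point is the left end of the support of \<open>G\<close>, where the junk value of the
  divergence at \<open>y = 0\<close> may break right-continuity.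
\<close>
lemma borel_measurable_berk_jones:
  assumes X: "\<And>i. X i \<in> borel_measurable M"
    and G: "continuous_on UNIV G" "\<And>x y. x \<le> y \<Longrightarrow> G x \<le> G y" "\<And>x. 0 \<le> G x" "\<And>x. G x \<le> 1"
  shows "(\<lambda>\<omega>. berk_jones (empirical_cdf X n \<omega>) G) \<in> borel_measurable M"
proof -
  define D where "D = \<rat> \<union> {x. G x = 0 \<and> (\<forall>q>x. 0 < G q)}"
  have "finite {x. G x = 0 \<and> (\<forall>q>x. 0 < G q)}" (is "finite ?A")
  proof (cases "?A = {}")
    case False
    then obtain a where a: "G a = 0" "\<And>q. a < q \<Longrightarrow> 0 < G q" by blast
    have "x = a" if "x \<in> ?A" for x
      using that a(1) a(2)[of x] by (cases rule: linorder_cases[of x a]) auto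
    then have "?A \<subseteq> {a}" by blast
    then show ?thesis by (rule finite_subset) simp
  next
    case True
    show ?thesis unfolding True by simp
  qed
  then have D: "countable D" unfolding D_def using countable_rat by (auto intro: countable_finite)
  have "berk_jones (empirical_cdf X n \<omega>) G = (SUP x\<in>D. bern_KL (empirical_cdf X n \<omega> x) (G x))" for \<omega>
    unfolding berk_jones_def
  proof (rule Sup_real_cong)
    define k where "k x = bern_KL (empirical_cdf X n \<omega> x) (G x)" for x
    have rc: "(k \<longlongrightarrow> k x) (at_right x)" if xD: "x \<notin> D" for x
    proof -
      \<comment> \<open>If \<open>G\<close> is interior, right-continuity comes from the formula. If
        \<open>G\<close> stays at 1 to the right, or at 0 on a right neighbourhood, the divergence
        is constant just to the right of \<open>x\<close>, whatever its default value.\<close>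
      have "(0 < G x \<and> G x < 1) \<or> G x = 1 \<or> (\<exists>q>x. G x = 0 \<and> G q = 0)"
      proof (cases "G x = 0")
        case True
        then obtain q where q: "x < q" "\<not> 0 < G q" using xD unfolding D_def by blast
        then have "G q = 0" using G(3)[of q] by simp
        then show ?thesis using q(1) True by blast
      next
        case False
        then show ?thesis using G(3)[of x] G(4)[of x] by (simp add: less_le)
      qed
      then consider "0 < G x \<and> G x < 1" | "G x = 1" | q where "x < q" "G x = 0" "G q = 0" by blast
      then show ?thesis
      proof cases
        case 1
        define p where "p = empirical_cdf X n \<omega> x"
        have "isCont G x" using G(1) by (simp add: continuous_on_eq_continuous_at)
        then have Gx: "(G \<longlongrightarrow> G x) (at_right x)" unfolding isCont_def by (rule tendsto_within_subset) simp
        have "((\<lambda>y. p * ln (p / G y)) \<longlongrightarrow> p * ln (p / G x)) (at_right x)"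
        proof (cases "p = 0")
          case False
          then show ?thesis using 1 by (intro tendsto_mult tendsto_const tendsto_ln tendsto_divide Gx) auto
        qed simp
        moreover have "((\<lambda>y. (1 - p) * ln ((1 - p) / (1 - G y))) \<longlongrightarrow> (1 - p) * ln ((1 - p) / (1 - G x))) (at_right x)"
        proof (cases "p = 1")
          case False
          then show ?thesis using 1 by (intro tendsto_mult tendsto_const tendsto_ln tendsto_divide tendsto_diff Gx) auto
        qed simp
        ultimately have "((\<lambda>y. bern_KL (empirical_cdf X n \<omega> x) (G y)) \<longlongrightarrow> k x) (at_right x)"
          unfolding k_def bern_KL_def p_def[symmetric] by (rule tendsto_add)
        then show ?thesis
          by (rule Lim_transform_eventually)
            (use empirical_cdf_eventually_eq[of X n \<omega> x] in eventually_elim, simp add: k_def)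
      next
        case 2
        then have g1: "G y = 1" if "x < y" for y using G(2)[of x y] G(4)[of y] that by simp
        have "eventually (\<lambda>y. k y = k x) (at_right x)"
          using empirical_cdf_eventually_eq[of X n \<omega> x] eventually_at_right_less[of x]
          by eventually_elim (simp add: k_def 2 g1)
        then show ?thesis by (rule tendsto_eventually)
      next
        case 3
        then have z: "G y = 0" if "y < q" for y using G(2)[of y q] G(3)[of y] that by simp
        have "eventually (\<lambda>y. y < q) (at_right x)"
          unfolding eventually_at_right_field using 3(1) by blast
        then have "eventually (\<lambda>y. k y = k x) (at_right x)"
          using empirical_cdf_eventually_eq[of X n \<omega> x]
          by eventually_elim (simp add: k_def 3(2) z)
        then show ?thesis by (rule tendsto_eventually)
      qed
    qed
    have "k x \<le> z" if D: "\<forall>y\<in>D. k y \<le> z" for x z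
    proof (cases "x \<in> D")
      case False
      show ?thesis
      proof (rule ccontr)
        assume "\<not> k x \<le> z"
        then have "eventually (\<lambda>y. z < k y) (at_right x)" using order_tendstoD(1)[OF rc[OF False]] by simp
        then obtain b where b: "x < b" "\<And>y. x < y \<Longrightarrow> y < b \<Longrightarrow> z < k y" unfolding eventually_at_right_field by blast
        obtain q where "q \<in> \<rat>" "x < q" "q < b" using Rats_dense_in_real[OF b(1)] by blast
        then show False using D b(2)[of q] unfolding D_def by (auto simp: not_less[symmetric])
      qed
    qed (use D in auto)
    then show "(\<forall>y\<in>range (\<lambda>x. bern_KL (empirical_cdf X n \<omega> x) (G x)). y \<le> z) \<longleftrightarrow>
        (\<forall>y\<in>(\<lambda>x. bern_KL (empirical_cdf X n \<omega> x) (G x)) ` D. y \<le> z)" for z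
      unfolding k_def[symmetric] by blast
  qed
  moreover have "(\<lambda>\<omega>. SUP x\<in>D. bern_KL (empirical_cdf X n \<omega> x) (G x)) \<in> borel_measurable M"
  proof (rule borel_measurable_cSUP_real[OF D])
    fix x
    have [measurable]: "(\<lambda>\<omega>. empirical_cdf X n \<omega> x) \<in> borel_measurable M" by (rule borel_measurable_empirical_cdf[OF X])
    show "(\<lambda>\<omega>. bern_KL (empirical_cdf X n \<omega> x) (G x)) \<in> borel_measurable M" unfolding bern_KL_def by measurable
  qed
  ultimately show ?thesis by simp
qed

section \<open>The weighted bridge and measurability of the limit variable\<close>

locale bridge_log_ratio = square_integrable_log_ratio +
  fixes N :: "'b measure" and B :: "real \<Rightarrow> 'b \<Rightarrow> real"
  assumes bridge: "brownian_bridge N B"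
begin

sublocale N: prob_space N using bridge by (simp add: brownian_bridge_def)

lemma B_measurable: "t \<in> {0..1} \<Longrightarrow> B t \<in> borel_measurable N"
  using bridge by (simp add: brownian_bridge_def)

lemma B_continuous: "\<omega> \<in> space N \<Longrightarrow> continuous_on {0..1} (\<lambda>t. B t \<omega>)"
  using bridge by (simp add: brownian_bridge_def)

definition W :: "'b \<Rightarrow> ereal \<Rightarrow> real" where "W \<omega> = extend (\<lambda>x. B (F x) \<omega> * L x)"

definition KFG :: "ereal \<Rightarrow> real" where "KFG = extend K"

lemma KFG_continuous: "continuous_on UNIV KFG" and KFG_infinity: "KFG \<infinity> = 0" "KFG (- \<infinity>) = 0" and KFG_ereal: "KFG (ereal x) = K x"
  unfolding KFG_def using extend_continuous[OF K_continuous K_at_bot K_at_top] by auto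

lemma isCont_path:
  assumes "\<omega> \<in> space N" "0 < F x" "F x < 1"
  shows "isCont (\<lambda>x. B (F x) \<omega> * L x) x"
proof -
  have "continuous_on UNIV (\<lambda>x. B (F x) \<omega>)"
    using F_bounds by (intro continuous_on_compose2[OF B_continuous[OF assms(1)] F_cont]) auto
  then show ?thesis using assms by (intro continuous_mult isCont_L) (auto simp: continuous_on_eq_continuous_at)
qed

lemma W_measurable: "(\<lambda>\<omega>. W \<omega> x) \<in> borel_measurable N"
proof (cases x)
  case (real r)
  then show ?thesis using B_measurable[of "F r"] F_bounds[of r] by (simp add: W_def)
next
  have m: "(\<lambda>\<omega>. B (F x) \<omega> * L x) \<in> borel_measurable N" for x
    using B_measurable[of "F x"] F_bounds[of x] by simp
  {
    case PInf
    have "(\<lambda>\<omega>. Lim at_top (\<lambda>x. B (F x) \<omega> * L x)) \<in> borel_measurable N"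
    \<comment> \<open>If \<open>F\<close> reaches 1, the weighted path is eventually 0 because
      \<open>L\<close> is. Otherwise \<open>0 < F < 1\<close> on a half-line, every path is
      continuous there, and measurability of \<open>Lim\<close> applies.\<close>
    proof (cases "\<exists>b. F b = 1")
      case True
      then obtain b where b: "F b = 1" by blast
      have L0: "L x = 0" if "b \<le> x" for x using F_mono[OF that] b F_bounds[of x] by (intro L_zero) auto
      have "eventually (\<lambda>x. B (F x) \<omega> * L x = 0) at_top" for \<omega>
        using eventually_ge_at_top[of b] by eventually_elim (simp only: L0 mult_zero_right)
      then have "Lim at_top (\<lambda>x. B (F x) \<omega> * L x) = 0" for \<omega> by (intro tendsto_Lim tendsto_eventually) auto
      then show ?thesis by simp
    next
      case False
      obtain c where c: "F c = 1/2" using F_attains[of "1/2"] by auto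
      have "0 < F x" "F x < 1" if "c \<le> x" for x
        using F_mono[OF that] c F_bounds(2)[of x] False by (auto simp: less_le)
      then show ?thesis
        by (intro borel_measurable_Lim_at_top[where c=c] m continuous_at_imp_continuous_on ballI isCont_path) auto
    qed
    then show ?thesis unfolding PInf W_def by simp
  next
    case MInf
    have "(\<lambda>\<omega>. Lim at_bot (\<lambda>x. B (F x) \<omega> * L x)) \<in> borel_measurable N"
    proof (cases "\<exists>b. F b = 0")
      case True
      then obtain b where b: "F b = 0" by blast
      have L0: "L x = 0" if "x \<le> b" for x using F_mono[OF that] b F_bounds[of x] by (intro L_zero) auto
      have "eventually (\<lambda>x. B (F x) \<omega> * L x = 0) at_bot" for \<omega>
        using eventually_le_at_bot[of b] by eventually_elim (simp only: L0 mult_zero_right)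
      then have "Lim at_bot (\<lambda>x. B (F x) \<omega> * L x) = 0" for \<omega> by (intro tendsto_Lim tendsto_eventually) auto
      then show ?thesis by simp
    next
      case False
      obtain c where c: "F c = 1/2" using F_attains[of "1/2"] by auto
      have "0 < F x" "F x < 1" if "x \<le> c" for x
        using F_mono[OF that] c F_bounds(1)[of x] False by (auto simp: less_le)
      then show ?thesis
        by (intro borel_measurable_Lim_at_bot[where c=c] m continuous_at_imp_continuous_on ballI isCont_path) auto
    qed
    then show ?thesis unfolding MInf W_def by simp
  }
qed

text \<open>Countably many points suffice for every path: a dense subset of the part where
  \<open>0 < F < 1\<close>, on which paths are continuous; one representative of the points where
  \<open>F\<close> is 0 or 1, since \<open>W\<close> is 0 at all of them; and the infinite
  points.\<close>

lemma level_sup_measurable: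
  "(\<lambda>\<omega>. SUP x\<in>{x. sup_fun KFG - 1 / Suc n \<le> KFG x}. W \<omega> x) \<in> borel_measurable N"
proof -
  define S where "S = {x. sup_fun KFG - 1 / Suc n \<le> KFG x}"
  define S1 where "S1 = {r. ereal r \<in> S \<and> 0 < F r \<and> F r < 1}"
  define S0 where "S0 = {r. ereal r \<in> S \<and> (F r = 0 \<or> F r = 1)}"
  obtain D where D: "countable D" "D \<subseteq> S1" "S1 \<subseteq> closure D" using separable[of S1] by metis
  define D0 where "D0 = (if S0 = {} then {} else {SOME r. r \<in> S0})"
  have D0: "D0 \<subseteq> S0" "S0 \<noteq> {} \<Longrightarrow> D0 \<noteq> {}" "countable D0" unfolding D0_def by (auto intro: someI2)
  define I where "I = ereal ` (D \<union> D0) \<union> (S \<inter> {\<infinity>, - \<infinity>})"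
  have I: "countable I" unfolding I_def using D(1) D0(3) by auto
  have IS: "I \<subseteq> S" unfolding I_def using D(2) D0(1) by (auto simp: S1_def S0_def)
  have "(SUP x\<in>S. W \<omega> x) = (SUP x\<in>I. W \<omega> x)" if \<omega>: "\<omega> \<in> space N" for \<omega>
  proof (rule Sup_real_cong)
    fix z
    have "W \<omega> x \<le> z" if all: "\<forall>x\<in>I. W \<omega> x \<le> z" and x: "x \<in> S" for x
    proof (cases x)
      case (real r)
      show ?thesis
      proof (cases "r \<in> S0")
        case True
        then obtain r0 where r0: "r0 \<in> D0" using D0(2) by blast
        have "W \<omega> (ereal r0) = 0" "W \<omega> x = 0"
          using r0 D0(1) True L_zero[of r0] L_zero[of r] by (auto simp: W_def real S0_def)
        moreover have "W \<omega> (ereal r0) \<le> z" using all r0 by (auto simp: I_def)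
        ultimately show ?thesis by simp
      next
        case False
        then have r: "r \<in> S1" using x real F_bounds[of r] by (auto simp: S1_def S0_def less_le)
        then have "r \<in> closure D" using D(3) by blast
        then obtain d where d: "\<And>n. d n \<in> D" "d \<longlonglongrightarrow> r" unfolding closure_sequential by blast
        have "(\<lambda>n. B (F (d n)) \<omega> * L (d n)) \<longlonglongrightarrow> B (F r) \<omega> * L r"
          using r by (intro isCont_tendsto_compose[OF isCont_path[OF \<omega>] d(2)]) (auto simp: S1_def)
        moreover have "B (F (d n)) \<omega> * L (d n) \<le> z" for n
        proof -
          have "W \<omega> (ereal (d n)) \<le> z" using all d(1)[of n] by (auto simp: I_def)
          then show ?thesis by (simp add: W_def)
        qed
        ultimately have "B (F r) \<omega> * L r \<le> z" by (intro LIMSEQ_le_const2) auto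
        then show ?thesis by (simp add: W_def real)
      qed
    qed (use all x in \<open>auto simp: I_def\<close>)
    then show "(\<forall>y\<in>W \<omega> ` S. y \<le> z) \<longleftrightarrow> (\<forall>y\<in>W \<omega> ` I. y \<le> z)" using IS by blast
  qed
  moreover have "(\<lambda>\<omega>. SUP x\<in>I. W \<omega> x) \<in> borel_measurable N"
    by (rule borel_measurable_cSUP_real[OF I W_measurable])
  ultimately show ?thesis
    unfolding S_def[symmetric] by (simp cong: measurable_cong)
qed

lemma limit_measurable: "(\<lambda>\<omega>. sup_fun_deriv KFG (W \<omega>)) \<in> borel_measurable N"
  by (rule borel_measurable_LIMSEQ_real[OF sup_fun_deriv_LIMSEQ[OF KFG_continuous] level_sup_measurable])

lemma path_continuous:
  assumes \<omega>: "\<omega> \<in> space N" and v: "vanishing_at_ends (\<lambda>t. B t \<omega>)"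
  shows "continuous_on UNIV (W \<omega>)" "W \<omega> \<infinity> = 0" "W \<omega> (- \<infinity>) = 0"
    "sup_fun_deriv KFG (W \<omega>) = (SUP x\<in>max_set KFG. W \<omega> x)"
proof -
  note e = extend_continuous[OF vanishing_continuous[OF v B_continuous[OF \<omega>]]
      vanishing_tendsto[OF v disjI1[OF F_lim(1)]] vanishing_tendsto[OF v disjI2[OF F_lim(2)]]]
  show c: "continuous_on UNIV (W \<omega>)" "W \<omega> \<infinity> = 0" "W \<omega> (- \<infinity>) = 0" unfolding W_def using e by auto
  show "sup_fun_deriv KFG (W \<omega>) = (SUP x\<in>max_set KFG. W \<omega> x)"
    by (rule sup_fun_deriv_eq_SUP[OF KFG_continuous c(1)])
qed

lemma W_ereal: "W \<omega> (ereal x) = B (F x) \<omega> * L x" by (simp add: W_def)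

text \<open>The value 0 of the extended divergence at the infinite points is a limit of finite
  values, so including these points does not raise the supremum.\<close>

lemma sup_KFG: "sup_fun KFG = berk_jones F G" "K x \<le> sup_fun KFG" "0 \<le> sup_fun KFG" "bdd_above (range K)"
proof -
  have b: "KFG x \<le> sup_fun KFG" for x by (rule sup_fun_continuous(3)[OF KFG_continuous])
  show K: "K x \<le> sup_fun KFG" for x using b[of "ereal x"] by (simp add: KFG_ereal)
  show "0 \<le> sup_fun KFG" using b[of \<infinity>] by (simp add: KFG_infinity)
  show bdd: "bdd_above (range K)" using K by (intro bdd_aboveI2)
  have K': "K x \<le> berk_jones F G" for x unfolding berk_jones_def using bdd by (intro cSUP_upper) auto
  have "0 \<le> berk_jones F G" by (rule tendsto_upperbound[OF K_at_top]) (use K' in auto)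
  then have "KFG x \<le> berk_jones F G" for x by (cases x) (auto simp: KFG_ereal KFG_infinity K')
  then have "sup_fun KFG \<le> berk_jones F G" unfolding sup_fun_def by (intro cSUP_least) auto
  moreover have "berk_jones F G \<le> sup_fun KFG" unfolding berk_jones_def using K by (intro cSUP_least) auto
  ultimately show "sup_fun KFG = berk_jones F G" by simp
qed

end

section \<open>Suprema of finitely many coordinates with bounded weights\<close>

definition sup_form :: "(nat \<times> real) set \<Rightarrow> (nat \<Rightarrow> real) \<Rightarrow> real" where
  "sup_form A s = (SUP (i, l)\<in>A. s i * l)"

context
  fixes A :: "(nat \<times> real) set" and m :: nat and c :: real
  assumes A: "A \<noteq> {}" "\<And>i l. (i, l) \<in> A \<Longrightarrow> i < m \<and> \<bar>l\<bar> \<le> c"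
begin

lemma sup_form_term:
  assumes "(i, l) \<in> A"
  shows "\<bar>x i * l - y i * l\<bar> \<le> c * (\<Sum>i<m. \<bar>x i - y i\<bar>)"
proof -
  have il: "i < m" "\<bar>l\<bar> \<le> c" using A(2)[OF assms] by auto
  have "\<bar>x i * l - y i * l\<bar> = \<bar>l\<bar> * \<bar>x i - y i\<bar>" by (simp add: abs_mult[symmetric] algebra_simps)
  also have "\<dots> \<le> c * (\<Sum>i<m. \<bar>x i - y i\<bar>)"
    using il member_le_sum[of i "{..<m}" "\<lambda>i. \<bar>x i - y i\<bar>"] by (intro mult_mono) auto
  finally show ?thesis .
qed

lemma sup_form_bdd: "bdd_above ((\<lambda>(i, l). s i * l) ` A)"
proof (rule bdd_aboveI2[where M="c * (\<Sum>i<m. \<bar>s i\<bar>)"])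
  fix p assume "p \<in> A"
  then show "(case p of (i, l) \<Rightarrow> s i * l) \<le> c * (\<Sum>i<m. \<bar>s i\<bar>)"
    using sup_form_term[of "fst p" "snd p" s "\<lambda>_. 0"] by (cases p) auto
qed

text \<open>\<open>A\<close> may contain infinitely many weights for one coordinate, but only
  \<open>m\<close> coordinates occur and the weights are bounded by \<open>c\<close>. A supremum of
  linear forms with such coefficients is Lipschitz.\<close>

lemma sup_form_Lipschitz: "\<bar>sup_form A x - sup_form A y\<bar> \<le> c * (\<Sum>i<m. \<bar>x i - y i\<bar>)"
proof -
  have "sup_form A x \<le> sup_form A y + c * (\<Sum>i<m. \<bar>x i - y i\<bar>)" for x y
    unfolding sup_form_def
  proof (rule cSUP_least[OF A(1)])
    fix p assume p: "p \<in> A"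
    obtain i l where il: "p = (i, l)" by (cases p)
    have "y i * l \<le> (SUP (i, l)\<in>A. y i * l)" using cSUP_upper[OF p sup_form_bdd, of y] by (simp add: il)
    then show "(case p of (i, l) \<Rightarrow> x i * l) \<le> (SUP (i, l)\<in>A. y i * l) + c * (\<Sum>i<m. \<bar>x i - y i\<bar>)"
      using sup_form_term[of i l x y] p by (simp add: il)
  qed
  from this[of x y] this[of y x] show ?thesis by (simp add: abs_minus_commute abs_le_iff)
qed

lemma sup_form_greater_iff: "t < sup_form A s \<longleftrightarrow> (\<exists>(i, l)\<in>A. t < s i * l)"
  unfolding sup_form_def using less_cSUP_iff[OF A(1) sup_form_bdd, of t s] by (simp add: case_prod_beta)

text \<open>Lipschitz substitute for the indicator of an exceedance: it rises from 0 at level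
  \<open>t\<close> to 1 at level \<open>t + d\<close>.\<close>

definition ramp :: "real \<Rightarrow> real \<Rightarrow> (nat \<Rightarrow> real) \<Rightarrow> real" where
  "ramp t d s = min 1 (max 0 ((sup_form A s - t) / d))"

lemma ramp_bounds: "0 \<le> ramp t d s" "ramp t d s \<le> 1" "\<bar>ramp t d s\<bar> \<le> 1"
  by (auto simp: ramp_def)

lemma ramp_Lipschitz:
  assumes "0 < d"
  shows "\<bar>ramp t d x - ramp t d y\<bar> \<le> c / d * (\<Sum>i<m. \<bar>x i - y i\<bar>)"
proof -
  have "\<bar>ramp t d x - ramp t d y\<bar> \<le> \<bar>(sup_form A x - t) / d - (sup_form A y - t) / d\<bar>"
    unfolding ramp_def by linarith
  also have "\<dots> = \<bar>sup_form A x - sup_form A y\<bar> / d"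
    using assms by (simp add: diff_divide_distrib[symmetric])
  also have "\<dots> \<le> c * (\<Sum>i<m. \<bar>x i - y i\<bar>) / d"
    using assms sup_form_Lipschitz by (intro divide_right_mono) auto
  finally show ?thesis by simp
qed

lemma ramp_eq_1: "0 < d \<Longrightarrow> t + d < sup_form A s \<Longrightarrow> ramp t d s = 1"
  by (simp add: ramp_def min_def max_def pos_le_divide_eq pos_divide_le_eq not_le)

lemma ramp_pos_iff: "0 < d \<Longrightarrow> 0 < ramp t d s \<longleftrightarrow> t < sup_form A s"
  by (simp add: ramp_def less_max_iff_disj zero_less_divide_iff)

end

context uniform_sample begin

text \<open>The indicators of exceeding \<open>t + d\<close> and \<open>t\<close> enclose the ramp,
  so convergence of its expectations compares the upper tails in both directions. The loss
  \<open>d\<close> in the level takes the place of continuity of the limit law.\<close>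

lemma sup_form_convergence:
  fixes A :: "(nat \<times> real) set" and t d c :: real
  assumes B: "brownian_bridge N B" and \<tau>: "\<And>i. \<tau> i \<in> {0..1}"
    and A: "A \<noteq> {}" "\<And>i l. (i, l) \<in> A \<Longrightarrow> i < m \<and> \<bar>l\<bar> \<le> c" and d: "0 < d" and e: "0 < e"
  defines "U' n s \<equiv> {\<omega> \<in> space M. \<exists>(i, l)\<in>A. s < empirical_process n (\<tau> i) \<omega> * l}"
    and "V s \<equiv> {\<omega> \<in> space N. \<exists>(i, l)\<in>A. s < B (\<tau> i) \<omega> * l}"
  shows "U' n t \<in> events" "V t \<in> sets N"
    "eventually (\<lambda>n. measure N (V (t + d)) \<le> prob (U' n t) + e) sequentially"
    "eventually (\<lambda>n. prob (U' n (t + d)) \<le> measure N (V t) + e) sequentially"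
proof -
  interpret N: prob_space N using B by (simp add: brownian_bridge_def)
  let ?f = "ramp A t d"
  have lip: "\<bar>ramp A t d x - ramp A t d y\<bar> \<le> c / d * (\<Sum>i<m. \<bar>x i - y i\<bar>)" if "0 < d" for t d x y
    by (rule ramp_Lipschitz[OF A that])
  have bd: "\<bar>ramp A t d x\<bar> \<le> 1" for t d x by (rule ramp_bounds(3)[OF A])
  have fd: "(\<lambda>n. expectation (\<lambda>\<omega>. ramp A t d (\<lambda>i. empirical_process n (\<tau> i) \<omega>))) \<longlonglongrightarrow> (\<integral>\<omega>. ramp A t d (\<lambda>i. B (\<tau> i) \<omega>) \<partial>N)"
    "(\<lambda>\<omega>. ramp A t d (\<lambda>i. empirical_process n (\<tau> i) \<omega>)) \<in> borel_measurable M"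
    "(\<lambda>\<omega>. ramp A t d (\<lambda>i. B (\<tau> i) \<omega>)) \<in> borel_measurable N" if "0 < d" for t d n
    by (rule finite_dimensional_convergence[OF B \<tau> lip[OF that] bd])+
  \<comment> \<open>\<open>A\<close> may be uncountable; measurability of the union is read off from
    that of the ramp.\<close>
  have U': "U' n t = {\<omega> \<in> space M. 0 < ramp A t 1 (\<lambda>i. empirical_process n (\<tau> i) \<omega>)}" for n t
    unfolding U'_def using ramp_pos_iff[OF A, of 1 t] sup_form_greater_iff[OF A, of t] by simp
  have V: "V t = {\<omega> \<in> space N. 0 < ramp A t 1 (\<lambda>i. B (\<tau> i) \<omega>)}" for t
    unfolding V_def using ramp_pos_iff[OF A, of 1 t] sup_form_greater_iff[OF A, of t] by simp
  have U'm: "U' n t \<in> events" for n t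
    unfolding U' using fd(2)[OF zero_less_one, of t n] by measurable
  have Vm: "V t \<in> sets N" for t
    unfolding V using fd(3)[OF zero_less_one, of t] by measurable
  show "U' n t \<in> events" "V t \<in> sets N" by (rule U'm Vm)+
  have lim: "(\<lambda>n. expectation (\<lambda>\<omega>. ?f (\<lambda>i. empirical_process n (\<tau> i) \<omega>))) \<longlonglongrightarrow> (\<integral>\<omega>. ?f (\<lambda>i. B (\<tau> i) \<omega>) \<partial>N)"
    by (rule fd(1)[OF d])
  have iM: "integrable M (\<lambda>\<omega>. ?f (\<lambda>i. empirical_process n (\<tau> i) \<omega>))" for n
    using fd(2)[OF d, of t n] ramp_bounds(3)[OF A] by (intro integrable_const_bound[where B=1]) auto
  have iN: "integrable N (\<lambda>\<omega>. ?f (\<lambda>i. B (\<tau> i) \<omega>))"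
    using fd(3)[OF d, of t] ramp_bounds(3)[OF A] by (intro N.integrable_const_bound[where B=1]) auto
  have iU: "integrable M (indicator (U' n s) :: _ \<Rightarrow> real)" for n s
    using U'm by (intro integrable_const_bound[where B=1]) auto
  have iV: "integrable N (indicator (V s) :: _ \<Rightarrow> real)" for s
    using Vm by (intro N.integrable_const_bound[where B=1]) auto
  have up: "?f s \<le> (if \<exists>(i, l)\<in>A. t < s i * l then 1 else 0)" for s
    using ramp_pos_iff[OF A d, of t s] sup_form_greater_iff[OF A, of t s] ramp_bounds(1,2)[OF A, of t d s] by (auto simp: not_less)
  have lo: "(if \<exists>(i, l)\<in>A. t + d < s i * l then 1 else 0) \<le> ?f s" for s
    using ramp_eq_1[OF A d, of t s] sup_form_greater_iff[OF A, of "t + d" s] ramp_bounds(1)[OF A, of t d s] by auto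
  have "expectation (\<lambda>\<omega>. ?f (\<lambda>i. empirical_process n (\<tau> i) \<omega>)) \<le> expectation (indicator (U' n t))" for n
  proof (rule integral_mono[OF iM iU])
    show "?f (\<lambda>i. empirical_process n (\<tau> i) \<omega>) \<le> indicator (U' n t) \<omega>" if "\<omega> \<in> space M" for \<omega>
      using up[of "\<lambda>i. empirical_process n (\<tau> i) \<omega>"] that unfolding U'_def indicator_def of_bool_def mem_Collect_eq by (simp only: simp_thms)
  qed
  then have 1: "expectation (\<lambda>\<omega>. ?f (\<lambda>i. empirical_process n (\<tau> i) \<omega>)) \<le> prob (U' n t)" for n using U'm by simp
  have "expectation (indicator (U' n (t + d))) \<le> expectation (\<lambda>\<omega>. ?f (\<lambda>i. empirical_process n (\<tau> i) \<omega>))" for n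
  proof (rule integral_mono[OF iU iM])
    show "indicator (U' n (t + d)) \<omega> \<le> ?f (\<lambda>i. empirical_process n (\<tau> i) \<omega>)" if "\<omega> \<in> space M" for \<omega>
      using lo[of "\<lambda>i. empirical_process n (\<tau> i) \<omega>"] that unfolding U'_def indicator_def of_bool_def mem_Collect_eq by (simp only: simp_thms)
  qed
  then have 2: "prob (U' n (t + d)) \<le> expectation (\<lambda>\<omega>. ?f (\<lambda>i. empirical_process n (\<tau> i) \<omega>))" for n using U'm by simp
  have "(\<integral>\<omega>. ?f (\<lambda>i. B (\<tau> i) \<omega>) \<partial>N) \<le> (\<integral>\<omega>. indicator (V t) \<omega> \<partial>N)"
  proof (rule integral_mono[OF iN iV])
    show "?f (\<lambda>i. B (\<tau> i) \<omega>) \<le> indicator (V t) \<omega>" if "\<omega> \<in> space N" for \<omega>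
      using up[of "\<lambda>i. B (\<tau> i) \<omega>"] that unfolding V_def indicator_def of_bool_def mem_Collect_eq by (simp only: simp_thms)
  qed
  then have 3: "(\<integral>\<omega>. ?f (\<lambda>i. B (\<tau> i) \<omega>) \<partial>N) \<le> measure N (V t)" using Vm by simp
  have "(\<integral>\<omega>. indicator (V (t + d)) \<omega> \<partial>N) \<le> (\<integral>\<omega>. ?f (\<lambda>i. B (\<tau> i) \<omega>) \<partial>N)"
  proof (rule integral_mono[OF iV iN])
    show "indicator (V (t + d)) \<omega> \<le> ?f (\<lambda>i. B (\<tau> i) \<omega>)" if "\<omega> \<in> space N" for \<omega>
      using lo[of "\<lambda>i. B (\<tau> i) \<omega>"] that unfolding V_def indicator_def of_bool_def mem_Collect_eq by (simp only: simp_thms)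
  qed
  then have 4: "measure N (V (t + d)) \<le> (\<integral>\<omega>. ?f (\<lambda>i. B (\<tau> i) \<omega>) \<partial>N)" using Vm by simp
  show "eventually (\<lambda>n. measure N (V (t + d)) \<le> prob (U' n t) + e) sequentially"
  proof -
    have "eventually (\<lambda>n. (\<integral>\<omega>. ?f (\<lambda>i. B (\<tau> i) \<omega>) \<partial>N) - e < expectation (\<lambda>\<omega>. ?f (\<lambda>i. empirical_process n (\<tau> i) \<omega>))) sequentially"
      using e by (intro order_tendstoD(1)[OF lim]) simp
    then show ?thesis
    proof eventually_elim
      case (elim n)
      then show ?case using 1[of n] 4 by linarith
    qed
  qed
  show "eventually (\<lambda>n. prob (U' n (t + d)) \<le> measure N (V t) + e) sequentially"
  proof -
    have "eventually (\<lambda>n. expectation (\<lambda>\<omega>. ?f (\<lambda>i. empirical_process n (\<tau> i) \<omega>)) < (\<integral>\<omega>. ?f (\<lambda>i. B (\<tau> i) \<omega>) \<partial>N) + e) sequentially"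
      using e by (intro order_tendstoD(2)[OF lim]) simp
    then show ?thesis
    proof eventually_elim
      case (elim n)
      then show ?case using 2[of n] 3 by linarith
    qed
  qed
qed

end

section \<open>The Berk-Jones statistic\<close>

lemma (in uniform_sample) prob_eq_0:
  assumes "c \<in> {0..1}"
  shows "prob {\<omega> \<in> space M. U i \<omega> = c} = 0"
proof (rule antisym[OF _ measure_nonneg])
  show "prob {\<omega> \<in> space M. U i \<omega> = c} \<le> 0"
  proof (rule field_le_epsilon)
    fix e :: real assume e: "0 < e"
    show "prob {\<omega> \<in> space M. U i \<omega> = c} \<le> 0 + e"
    proof (cases "c \<le> e")
      case True
      have "prob {\<omega> \<in> space M. U i \<omega> = c} \<le> prob {\<omega> \<in> space M. U i \<omega> \<le> c}" by (intro finite_measure_mono) auto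
      then show ?thesis using True uniform[OF assms, of i] by simp
    next
      case False
      have "prob {\<omega> \<in> space M. U i \<omega> = c} \<le> prob {\<omega> \<in> space M. U i \<omega> \<in> {c - e<..c}}"
        using e by (intro finite_measure_mono) auto
      then show ?thesis using prob_between[of "c - e" c i] False assms e by simp
    qed
  qed
qed

lemma (in uniform_sample) empirical_process_le_sqrt:
  assumes "t \<in> {0..1}"
  shows "\<bar>empirical_process n t \<omega>\<bar> \<le> sqrt n"
proof -
  have "\<bar>\<Sum>i<n. indicator {..t} (U i \<omega>) - t\<bar> \<le> (\<Sum>i<n. 1)"
    using assms by (intro order_trans[OF sum_abs sum_mono]) (auto simp: indicator_def)
  then have "\<bar>empirical_process n t \<omega>\<bar> \<le> n / sqrt n"
    unfolding empirical_process_def by (simp add: divide_right_mono)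
  then show ?thesis by (simp add: real_div_sqrt)
qed

lemma (in square_integrable_log_ratio) tail_or_center:
  assumes "2 \<le> k"
  obtains m where "0 \<le> m" "\<And>x. 1 / 2^k < F x \<Longrightarrow> 1 / 2^k < 1 - F x \<Longrightarrow> \<bar>L x\<bar> \<le> m"
proof -
  have "(2::real)^1 < 2^k" using assms by (intro power_strict_increasing) auto
  then have "0 < 1 / (2::real)^k" "1 / (2::real)^k < 1/2" by (auto simp: divide_simps)
  then obtain m where m: "\<And>x. 1 / 2^k \<le> F x \<Longrightarrow> F x \<le> 1 - 1 / 2^k \<Longrightarrow> \<bar>L x\<bar> \<le> m" using L_bounded_center by blast
  have "\<bar>L x\<bar> \<le> max 0 m" if "1 / 2^k < F x" "1 / 2^k < 1 - F x" for x using m[of x] that by linarith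
  then show ?thesis using that[of "max 0 m"] by auto
qed

locale berk_jones_limit = bridge_log_ratio P Q F G N B
  for P Q F G and N :: "'b measure" and B +
  fixes M :: "'a measure" and X :: "nat \<Rightarrow> 'a \<Rightarrow> real"
  assumes M: "prob_space M" and X_indep: "prob_space.indep_vars M (\<lambda>_. borel) X UNIV"
    and X_distr: "\<And>i. distr M borel (X i) = P"
begin

sublocale M: prob_space M by (rule M)

lemma X_measurable[measurable]: "X i \<in> borel_measurable M"
  using X_indep by (auto simp: M.indep_vars_def)

sublocale U: uniform_sample M "\<lambda>i \<omega>. F (X i \<omega>)"
proof
  show "M.indep_vars (\<lambda>_. borel) (\<lambda>i \<omega>. F (X i \<omega>)) UNIV"
    by (rule M.indep_vars_compose2[OF X_indep]) measurable
  fix i and t :: real assume t: "t \<in> {0..1}"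
  have "measure M {\<omega> \<in> space M. F (X i \<omega>) \<le> t} = measure (distr M borel (X i)) {x. F x \<le> t}"
    by (subst measure_distr) (auto intro!: arg_cong[where f="measure M"])
  then show "measure M {\<omega> \<in> space M. F (X i \<omega>) \<le> t} = t" using prob_F_le[OF t] by (simp add: X_distr)
qed

text \<open>\<open>F\<close> may be flat, so \<open>F (X i \<omega>) \<le> F x\<close> does not by
  itself give \<open>X i \<omega> \<le> x\<close>. Where this holds, the sample can be studied
  through the uniform variables \<open>F (X i \<omega>)\<close>.\<close>

definition regular :: "'a \<Rightarrow> bool" where
  "regular \<omega> \<longleftrightarrow> (\<forall>i. 0 < F (X i \<omega>) \<and> F (X i \<omega>) < 1 \<and> (\<forall>x. X i \<omega> \<le> x \<longleftrightarrow> F (X i \<omega>) \<le> F x))"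

text \<open>A violation of the order property puts \<open>F (X i \<omega>)\<close> at the value
  \<open>F q\<close> for a rational \<open>q\<close> between \<open>x\<close> and
  \<open>X i \<omega>\<close>. These are countably many values, each taken with probability
  0.\<close>

lemma AE_regular: "AE \<omega> in M. regular \<omega>"
proof -
  have ne: "AE \<omega> in M. F (X i \<omega>) \<noteq> c" if "c \<in> {0..1}" for i c
  proof -
    have "{\<omega> \<in> space M. F (X i \<omega>) = c} \<in> null_sets M"
      using U.prob_eq_0[OF that, of i] by (auto simp: M.emeasure_eq_measure null_sets_def)
    then show ?thesis by (rule AE_I') auto
  qed
  have "AE \<omega> in M. \<forall>i. F (X i \<omega>) \<noteq> 0 \<and> F (X i \<omega>) \<noteq> 1 \<and> (\<forall>q::rat. F (X i \<omega>) \<noteq> F (of_rat q))"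
    unfolding AE_all_countable using F_bounds by (intro allI AE_conjI ne) (auto simp: AE_all_countable intro!: ne)
  then show ?thesis
  proof eventually_elim
    case (elim \<omega>)
    have "X i \<omega> \<le> x" if le: "F (X i \<omega>) \<le> F x" for i x
    proof (rule ccontr)
      assume "\<not> X i \<omega> \<le> x"
      then obtain q where q: "x < of_rat q" "of_rat q < X i \<omega>" using of_rat_dense[of x "X i \<omega>"] by auto
      then have "F (X i \<omega>) = F (of_rat q)"
        using F_mono[of x "of_rat q"] F_mono[of "of_rat q" "X i \<omega>"] le by simp
      then show False using elim by blast
    qed
    moreover have "0 < F (X i \<omega>)" "F (X i \<omega>) < 1" for i
      using elim F_bounds[of "X i \<omega>"] by (auto simp: less_le)
    ultimately show ?case unfolding regular_def using F_mono by blast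
  qed
qed

definition stat :: "nat \<Rightarrow> 'a \<Rightarrow> real \<Rightarrow> real" where
  "stat n \<omega> x = bern_KL (empirical_cdf X n \<omega> x) (G x)"

definition BJ :: "nat \<Rightarrow> 'a \<Rightarrow> real" where
  "BJ n \<omega> = sqrt n * (berk_jones (empirical_cdf X n \<omega>) G - sup_fun KFG)"

definition Z :: "nat \<Rightarrow> 'a \<Rightarrow> real \<Rightarrow> real" where
  "Z n \<omega> x = U.empirical_process n (F x) \<omega> * L x"

text \<open>Where \<open>F\<close> is 0 or 1 the empirical distribution function agrees with
  \<open>F\<close> for a regular sample, so nothing remains; the value 0 also avoids default values
  of the divergence.\<close>

definition remainder :: "nat \<Rightarrow> 'a \<Rightarrow> real \<Rightarrow> real" where
  "remainder n \<omega> x = (if 0 < F x \<and> F x < 1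
     then sqrt n * bern_KL (F x + U.empirical_process n (F x) \<omega> / sqrt n) (F x) else 0)"

lemma BJ_measurable[measurable]: "BJ n \<in> borel_measurable M"
  unfolding BJ_def using borel_measurable_berk_jones[OF X_measurable G_cont G_mono G_bounds] by measurable

lemma empirical_cdf_eq:
  assumes "regular \<omega>" "0 < n"
  shows "empirical_cdf X n \<omega> x = F x + U.empirical_process n (F x) \<omega> / sqrt n"
proof -
  have "{i. i < n \<and> X i \<omega> \<le> x} = {i. i < n \<and> F (X i \<omega>) \<le> F x}" using assms(1) unfolding regular_def by blast
  then show ?thesis
    unfolding U.empirical_fraction[OF assms(2)] empirical_cdf_def
    by (simp add: indicator_def of_bool_def[symmetric] Int_def lessThan_def)
qed

lemma empirical_cdf_bounds: "0 \<le> empirical_cdf X n \<omega> x" "empirical_cdf X n \<omega> x \<le> 1"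
proof -
  have "card {i. i < n \<and> X i \<omega> \<le> x} \<le> card {..<n}" by (intro card_mono) auto
  then show "0 \<le> empirical_cdf X n \<omega> x" "empirical_cdf X n \<omega> x \<le> 1"
    unfolding empirical_cdf_def by (auto simp: divide_le_eq)
qed

lemma empirical_cdf_degenerate:
  assumes "regular \<omega>" "0 < n"
  shows "F x = 0 \<Longrightarrow> empirical_cdf X n \<omega> x = F x" "F x = 1 \<Longrightarrow> empirical_cdf X n \<omega> x = F x"
proof -
  assume F0: "F x = 0"
  then have "{i. i < n \<and> X i \<omega> \<le> x} = {}" using assms(1) unfolding regular_def by (auto simp: not_le)
  then show "empirical_cdf X n \<omega> x = F x" unfolding empirical_cdf_def F0 by simp
next
  assume F1: "F x = 1"
  then have "{i. i < n \<and> X i \<omega> \<le> x} = {..<n}" using assms(1) F_bounds unfolding regular_def by auto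
  then show "empirical_cdf X n \<omega> x = F x" unfolding empirical_cdf_def F1 using assms(2) by simp
qed

lemma stat_expansion:
  assumes "regular \<omega>" "0 < n"
  shows "sqrt n * (stat n \<omega> x - r) = sqrt n * (K x - r) + Z n \<omega> x + remainder n \<omega> x"
proof -
  consider "F x = 0 \<or> F x = 1" | "0 < F x" "F x < 1" using F_bounds[of x] by (auto simp: less_le)
  then show ?thesis
  proof cases
    case 1
    then have "stat n \<omega> x = K x" unfolding stat_def using empirical_cdf_degenerate[OF assms, of x] by auto
    moreover have "Z n \<omega> x = 0" using L_zero[OF 1] by (simp add: Z_def)
    moreover have "remainder n \<omega> x = 0" using 1 by (auto simp: remainder_def)
    ultimately show ?thesis by simp
  next
    case 2
    let ?u = "U.empirical_process n (F x) \<omega>"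
    have "stat n \<omega> x = K x + ?u / sqrt n * L x + bern_KL (F x + ?u / sqrt n) (F x)"
      unfolding stat_def bern_KL_expansion[OF empirical_cdf_bounds 2] by (simp add: empirical_cdf_eq[OF assms])
    moreover have "sqrt n * (?u / sqrt n * L x) = Z n \<omega> x" using assms(2) by (simp add: Z_def)
    ultimately show ?thesis using 2 by (simp add: remainder_def algebra_simps)
  qed
qed

lemma remainder_nonneg:
  assumes "regular \<omega>" "0 < n"
  shows "0 \<le> remainder n \<omega> x"
proof -
  have "0 \<le> bern_KL (empirical_cdf X n \<omega> x) (F x)" if "0 < F x" "F x < 1"
    using that by (intro bern_KL_nonneg empirical_cdf_bounds)
  then show ?thesis unfolding remainder_def empirical_cdf_eq[OF assms, symmetric] by simp
qed

lemma stat_nonneg: "0 < F x \<Longrightarrow> F x < 1 \<Longrightarrow> 0 \<le> stat n \<omega> x"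
  unfolding stat_def using G_interior[of x] by (intro bern_KL_nonneg empirical_cdf_bounds) auto

text \<open>If no such \<open>x\<close> existed, the statistic would be bounded by a common
  constant, so the supremum in the contradiction is a genuine one. In this direction boundedness
  comes for free; \<open>BJ_lower\<close> has to assume it.\<close>

lemma BJ_greater_imp:
  assumes "regular \<omega>" "0 < n" "t < BJ n \<omega>"
  obtains x where "t < sqrt n * (K x - sup_fun KFG) + Z n \<omega> x + remainder n \<omega> x"
proof (rule ccontr)
  assume "\<not> thesis"
  then have "sqrt n * (stat n \<omega> x - sup_fun KFG) \<le> t" for x
    unfolding stat_expansion[OF assms(1,2)] using that not_less by blast
  then have "stat n \<omega> x \<le> t / sqrt n + sup_fun KFG" for x
    using assms(2) by (simp add: pos_le_divide_eq mult.commute diff_le_eq[symmetric])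
  then have "berk_jones (empirical_cdf X n \<omega>) G \<le> t / sqrt n + sup_fun KFG"
    unfolding berk_jones_def stat_def[symmetric] by (intro cSUP_least) auto
  then have "sqrt n * (berk_jones (empirical_cdf X n \<omega>) G - sup_fun KFG) \<le> sqrt n * (t / sqrt n)"
    by (intro mult_left_mono) auto
  then have "BJ n \<omega> \<le> t" using assms(2) by (simp add: BJ_def)
  then show False using assms(3) by simp
qed

lemma BJ_lower:
  assumes "regular \<omega>" "0 < n" "bdd_above (range (stat n \<omega>))"
  shows "sqrt n * (stat n \<omega> x - sup_fun KFG) \<le> BJ n \<omega>"
proof -
  have "stat n \<omega> x \<le> berk_jones (empirical_cdf X n \<omega>) G"
    unfolding berk_jones_def stat_def[symmetric] by (rule cSUP_upper[OF _ assms(3)]) simp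
  then show ?thesis unfolding BJ_def by (intro mult_left_mono) auto
qed

lemma tail_event:
  assumes a: "0 < a" and d: "0 < d"
  shows "\<exists>k0\<ge>2. \<exists>n0>0. \<forall>n\<ge>n0. \<exists>E\<in>M.events. M.prob E \<le> d \<and> (\<forall>\<omega>\<in>space M - E.
    (\<forall>x. F x \<le> 1 / 2^k0 \<or> 1 - F x \<le> 1 / 2^k0 \<longrightarrow> \<bar>Z n \<omega> x\<bar> \<le> a) \<and> (\<forall>x. remainder n \<omega> x \<le> a))"
proof -
  obtain w where w: "\<And>k. 0 < w k" "summable (\<lambda>k. (w k)\<^sup>2 / 2^k)"
    "\<And>k x. 2 \<le> k \<Longrightarrow> 1 / 2^(k+1) < F x \<Longrightarrow> F x \<le> 1 / 2^k \<Longrightarrow> \<bar>L x\<bar> \<le> w k"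
    "\<And>k x. 2 \<le> k \<Longrightarrow> 1 / 2^(k+1) < 1 - F x \<Longrightarrow> 1 - F x \<le> 1 / 2^k \<Longrightarrow> \<bar>L x\<bar> \<le> w k"
    using L_dyadic_weights by blast
  have d2: "0 < d / 2" using d by simp
  obtain k1 where k1: "1 \<le> k1" "\<And>n. 0 < n \<Longrightarrow> \<exists>E\<in>M.events. M.prob E \<le> d / 2 \<and> (\<forall>\<omega>\<in>space M - E. \<forall>k\<ge>k1. \<forall>t\<in>{0..1/2^k}.
    \<bar>U.empirical_process n t \<omega>\<bar> * w k \<le> a \<and> \<bar>U.empirical_process n (1 - t) \<omega>\<bar> * w k \<le> a)"
    using U.weighted_tail[OF w(1,2) a d2] by blast
  obtain n1 where n1: "\<And>n. n1 \<le> n \<Longrightarrow> \<exists>E\<in>M.events. M.prob E \<le> d / 2 \<and> (\<forall>\<omega>\<in>space M - E. \<forall>t\<in>{0<..<1}.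
    sqrt n * bern_KL (t + U.empirical_process n t \<omega> / sqrt n) t \<le> a)"
    using U.null_statistic_negligible[OF a d2] by blast
  define k0 where "k0 = max 2 k1"
  have "\<exists>E\<in>M.events. M.prob E \<le> d \<and> (\<forall>\<omega>\<in>space M - E.
    (\<forall>x. F x \<le> 1 / 2^k0 \<or> 1 - F x \<le> 1 / 2^k0 \<longrightarrow> \<bar>Z n \<omega> x\<bar> \<le> a) \<and> (\<forall>x. remainder n \<omega> x \<le> a))" if n: "max 1 n1 \<le> n" for n
  proof -
    obtain E1 where E1: "E1 \<in> M.events" "M.prob E1 \<le> d / 2"
      "\<And>\<omega> k t. \<omega> \<in> space M - E1 \<Longrightarrow> k1 \<le> k \<Longrightarrow> t \<in> {0..1/2^k} \<Longrightarrow>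
        \<bar>U.empirical_process n t \<omega>\<bar> * w k \<le> a \<and> \<bar>U.empirical_process n (1 - t) \<omega>\<bar> * w k \<le> a"
      using k1(2)[of n] n by auto
    obtain E2 where E2: "E2 \<in> M.events" "M.prob E2 \<le> d / 2"
      "\<And>\<omega> t. \<omega> \<in> space M - E2 \<Longrightarrow> t \<in> {0<..<1} \<Longrightarrow> sqrt n * bern_KL (t + U.empirical_process n t \<omega> / sqrt n) t \<le> a"
      using n1[of n] n by auto
    have "M.prob (E1 \<union> E2) \<le> d" using measure_Un_le[OF E1(1) E2(1)] E1(2) E2(2) by linarith
    moreover have "\<bar>Z n \<omega> x\<bar> \<le> a" if \<omega>: "\<omega> \<in> space M - (E1 \<union> E2)" and x: "F x \<le> 1 / 2^k0 \<or> 1 - F x \<le> 1 / 2^k0" for \<omega> x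
      unfolding Z_def
    proof (rule weighted_tail_at[where w=w and K=k0 and b="\<lambda>t. U.empirical_process n t \<omega>", OF w(3,4) _ _ x])
      show "\<bar>U.empirical_process n t \<omega>\<bar> * w k \<le> a \<and> \<bar>U.empirical_process n (1 - t) \<omega>\<bar> * w k \<le> a"
        if "k0 \<le> k" "t \<in> {0..1/2^k}" for k t
        using E1(3)[of \<omega> k t] \<omega> that by (auto simp: k0_def)
    qed (use a in \<open>auto simp: k0_def\<close>)
    moreover have "remainder n \<omega> x \<le> a" if \<omega>: "\<omega> \<in> space M - (E1 \<union> E2)" for \<omega> x
      unfolding remainder_def using E2(3)[of \<omega> "F x"] \<omega> a by auto
    ultimately show ?thesis using E1(1) E2(1) by (intro bexI[of _ "E1 \<union> E2"]) auto
  qed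
  then show ?thesis by (intro exI[of _ k0] conjI exI[of _ "max 1 n1"]) (auto simp: k0_def)
qed

text \<open>Lower bounds for \<open>BJ\<close> make sense only if the supremum is not a default
  value. Near the ends \<open>Z\<close> is at most 1 by \<open>tail_event\<close>; in the centre
  \<open>L\<close> is bounded and the empirical process is at most \<open>sqrt n\<close>; the drift
  is never positive.\<close>

lemma bounded_event:
  assumes d: "0 < d"
  shows "\<exists>n0>0. \<forall>n\<ge>n0. \<exists>E\<in>M.events. M.prob E \<le> d \<and> (\<forall>\<omega>\<in>space M - E. regular \<omega> \<longrightarrow> bdd_above (range (stat n \<omega>)))"
proof -
  obtain k0 n0 where k0: "2 \<le> k0" "0 < n0" "\<And>n. n0 \<le> n \<Longrightarrow> \<exists>E\<in>M.events. M.prob E \<le> d \<and> (\<forall>\<omega>\<in>space M - E.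
    (\<forall>x. F x \<le> 1 / 2^k0 \<or> 1 - F x \<le> 1 / 2^k0 \<longrightarrow> \<bar>Z n \<omega> x\<bar> \<le> 1) \<and> (\<forall>x. remainder n \<omega> x \<le> 1))"
    using tail_event[OF zero_less_one d] by blast
  obtain m where m: "0 \<le> m" "\<And>x. 1 / 2^k0 < F x \<Longrightarrow> 1 / 2^k0 < 1 - F x \<Longrightarrow> \<bar>L x\<bar> \<le> m"
    using tail_or_center[OF k0(1)] by blast
  have "bdd_above (range (stat n \<omega>))"
    if n: "n0 \<le> n" and "regular \<omega>"
      and Z: "\<And>x. F x \<le> 1 / 2^k0 \<or> 1 - F x \<le> 1 / 2^k0 \<Longrightarrow> \<bar>Z n \<omega> x\<bar> \<le> 1" and r: "\<And>x. remainder n \<omega> x \<le> 1" for n \<omega>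
  proof (rule bdd_aboveI2)
    fix x
    have n': "0 < n" using n k0(2) by simp
    have "\<bar>Z n \<omega> x\<bar> \<le> 1 + sqrt n * m"
    proof (cases "F x \<le> 1 / 2^k0 \<or> 1 - F x \<le> 1 / 2^k0")
      case True
      have "0 \<le> sqrt n * m" using m(1) by simp
      then show ?thesis using Z[OF True] by linarith
    next
      case False
      have "\<bar>Z n \<omega> x\<bar> \<le> sqrt n * m"
        unfolding Z_def abs_mult using m False U.empirical_process_le_sqrt[of "F x" n \<omega>] F_bounds[of x]
        by (intro mult_mono) auto
      then show ?thesis by simp
    qed
    moreover have "sqrt n * (K x - sup_fun KFG) \<le> 0" using sup_KFG(2)[of x] by (intro mult_nonneg_nonpos) auto
    ultimately have "sqrt n * (stat n \<omega> x - sup_fun KFG) \<le> 2 + sqrt n * m"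
      unfolding stat_expansion[OF that(2) n'] using r[of x] by linarith
    then show "stat n \<omega> x \<le> (2 + sqrt n * m) / sqrt n + sup_fun KFG"
      using n' by (simp add: pos_le_divide_eq mult.commute diff_le_eq[symmetric])
  qed
  then have "\<forall>n\<ge>n0. \<exists>E\<in>M.events. M.prob E \<le> d \<and> (\<forall>\<omega>\<in>space M - E. regular \<omega> \<longrightarrow> bdd_above (range (stat n \<omega>)))"
    using k0(3) by meson
  then show ?thesis using k0(2) by blast
qed

lemma AE_vanishing: "AE \<omega> in N. vanishing_at_ends (\<lambda>t. B t \<omega>)"
proof -
  obtain w where w: "\<And>k. 0 < w k" "summable (\<lambda>k. (w k)\<^sup>2 / 2^k)"
    "\<And>k x. 2 \<le> k \<Longrightarrow> 1 / 2^(k+1) < F x \<Longrightarrow> F x \<le> 1 / 2^k \<Longrightarrow> \<bar>L x\<bar> \<le> w k"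
    "\<And>k x. 2 \<le> k \<Longrightarrow> 1 / 2^(k+1) < 1 - F x \<Longrightarrow> 1 - F x \<le> 1 / 2^k \<Longrightarrow> \<bar>L x\<bar> \<le> w k"
    using L_dyadic_weights by blast
  show ?thesis
    using U.bridge_weighted_tail[OF bridge w(1,2)]
    by eventually_elim (rule vanishing_at_endsI[where w=w, OF w(3,4)])
qed

end

context berk_jones_limit begin

abbreviation limit :: "'b \<Rightarrow> real" where "limit \<omega> \<equiv> sup_fun_deriv KFG (W \<omega>)"

text \<open>By continuity an excess at an interior maximiser passes to a point of \<open>D\<close>.
  A maximiser at infinity, or with \<open>F\<close> equal to 0 or 1, contributes the value 0 and so
  matters for negative \<open>t\<close> only.\<close>

lemma limit_exceeds_imp:
  assumes \<omega>: "\<omega> \<in> space N" "vanishing_at_ends (\<lambda>t. B t \<omega>)" and t: "t < limit \<omega>"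
    and D: "{r. ereal r \<in> max_set KFG \<and> 0 < F r \<and> F r < 1} \<subseteq> closure D"
  shows "(\<exists>r\<in>D. t < B (F r) \<omega> * L r) \<or>
    (t < 0 \<and> (\<exists>x\<in>max_set KFG. \<forall>r. x = ereal r \<longrightarrow> F r = 0 \<or> F r = 1))"
proof -
  note p = path_continuous[OF \<omega>]
  have "bdd_above (W \<omega> ` max_set KFG)"
    by (rule bdd_above_mono[OF sup_fun_continuous(1)[OF p(1)] image_mono]) simp
  then obtain x where x: "x \<in> max_set KFG" "t < W \<omega> x"
    using t unfolding p(4) by (subst (asm) less_cSUP_iff) (auto simp: sup_fun_continuous(2)[OF KFG_continuous])
  show ?thesis
  proof (cases "\<exists>r. x = ereal r \<and> 0 < F r \<and> F r < 1")
    case True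
    then obtain r where r: "x = ereal r" "0 < F r" "F r < 1" by blast
    then have "r \<in> closure D" using x(1) D by blast
    then obtain d where d: "\<And>n. d n \<in> D" "d \<longlonglongrightarrow> r" unfolding closure_sequential by blast
    have "(\<lambda>n. B (F (d n)) \<omega> * L (d n)) \<longlonglongrightarrow> B (F r) \<omega> * L r"
      by (intro isCont_tendsto_compose[OF isCont_path[OF \<omega>(1) r(2,3)] d(2)])
    moreover have "t < B (F r) \<omega> * L r" using x(2) by (simp add: r(1) W_ereal)
    ultimately have "eventually (\<lambda>n. t < B (F (d n)) \<omega> * L (d n)) sequentially" by (rule order_tendstoD)
    then obtain n where "t < B (F (d n)) \<omega> * L (d n)" using eventually_happens trivial_limit_sequentially by blast
    then show ?thesis using d(1) by blast
  next
    case False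
    then have deg: "F r = 0 \<or> F r = 1" if "x = ereal r" for r using that F_bounds[of r] by (auto simp: less_le)
    then have "W \<omega> x = 0" using p(2,3) by (cases x) (auto simp: W_ereal L_zero)
    then show ?thesis using x deg by auto
  qed
qed

text \<open>At a maximiser the drift is 0 and the remainder is nonnegative. The three thirds of
  \<open>e\<close> pay for an unbounded statistic, for passing from \<open>D\<close> to finitely
  many of its points, and for convergence at these points.\<close>

lemma upper_tail_liminf:
  assumes d: "0 < d" and e: "0 < e"
  shows "eventually (\<lambda>n. N.prob {\<omega> \<in> space N. t + d < limit \<omega>} \<le> M.prob {\<omega> \<in> space M. t < BJ n \<omega>} + e) sequentially"
proof -
  note [measurable] = limit_measurable
  define S where "S = {r. ereal r \<in> max_set KFG \<and> 0 < F r \<and> F r < 1}"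
  obtain D where D: "countable D" "D \<subseteq> S" "S \<subseteq> closure D" using separable[of S] by metis
  have e3: "0 < e / 3" using e by simp
  obtain n0 where n0': "0 < n0 \<and> (\<forall>n\<ge>n0. \<exists>E\<in>M.events. M.prob E \<le> e / 3 \<and> (\<forall>\<omega>\<in>space M - E. regular \<omega> \<longrightarrow> bdd_above (range (stat n \<omega>))))"
    using bounded_event[OF e3] by (rule exE)
  note n0 = conjunct1[OF n0'] conjunct2[OF n0', rule_format]
  have imp: "M.prob A \<le> M.prob {\<omega> \<in> space M. t < BJ n \<omega>} + e / 3"
    if n: "n0 \<le> n" and A: "A \<in> M.events"
      and impl: "\<And>\<omega>. \<omega> \<in> A \<Longrightarrow> regular \<omega> \<Longrightarrow> bdd_above (range (stat n \<omega>)) \<Longrightarrow> t < BJ n \<omega>" for n A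
  proof -
    obtain E where E: "E \<in> M.events" "M.prob E \<le> e / 3" "\<And>\<omega>. \<omega> \<in> space M - E \<Longrightarrow> regular \<omega> \<Longrightarrow> bdd_above (range (stat n \<omega>))"
      using n0(2)[OF n] by (elim bexE conjE) (rule that, auto)
    have "M.prob A \<le> M.prob ({\<omega> \<in> space M. t < BJ n \<omega>} \<union> E)"
    proof (rule M.finite_measure_mono_AE)
      show "AE \<omega> in M. \<omega> \<in> A \<longrightarrow> \<omega> \<in> {\<omega> \<in> space M. t < BJ n \<omega>} \<union> E"
        using AE_regular AE_space
      proof eventually_elim
        case (elim \<omega>)
        then show ?case using impl[of \<omega>] E(3)[of \<omega>] by auto
      qed
      show "{\<omega> \<in> space M. t < BJ n \<omega>} \<union> E \<in> M.events" using E(1) by (intro sets.Un) measurable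
    qed
    also have "\<dots> \<le> M.prob {\<omega> \<in> space M. t < BJ n \<omega>} + M.prob E" using E(1) by (intro measure_Un_le) auto
    finally show ?thesis using E(2) by simp
  qed
  show ?thesis
  \<comment> \<open>With a maximiser at an end of the support, \<open>BJ\<close> is nonnegative off
    the event of unboundedness, so its upper tail at a negative level has probability nearly 1. For
    an infinite maximiser the maximal divergence is 0, and the statistic is nonnegative at any
    interior point.\<close>
  proof (cases "t + d < 0 \<and> (\<exists>x\<in>max_set KFG. \<forall>r. x = ereal r \<longrightarrow> F r = 0 \<or> F r = 1)")
    case True
    then obtain x where x: "x \<in> max_set KFG" "\<And>r. x = ereal r \<Longrightarrow> F r = 0 \<or> F r = 1" by blast
    have "N.prob {\<omega> \<in> space N. t + d < limit \<omega>} \<le> M.prob {\<omega> \<in> space M. t < BJ n \<omega>} + e" if n: "n0 \<le> n" for n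
    proof -
      have "M.prob (space M) \<le> M.prob {\<omega> \<in> space M. t < BJ n \<omega>} + e / 3"
      proof (rule imp[OF n])
        fix \<omega> assume \<omega>: "\<omega> \<in> space M" "regular \<omega>" "bdd_above (range (stat n \<omega>))"
        have n': "0 < n" using n n0(1) by simp
        have "\<exists>y. 0 \<le> sqrt n * (stat n \<omega> y - sup_fun KFG)"
        proof (cases x)
          case (real r)
          then have "K r = sup_fun KFG" using x(1) by (simp add: max_set_def KFG_ereal)
          moreover have "L r = 0" using x(2)[OF real] by (rule L_zero)
          ultimately show ?thesis
            using stat_expansion[OF \<omega>(2) n', of r "sup_fun KFG"] remainder_nonneg[OF \<omega>(2) n', of r]
            by (intro exI[of _ r]) (simp add: Z_def)
        next
          case PInf
          then have "sup_fun KFG = 0" using x(1) by (simp add: max_set_def KFG_infinity)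
          moreover obtain y where "F y = 1/2" using F_attains[of "1/2"] by auto
          ultimately show ?thesis using stat_nonneg[of y n \<omega>] by (intro exI[of _ y]) simp
        next
          case MInf
          then have "sup_fun KFG = 0" using x(1) by (simp add: max_set_def KFG_infinity)
          moreover obtain y where "F y = 1/2" using F_attains[of "1/2"] by auto
          ultimately show ?thesis using stat_nonneg[of y n \<omega>] by (intro exI[of _ y]) simp
        qed
        then obtain y where "0 \<le> sqrt n * (stat n \<omega> y - sup_fun KFG)" by blast
        also have "\<dots> \<le> BJ n \<omega>" by (rule BJ_lower[OF \<omega>(2) n' \<omega>(3)])
        finally show "t < BJ n \<omega>" using True d by linarith
      qed simp
      then have "1 \<le> M.prob {\<omega> \<in> space M. t < BJ n \<omega>} + e / 3" by (simp add: M.prob_space)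
      then show ?thesis using N.prob_le_1[of "{\<omega> \<in> space N. t + d < limit \<omega>}"] e by linarith
    qed
    then show ?thesis unfolding eventually_sequentially by blast
  next
    case False
    have Dm: "{\<omega> \<in> space N. \<exists>r\<in>D. s < B (F r) \<omega> * L r} \<in> sets N" for s
    proof -
      have "(\<lambda>\<omega>. B (F r) \<omega> * L r) \<in> borel_measurable N" for r using W_measurable[of "ereal r"] by (simp add: W_ereal)
      then have "{\<omega> \<in> space N. s < B (F r) \<omega> * L r} \<in> sets N" for r by measurable
      then have "(\<Union>r\<in>D. {\<omega> \<in> space N. s < B (F r) \<omega> * L r}) \<in> sets N" using D(1) by (intro sets.countable_UN'') auto
      also have "(\<Union>r\<in>D. {\<omega> \<in> space N. s < B (F r) \<omega> * L r}) = {\<omega> \<in> space N. \<exists>r\<in>D. s < B (F r) \<omega> * L r}" by auto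
      finally show ?thesis .
    qed
    have le: "N.prob {\<omega> \<in> space N. t + d < limit \<omega>} \<le> N.prob {\<omega> \<in> space N. \<exists>r\<in>D. t + d < B (F r) \<omega> * L r}"
    proof (rule N.finite_measure_mono_AE[OF _ Dm])
      show "AE \<omega> in N. \<omega> \<in> {\<omega> \<in> space N. t + d < limit \<omega>} \<longrightarrow> \<omega> \<in> {\<omega> \<in> space N. \<exists>r\<in>D. t + d < B (F r) \<omega> * L r}"
        using AE_vanishing
      proof eventually_elim
        case (elim \<omega>)
        then show ?case using limit_exceeds_imp[of \<omega> "t + d" D] False D(3) unfolding S_def by blast
      qed
    qed
    show ?thesis
    proof (cases "D = {}")
      case True
      then have "N.prob {\<omega> \<in> space N. t + d < limit \<omega>} \<le> 0" using le by simp
      then have "N.prob {\<omega> \<in> space N. t + d < limit \<omega>} \<le> M.prob {\<omega> \<in> space M. t < BJ n \<omega>} + e" for n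
        using measure_nonneg[of M "{\<omega> \<in> space M. t < BJ n \<omega>}"] e by linarith
      then show ?thesis by simp
    next
      case ne: False
      define q where "q = from_nat_into D"
      have q: "D = range q" "q i \<in> D" for i using D(1) ne by (simp_all add: q_def range_from_nat_into from_nat_into)
      define V where "V m = {\<omega> \<in> space N. \<exists>i<m. t + d < B (F (q i)) \<omega> * L (q i)}" for m
      have Vm: "V m \<in> sets N" for m
      proof -
        have [measurable]: "(\<lambda>\<omega>. B (F r) \<omega> * L r) \<in> borel_measurable N" for r using W_measurable[of "ereal r"] by (simp add: W_ereal)
        show ?thesis unfolding V_def by measurable
      qed
      then have "range V \<subseteq> sets N" by blast
      moreover have "incseq V" unfolding V_def incseq_def by (auto intro: less_le_trans)
      ultimately have "(\<lambda>m. N.prob (V m)) \<longlonglongrightarrow> N.prob (\<Union>m. V m)" by (rule N.finite_Lim_measure_incseq)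
      moreover have "(\<Union>m. V m) = {\<omega> \<in> space N. \<exists>r\<in>D. t + d < B (F r) \<omega> * L r}" unfolding V_def q(1) by auto
      ultimately have "eventually (\<lambda>m. N.prob {\<omega> \<in> space N. \<exists>r\<in>D. t + d < B (F r) \<omega> * L r} - e / 3 < N.prob (V m)) sequentially"
        using e3 by (intro order_tendstoD(1)) auto
      then obtain m0 where m0: "\<And>m. m0 \<le> m \<Longrightarrow> N.prob {\<omega> \<in> space N. \<exists>r\<in>D. t + d < B (F r) \<omega> * L r} - e / 3 < N.prob (V m)"
        unfolding eventually_sequentially by blast
      define m where "m = Suc m0"
      define A where "A = (\<lambda>i. (i, L (q i))) ` {..<m}"
      have A0: "A \<noteq> {}" by (auto simp: A_def m_def)
      have A1: "i < m \<and> \<bar>l\<bar> \<le> (\<Sum>i<m. \<bar>L (q i)\<bar>)" if "(i, l) \<in> A" for i l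
        using that member_le_sum[of i "{..<m}" "\<lambda>i. \<bar>L (q i)\<bar>"] by (auto simp: A_def)
      have \<tau>: "F (q i) \<in> {0..1}" for i using F_bounds by simp
      have Aex: "(\<exists>(i, l)\<in>A. s < f i * l) \<longleftrightarrow> (\<exists>i<m. s < f i * L (q i))" for s f by (auto simp: A_def)
      note conv = U.sup_form_convergence[OF bridge, of "\<lambda>i. F (q i)", OF \<tau> A0 A1 d e3, unfolded Aex]
      have "eventually (\<lambda>n. N.prob (V m) \<le> M.prob {\<omega> \<in> space M. \<exists>i<m. t < U.empirical_process n (F (q i)) \<omega> * L (q i)} + e / 3) sequentially"
        unfolding V_def by (rule conv(3))
      then show ?thesis
        using eventually_ge_at_top[of n0]
      proof eventually_elim
        case (elim n)
        have n': "0 < n" using elim(2) n0(1) by simp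
        have "M.prob {\<omega> \<in> space M. \<exists>i<m. t < U.empirical_process n (F (q i)) \<omega> * L (q i)} \<le> M.prob {\<omega> \<in> space M. t < BJ n \<omega>} + e / 3"
        proof (rule imp[OF elim(2) conv(1)])
          fix \<omega> assume \<omega>: "\<omega> \<in> {\<omega> \<in> space M. \<exists>i<m. t < U.empirical_process n (F (q i)) \<omega> * L (q i)}" "regular \<omega>" "bdd_above (range (stat n \<omega>))"
          then obtain i where i: "t < Z n \<omega> (q i)" unfolding Z_def by blast
          have "K (q i) = sup_fun KFG" using q(2)[of i] D(2) by (auto simp: S_def max_set_def KFG_ereal)
          then have "t < sqrt n * (stat n \<omega> (q i) - sup_fun KFG)"
            using stat_expansion[OF \<omega>(2) n', of "q i" "sup_fun KFG"] remainder_nonneg[OF \<omega>(2) n', of "q i"] i by simp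
          also have "\<dots> \<le> BJ n \<omega>" by (rule BJ_lower[OF \<omega>(2) n' \<omega>(3)])
          finally show "t < BJ n \<omega>" .
        qed
        moreover have "N.prob {\<omega> \<in> space N. \<exists>r\<in>D. t + d < B (F r) \<omega> * L r} - e / 3 < N.prob (V m)" by (rule m0) (simp add: m_def)
        ultimately show ?case using elim(1) le by linarith
      qed
    qed
  qed
qed

text \<open>Along \<open>1 / Suc k\<close> the suprema over the level sets converge to the limit for
  every path, so the probability that they exceed it by \<open>a\<close> tends to 0.\<close>

lemma level_set_limit:
  assumes a: "0 < a" and e: "0 < e"
  obtains k :: nat where "{\<omega> \<in> space N. t + a < (SUP x\<in>{x. sup_fun KFG - 1 / Suc k \<le> KFG x}. W \<omega> x)} \<in> sets N"
    "N.prob {\<omega> \<in> space N. t + a < (SUP x\<in>{x. sup_fun KFG - 1 / Suc k \<le> KFG x}. W \<omega> x)} \<le> N.prob {\<omega> \<in> space N. t < limit \<omega>} + e"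
proof -
  note [measurable] = limit_measurable
  define h where "h k \<omega> = (SUP x\<in>{x. sup_fun KFG - 1 / Suc k \<le> KFG x}. W \<omega> x)" for k \<omega>
  have [measurable]: "h k \<in> borel_measurable N" for k unfolding h_def by (rule level_sup_measurable)
  define A where "A k = {\<omega> \<in> space N. t + a < h k \<omega> \<and> limit \<omega> \<le> t}" for k
  have Am[measurable]: "A k \<in> sets N" for k unfolding A_def by measurable
  have "(\<lambda>k. \<integral>\<omega>. indicator (A k) \<omega> \<partial>N) \<longlonglongrightarrow> (\<integral>\<omega>. (0::real) \<partial>N)"
  proof (rule integral_dominated_convergence[where w="\<lambda>_. 1"])
    show "AE \<omega> in N. (\<lambda>k. indicator (A k) \<omega> :: real) \<longlonglongrightarrow> 0"
    proof (rule AE_I2)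
      fix \<omega>
      have lim: "(\<lambda>k. h k \<omega>) \<longlonglongrightarrow> limit \<omega>" unfolding h_def by (rule sup_fun_deriv_LIMSEQ[OF KFG_continuous])
      have "eventually (\<lambda>k. h k \<omega> < limit \<omega> + a) sequentially" using a by (intro order_tendstoD(2)[OF lim]) simp
      then have "eventually (\<lambda>k. indicator (A k) \<omega> = (0::real)) sequentially"
        by eventually_elim (auto simp: A_def indicator_def)
      then show "(\<lambda>k. indicator (A k) \<omega> :: real) \<longlonglongrightarrow> 0" by (rule tendsto_eventually)
    qed
  qed auto
  then have "(\<lambda>k. N.prob (A k)) \<longlonglongrightarrow> 0" by simp
  from order_tendstoD(2)[OF this e] obtain k where k: "N.prob (A k) < e" unfolding eventually_sequentially by blast
  have "N.prob {\<omega> \<in> space N. t + a < h k \<omega>} \<le> N.prob ({\<omega> \<in> space N. t < limit \<omega>} \<union> A k)"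
    by (rule N.finite_measure_mono) (auto simp: A_def)
  also have "\<dots> \<le> N.prob {\<omega> \<in> space N. t < limit \<omega>} + N.prob (A k)" by (intro measure_Un_le) auto
  finally have "N.prob {\<omega> \<in> space N. t + a < h k \<omega>} \<le> N.prob {\<omega> \<in> space N. t < limit \<omega>} + e" using k by simp
  moreover have "{\<omega> \<in> space N. t + a < h k \<omega>} \<in> sets N" by measurable
  ultimately show ?thesis using that[of k] unfolding h_def by blast
qed

lemma bridge_tail_event:
  assumes a: "0 < a" and e: "0 < e"
  shows "\<exists>k0. \<forall>k\<ge>k0. \<exists>E\<in>sets N. N.prob E \<le> e \<and>
    (\<forall>\<omega>\<in>space N - E. \<forall>x. F x \<le> 1 / 2^k \<or> 1 - F x \<le> 1 / 2^k \<longrightarrow> \<bar>B (F x) \<omega> * L x\<bar> \<le> a)"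
proof -
  obtain w where w: "\<And>k. 0 < w k" "summable (\<lambda>k. (w k)\<^sup>2 / 2^k)"
    "\<And>k x. 2 \<le> k \<Longrightarrow> 1 / 2^(k+1) < F x \<Longrightarrow> F x \<le> 1 / 2^k \<Longrightarrow> \<bar>L x\<bar> \<le> w k"
    "\<And>k x. 2 \<le> k \<Longrightarrow> 1 / 2^(k+1) < 1 - F x \<Longrightarrow> 1 - F x \<le> 1 / 2^k \<Longrightarrow> \<bar>L x\<bar> \<le> w k"
    using L_dyadic_weights by blast
  obtain k0 E where E: "E \<in> sets N" "N.prob E \<le> e" "\<And>\<omega> k t. \<omega> \<in> space N - E \<Longrightarrow> k0 \<le> k \<Longrightarrow> t \<in> {0..1/2^k} \<Longrightarrow>
    \<bar>B t \<omega>\<bar> * w k \<le> a \<and> \<bar>B (1 - t) \<omega>\<bar> * w k \<le> a"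
    using U.bridge_weighted_tail_prob[OF bridge w(1,2) a e] by blast
  have "\<bar>B (F x) \<omega> * L x\<bar> \<le> a" if k: "max 2 k0 \<le> k" and \<omega>: "\<omega> \<in> space N - E"
    and x: "F x \<le> 1 / 2^k \<or> 1 - F x \<le> 1 / 2^k" for k \<omega> x
    by (rule weighted_tail_at[where w=w and K=k and b="\<lambda>t. B t \<omega>", OF w(3,4) _ _ x]) (use E(3)[OF \<omega>] k a in auto)
  then have "\<forall>k\<ge>max 2 k0. \<exists>E\<in>sets N. N.prob E \<le> e \<and>
    (\<forall>\<omega>\<in>space N - E. \<forall>x. F x \<le> 1 / 2^k \<or> 1 - F x \<le> 1 / 2^k \<longrightarrow> \<bar>B (F x) \<omega> * L x\<bar> \<le> a)"
    using E(1,2) by blast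
  then show ?thesis by blast
qed

text \<open>Off the level set of \<open>\<epsilon>\<close> the drift is below
  \<open>- sqrt n \<epsilon>\<close> and outweighs the process; on it the drift is at most 0. The
  level drops from \<open>t + 8 a\<close> to \<open>t + 6 a\<close> by discretisation and remainder,
  to \<open>t + 5 a\<close> by convergence, and discretisation of the bridge leaves it above
  \<open>t + a\<close>. The probability \<open>8 b\<close> is spent on four events of the sample,
  the convergence, two events of the bridge and the level set.\<close>

lemma upper_tail_limsup:
  assumes d: "0 < d" and e: "0 < e"
  shows "eventually (\<lambda>n. M.prob {\<omega> \<in> space M. t + d < BJ n \<omega>} \<le> N.prob {\<omega> \<in> space N. t < limit \<omega>} + e) sequentially"
proof -
  note [measurable] = limit_measurable
  define a where "a = d / 8"
  define b where "b = e / 8"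
  have "d = 8 * a" by (simp add: a_def)
  have a: "0 < a" and b: "0 < b" using d e by (simp_all add: a_def b_def)
  obtain k where lev: "{\<omega> \<in> space N. t + a < (SUP x\<in>{x. sup_fun KFG - 1 / Suc k \<le> KFG x}. W \<omega> x)} \<in> sets N"
    "N.prob {\<omega> \<in> space N. t + a < (SUP x\<in>{x. sup_fun KFG - 1 / Suc k \<le> KFG x}. W \<omega> x)} \<le> N.prob {\<omega> \<in> space N. t < limit \<omega>} + b"
    using level_set_limit[OF a b, of t] by blast
  define \<epsilon> where "\<epsilon> = 1 / real (Suc k)"
  have \<epsilon>: "0 < \<epsilon>" by (simp add: \<epsilon>_def)
  define h where "h \<omega> = (SUP x\<in>{x. sup_fun KFG - \<epsilon> \<le> KFG x}. W \<omega> x)" for \<omega>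
  note lev' = lev[folded \<epsilon>_def, folded h_def]
  obtain k1 n1 :: nat where k1: "2 \<le> k1" "0 < n1" "\<And>n. n1 \<le> n \<Longrightarrow> \<exists>E\<in>M.events. M.prob E \<le> b \<and> (\<forall>\<omega>\<in>space M - E.
    (\<forall>x. F x \<le> 1 / 2^k1 \<or> 1 - F x \<le> 1 / 2^k1 \<longrightarrow> \<bar>Z n \<omega> x\<bar> \<le> a) \<and> (\<forall>x. remainder n \<omega> x \<le> a))"
    using tail_event[OF a b] by blast
  obtain k2 :: nat where k2: "\<And>k. k2 \<le> k \<Longrightarrow> \<exists>E\<in>sets N. N.prob E \<le> b \<and>
    (\<forall>\<omega>\<in>space N - E. \<forall>x. F x \<le> 1 / 2^k \<or> 1 - F x \<le> 1 / 2^k \<longrightarrow> \<bar>B (F x) \<omega> * L x\<bar> \<le> a)"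
    using bridge_tail_event[OF a b] by blast
  define K0 where "K0 = max k1 k2"
  have K01: "1 / (2::real)^K0 \<le> 1 / 2^k1" by (intro divide_left_mono power_increasing) (auto simp: K0_def)
  obtain F1 where F1: "F1 \<in> sets N" "N.prob F1 \<le> b"
    "\<And>\<omega> x. \<omega> \<in> space N - F1 \<Longrightarrow> F x \<le> 1 / 2^K0 \<or> 1 - F x \<le> 1 / 2^K0 \<Longrightarrow> \<bar>B (F x) \<omega> * L x\<bar> \<le> a"
    using k2[of K0] by (auto simp: K0_def)
  have K02: "2 \<le> K0" using k1(1) by (simp add: K0_def)
  define center where "center x \<longleftrightarrow> 1 / 2^K0 < F x \<and> 1 / 2^K0 < 1 - F x" for x
  obtain c where c: "0 \<le> c" "\<And>x. center x \<Longrightarrow> \<bar>L x\<bar> \<le> c"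
  proof (rule tail_or_center[OF K02], goal_cases)
    case (1 c)
    show ?case by (rule 1(1)[OF 1(2)]) (auto simp: center_def intro: 1(3))
  qed
  define a' where "a' = a / (c + 1)"
  have a'0: "0 < a'" using a c(1) by (simp add: a'_def)
  have "a' * c \<le> a' * (c + 1)" using a'0 by (intro mult_left_mono) auto
  also have "\<dots> = a" using c(1) by (simp add: a'_def)
  finally have a': "0 < a'" "a' * c \<le> a" using a'0 by auto
  obtain m1 where m1: "\<forall>m::nat\<ge>m1. \<forall>n::nat\<ge>m. \<exists>E\<in>M.events. M.prob E \<le> b \<and> (\<forall>\<omega>\<in>space M - E. \<forall>j<m. \<forall>s\<in>{0..1/m}.
    \<bar>U.empirical_process n (j / m + s) \<omega> - U.empirical_process n (j / m) \<omega>\<bar> \<le> a')"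
    using U.equicontinuity[OF a'(1) b] by (rule exE)
  obtain m2 where m2: "\<forall>m::nat\<ge>m2. \<exists>E\<in>sets N. N.prob E \<le> b \<and> (\<forall>\<omega>\<in>space N - E. \<forall>j<m. \<forall>s\<in>{0..1/m}.
    \<bar>B (j / m + s) \<omega> - B (j / m) \<omega>\<bar> \<le> a')"
    using bridge_equicontinuity[OF bridge a'(1) b] by (rule exE)
  define m where "m = max 1 (max m1 m2)"
  have m: "0 < m" "m1 \<le> m" "m2 \<le> m" by (auto simp: m_def)
  obtain F2 where F2: "F2 \<in> sets N" "N.prob F2 \<le> b"
    "\<And>\<omega> j s. \<omega> \<in> space N - F2 \<Longrightarrow> j < m \<Longrightarrow> s \<in> {0..1/m} \<Longrightarrow> \<bar>B (j / m + s) \<omega> - B (j / m) \<omega>\<bar> \<le> a'"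
    using m2[rule_format, OF m(3)] by blast
  \<comment> \<open>In the centre \<open>j x / m\<close> is the grid point just below
    \<open>F x\<close>. Elsewhere the weight \<open>l x\<close> is 0, so the process is replaced by
    0, at a cost controlled by the tail events.\<close>
  define j where "j x = (if center x then nat \<lfloor>F x * m\<rfloor> else 0)" for x
  define l where "l x = (if center x then L x else 0)" for x
  have cell: "j x < m" "F x - j x / m \<in> {0..1/m}" if "center x" for x
  proof -
    have "0 < 1 / (2::real)^K0" by simp
    then have Fx: "0 < F x" "F x < 1" using that unfolding center_def by linarith+
    have p: "0 \<le> F x * m" using Fx by simp
    have "real (j x) = of_int \<lfloor>F x * m\<rfloor>" using that p by (simp add: j_def of_nat_nat)
    then have r: "real (j x) \<le> F x * m" "F x * m < real (j x) + 1" by linarith+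
    have "F x * m < 1 * real m" using Fx m(1) by (intro mult_strict_right_mono) auto
    then have "real (j x) < real m" using r(1) by linarith
    then show "j x < m" by simp
    have "real (j x) / m \<le> F x" using r(1) m(1) by (simp add: divide_le_eq)
    moreover have "F x \<le> (real (j x) + 1) / m" using r(2) m(1) by (simp add: le_divide_eq)
    ultimately show "F x - j x / m \<in> {0..1/m}" by (simp add: add_divide_distrib)
  qed
  \<comment> \<open>A deterministic statement about one path \<open>\<beta>\<close>, used below for
    the bridge and for the empirical process.\<close>
  have approx: "\<bar>\<beta> (F x) * L x - \<beta> (j x / m) * l x\<bar> \<le> a"
    if tail: "\<And>x. F x \<le> 1 / 2^K0 \<or> 1 - F x \<le> 1 / 2^K0 \<Longrightarrow> \<bar>\<beta> (F x) * L x\<bar> \<le> a"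
      and osc: "\<And>j s. j < m \<Longrightarrow> s \<in> {0..1/m} \<Longrightarrow> \<bar>\<beta> (j / m + s) - \<beta> (j / m)\<bar> \<le> a'" for \<beta> :: "real \<Rightarrow> real" and x
  proof (cases "center x")
    case True
    have "\<bar>\<beta> (j x / m + (F x - j x / m)) - \<beta> (j x / m)\<bar> \<le> a'" by (rule osc[OF cell[OF True]])
    then have "\<bar>\<beta> (F x) - \<beta> (j x / m)\<bar> * \<bar>L x\<bar> \<le> a' * c" using c(2)[OF True] a'(1) by (intro mult_mono) auto
    also have "\<dots> \<le> a" by (rule a'(2))
    finally show ?thesis using True by (simp add: l_def abs_mult[symmetric] left_diff_distrib)
  next
    case False
    then have "\<bar>\<beta> (F x) * L x\<bar> \<le> a" by (intro tail) (auto simp: center_def not_less)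
    then show ?thesis using False by (simp add: l_def)
  qed
  define A where "A = (\<lambda>x. (j x, l x)) ` {x. sup_fun KFG - \<epsilon> \<le> K x}"
  have "\<exists>x. sup_fun KFG - \<epsilon> \<le> K x"
  proof (rule ccontr)
    assume "\<nexists>x. sup_fun KFG - \<epsilon> \<le> K x"
    then have "K x \<le> sup_fun KFG - \<epsilon>" for x by (meson linear)
    then have "berk_jones F G \<le> sup_fun KFG - \<epsilon>" unfolding berk_jones_def by (intro cSUP_least) simp_all
    then show False using \<epsilon> unfolding sup_KFG(1)[symmetric] by simp
  qed
  then have A0: "A \<noteq> {}" by (auto simp: A_def)
  have A1: "i < m \<and> \<bar>y\<bar> \<le> c" if "(i, y) \<in> A" for i y
    using that cell(1) c m(1) by (auto simp: A_def l_def j_def)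
  have Aex: "(\<exists>(i, y)\<in>A. s < f i * y) \<longleftrightarrow> (\<exists>x. sup_fun KFG - \<epsilon> \<le> K x \<and> s < f (j x) * l x)" for s f by (auto simp: A_def)
  \<comment> \<open>The minimum keeps every \<open>\<tau> i\<close> in the unit interval; for the
    indices that occur it is \<open>i / m\<close>.\<close>
  define \<tau> where "\<tau> i = min 1 (real i / m)" for i
  have \<tau>: "\<tau> i \<in> {0..1}" for i by (simp add: \<tau>_def)
  have \<tau>j: "\<tau> (j x) = j x / m" for x
    using cell(1)[of x] m(1) by (cases "center x") (auto simp: \<tau>_def j_def)
  note conv = U.sup_form_convergence[OF bridge, of \<tau>, OF \<tau> A0 A1 a b, unfolded Aex \<tau>j]
  have "N.prob {\<omega> \<in> space N. \<exists>x. sup_fun KFG - \<epsilon> \<le> K x \<and> t + 5 * a < B (j x / m) \<omega> * l x}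
      \<le> N.prob ({\<omega> \<in> space N. t + a < h \<omega>} \<union> (F1 \<union> F2))"
  proof (rule N.finite_measure_mono_AE)
    show "AE \<omega> in N. \<omega> \<in> {\<omega> \<in> space N. \<exists>x. sup_fun KFG - \<epsilon> \<le> K x \<and> t + 5 * a < B (j x / m) \<omega> * l x} \<longrightarrow>
      \<omega> \<in> {\<omega> \<in> space N. t + a < h \<omega>} \<union> (F1 \<union> F2)"
      using AE_vanishing
    proof eventually_elim
      case (elim \<omega>)
      show ?case
      proof (intro impI, rule ccontr)
        assume "\<omega> \<in> {\<omega> \<in> space N. \<exists>x. sup_fun KFG - \<epsilon> \<le> K x \<and> t + 5 * a < B (j x / m) \<omega> * l x}"
        then obtain x where x: "\<omega> \<in> space N" "sup_fun KFG - \<epsilon> \<le> K x" "t + 5 * a < B (j x / m) \<omega> * l x" by blast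
        assume n: "\<omega> \<notin> {\<omega> \<in> space N. t + a < h \<omega>} \<union> (F1 \<union> F2)"
        have "\<bar>B (F x) \<omega> * L x - B (j x / m) \<omega> * l x\<bar> \<le> a"
          by (rule approx) (use F1(3)[of \<omega>] F2(3)[of \<omega>] n x(1) in auto)
        then have "t + a < W \<omega> (ereal x)" using x(3) a by (simp add: W_ereal abs_le_iff)
        also have "W \<omega> (ereal x) \<le> h \<omega>"
          unfolding h_def
        proof (rule cSUP_upper)
          show "bdd_above (W \<omega> ` {x. sup_fun KFG - \<epsilon> \<le> KFG x})"
            by (rule bdd_above_mono[OF sup_fun_continuous(1)[OF path_continuous(1)[OF x(1) elim]] image_mono]) simp
        qed (simp add: KFG_ereal x(2))
        finally show False using n x(1) by blast
      qed
    qed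
    show "{\<omega> \<in> space N. t + a < h \<omega>} \<union> (F1 \<union> F2) \<in> sets N" by (intro sets.Un lev'(1) F1(1) F2(1))
  qed
  also have "\<dots> \<le> N.prob {\<omega> \<in> space N. t + a < h \<omega>} + (N.prob F1 + N.prob F2)"
    using measure_Un_le[OF lev'(1) sets.Un[OF F1(1) F2(1)]] measure_Un_le[OF F1(1) F2(1)] by linarith
  finally have limit_side: "N.prob {\<omega> \<in> space N. \<exists>x. sup_fun KFG - \<epsilon> \<le> K x \<and> t + 5 * a < B (j x / m) \<omega> * l x}
      \<le> N.prob {\<omega> \<in> space N. t < limit \<omega>} + 3 * b"
    using lev'(2) F1(2) F2(2) by linarith
  have ev1: "eventually (\<lambda>n. M.prob {\<omega> \<in> space M. \<exists>x. sup_fun KFG - \<epsilon> \<le> K x \<and> t + 5 * a + a < U.empirical_process n (j x / m) \<omega> * l x}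
      \<le> N.prob {\<omega> \<in> space N. \<exists>x. sup_fun KFG - \<epsilon> \<le> K x \<and> t + 5 * a < B (j x / m) \<omega> * l x} + b) sequentially"
    by (rule conv(4))
  \<comment> \<open>While the empirical process stays below \<open>r n\<close>, the discretised
    weighted process is at most \<open>sqrt n * \<epsilon> / 2\<close>, half of the drift off the
    level set. Since \<open>r n\<close> grows like \<open>sqrt n\<close>, exceeding it becomes
    improbable.\<close>
  define r where "r n = sqrt (real n) * \<epsilon> / (2 * (c + 1))" for n :: nat
  have c1: "0 < c + 1" using c(1) by simp
  have "filterlim (\<lambda>n::nat. sqrt (real n) * \<epsilon> / 2) at_top sequentially" using \<epsilon> by real_asymp
  then have ev2: "eventually (\<lambda>n::nat. 2 * a - t - d < sqrt (real n) * \<epsilon> / 2) sequentially" unfolding filterlim_at_top_dense by blast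
  have "(\<lambda>n. 8 * (1 / 2) / (r n)^2) \<longlonglongrightarrow> 0" unfolding r_def using \<epsilon> c1 by real_asymp
  then have ev3: "eventually (\<lambda>n. 8 * (1 / 2) / (r n)^2 < b) sequentially" using b by (rule order_tendstoD)
  show ?thesis
    using ev1 ev2 ev3 eventually_ge_at_top[of "max m n1"]
  proof eventually_elim
    case (elim n)
    have n: "m \<le> n" "n1 \<le> n" "0 < n" using elim(4) m(1) by auto
    have rn: "0 < r n" using \<epsilon> c1 n(3) by (simp add: r_def)
    obtain E1 where E1: "E1 \<in> M.events" "M.prob E1 \<le> b"
      "\<And>\<omega> x. \<omega> \<in> space M - E1 \<Longrightarrow> F x \<le> 1 / 2^k1 \<or> 1 - F x \<le> 1 / 2^k1 \<Longrightarrow> \<bar>Z n \<omega> x\<bar> \<le> a"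
      "\<And>\<omega> x. \<omega> \<in> space M - E1 \<Longrightarrow> remainder n \<omega> x \<le> a"
      using k1(3)[OF n(2)] by blast
    obtain E2 where E2: "E2 \<in> M.events" "M.prob E2 \<le> b"
      "\<And>\<omega> j s. \<omega> \<in> space M - E2 \<Longrightarrow> j < m \<Longrightarrow> s \<in> {0..1/m} \<Longrightarrow>
        \<bar>U.empirical_process n (j / m + s) \<omega> - U.empirical_process n (j / m) \<omega>\<bar> \<le> a'"
      using m1[rule_format, OF m(2) n(1)] by blast
    \<comment> \<open>The two one-sided maximal inequalities on \<open>[0, 1/2]\<close> together
      bound the process on the whole unit interval.\<close>
    have half: "(0::real) < 1/2" "(1/2::real) \<le> 1/2" by auto
    obtain E3 where E3: "E3 \<in> M.events" "M.prob E3 \<le> 8 * (1/2) / (r n)^2"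
      "\<And>\<omega> s. \<omega> \<in> space M - E3 \<Longrightarrow> s \<in> {0..1/2} \<Longrightarrow> \<bar>U.empirical_process n s \<omega>\<bar> \<le> r n"
      using U.maximal_low[OF half rn n(3)] by blast
    obtain E4 where E4: "E4 \<in> M.events" "M.prob E4 \<le> 8 * (1/2) / (r n)^2"
      "\<And>\<omega> s. \<omega> \<in> space M - E4 \<Longrightarrow> s \<in> {0..1/2} \<Longrightarrow> \<bar>U.empirical_process n (1 - s) \<omega>\<bar> \<le> r n"
      using U.maximal_high[OF half rn n(3)] by blast
    define V where "V = {\<omega> \<in> space M. \<exists>x. sup_fun KFG - \<epsilon> \<le> K x \<and> t + 5 * a + a < U.empirical_process n (j x / m) \<omega> * l x}"
    have Vm: "V \<in> M.events" unfolding V_def by (rule conv(1))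
    have "M.prob {\<omega> \<in> space M. t + d < BJ n \<omega>} \<le> M.prob (V \<union> ((E1 \<union> E2) \<union> (E3 \<union> E4)))"
    proof (rule M.finite_measure_mono_AE)
      show "AE \<omega> in M. \<omega> \<in> {\<omega> \<in> space M. t + d < BJ n \<omega>} \<longrightarrow> \<omega> \<in> V \<union> ((E1 \<union> E2) \<union> (E3 \<union> E4))"
        using AE_regular
      proof eventually_elim
        case (elim \<omega>)
        show ?case
        proof (intro impI, rule ccontr)
          assume "\<omega> \<in> {\<omega> \<in> space M. t + d < BJ n \<omega>}"
          then have \<omega>: "\<omega> \<in> space M" "t + d < BJ n \<omega>" by auto
          assume bad: "\<omega> \<notin> V \<union> ((E1 \<union> E2) \<union> (E3 \<union> E4))"
          then have nE: "\<omega> \<in> space M - E1" "\<omega> \<in> space M - E2" "\<omega> \<in> space M - E3" "\<omega> \<in> space M - E4" "\<omega> \<notin> V" using \<omega>(1) by auto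
          obtain x where x: "t + d < sqrt n * (K x - sup_fun KFG) + Z n \<omega> x + remainder n \<omega> x"
            using BJ_greater_imp[OF elim n(3) \<omega>(2)] by blast
          have appr: "\<bar>Z n \<omega> x - U.empirical_process n (j x / m) \<omega> * l x\<bar> \<le> a"
            unfolding Z_def
          proof (rule approx)
            show "\<bar>U.empirical_process n (F x) \<omega> * L x\<bar> \<le> a" if "F x \<le> 1 / 2^K0 \<or> 1 - F x \<le> 1 / 2^K0" for x
              using E1(3)[OF nE(1), of x] that K01 unfolding Z_def by linarith
          qed (rule E2(3)[OF nE(2)])
          have jx: "j x / m \<in> {0..1}" using \<tau>[of "j x"] by (simp only: \<tau>j)
          have "\<bar>U.empirical_process n (j x / m) \<omega>\<bar> \<le> r n"
            using E3(3)[OF nE(3), of "j x / m"] E4(3)[OF nE(4), of "1 - j x / m"] jx by (cases "j x / m \<le> 1/2") auto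
          moreover have "\<bar>l x\<bar> \<le> c" using c(1) c(2)[of x] by (simp add: l_def)
          then have "\<bar>l x\<bar> \<le> c + 1" by simp
          ultimately have "\<bar>U.empirical_process n (j x / m) \<omega> * l x\<bar> \<le> r n * (c + 1)"
            unfolding abs_mult using rn by (intro mult_mono) auto
          also have "r n * (c + 1) = sqrt n * \<epsilon> / 2"
          proof -
            have "y / (2 * z) * z = y / 2" if "0 < z" for y z :: real using that by simp
            then show ?thesis unfolding r_def using c1 by blast
          qed
          finally have big: "\<bar>U.empirical_process n (j x / m) \<omega> * l x\<bar> \<le> sqrt n * \<epsilon> / 2" .
          have rem: "remainder n \<omega> x \<le> a" by (rule E1(4)[OF nE(1)])
          have "sup_fun KFG - \<epsilon> \<le> K x"
          proof (rule ccontr)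
            assume "\<not> sup_fun KFG - \<epsilon> \<le> K x"
            then have "sqrt n * (K x - sup_fun KFG) \<le> sqrt n * (- \<epsilon>)" by (intro mult_left_mono) auto
            then have "sqrt n * (K x - sup_fun KFG) \<le> - (sqrt n * \<epsilon>)" by simp
            then show False using x appr big rem \<open>2 * a - t - d < sqrt (real n) * \<epsilon> / 2\<close> by linarith
          qed
          moreover have "sqrt n * (K x - sup_fun KFG) \<le> 0" using sup_KFG(2)[of x] by (intro mult_nonneg_nonpos) auto
          then have "t + 5 * a + a < U.empirical_process n (j x / m) \<omega> * l x"
            using x appr rem \<open>d = 8 * a\<close> by linarith
          ultimately show False using nE(5) \<omega>(1) unfolding V_def by blast
        qed
      qed
      show "V \<union> ((E1 \<union> E2) \<union> (E3 \<union> E4)) \<in> M.events" by (intro sets.Un Vm E1(1) E2(1) E3(1) E4(1))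
    qed
    also have "\<dots> \<le> M.prob V + ((M.prob E1 + M.prob E2) + (M.prob E3 + M.prob E4))"
    proof -
      note E12 = sets.Un[OF E1(1) E2(1)] and E34 = sets.Un[OF E3(1) E4(1)]
      show ?thesis
        using measure_Un_le[OF Vm sets.Un[OF E12 E34]] measure_Un_le[OF E12 E34]
          measure_Un_le[OF E1(1) E2(1)] measure_Un_le[OF E3(1) E4(1)] by linarith
    qed
    finally have "M.prob {\<omega> \<in> space M. t + d < BJ n \<omega>} \<le> M.prob V + 4 * b"
      using E1(2) E2(2) E3(2) E4(2) elim(3) by linarith
    then show ?case using elim(1) limit_side unfolding V_def b_def by linarith
  qed
qed

text \<open>At a continuity point of the limit distribution function the shift of the level is
  harmless: the two tail comparisons enclose the distribution function of \<open>BJ n\<close> at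
  \<open>x\<close> between limit values at \<open>x - \<delta> / 2\<close> and
  \<open>x + \<delta> / 2\<close>.\<close>

lemma weak_convergence:
  "weak_conv_m (\<lambda>n. distr M borel (BJ n)) (distr N borel limit)"
  unfolding weak_conv_m_def weak_conv_def
proof (intro allI impI)
  note [measurable] = limit_measurable
  fix x assume c: "isCont (cdf (distr N borel limit)) x"
  have cM: "cdf (distr M borel (BJ n)) s = 1 - M.prob {\<omega> \<in> space M. s < BJ n \<omega>}" for n s
    using M.prob_neg[of "\<lambda>\<omega>. s < BJ n \<omega>"]
    by (simp add: cdf_def measure_distr vimage_def Int_def not_less conj_commute)
  have cN: "cdf (distr N borel limit) s = 1 - N.prob {\<omega> \<in> space N. s < limit \<omega>}" for s
    using N.prob_neg[of "\<lambda>\<omega>. s < limit \<omega>"]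
    by (simp add: cdf_def measure_distr vimage_def Int_def not_less conj_commute)
  show "(\<lambda>n. cdf (distr M borel (BJ n)) x) \<longlonglongrightarrow> cdf (distr N borel limit) x"
  proof (rule tendstoI)
    fix e :: real assume e: "0 < e"
    then have e2: "0 < e / 2" by simp
    obtain \<delta> where \<delta>: "0 < \<delta>" "\<And>y. \<bar>y - x\<bar> < \<delta> \<Longrightarrow> \<bar>cdf (distr N borel limit) y - cdf (distr N borel limit) x\<bar> < e / 2"
      using c e2 unfolding continuous_at_eps_delta dist_real_def by blast
    have d: "0 < \<delta> / 2" using \<delta>(1) by simp
    have n1: "\<bar>cdf (distr N borel limit) (x + \<delta> / 2) - cdf (distr N borel limit) x\<bar> < e / 2" using \<delta> by simp
    have n2: "\<bar>cdf (distr N borel limit) (x - \<delta> / 2) - cdf (distr N borel limit) x\<bar> < e / 2" using \<delta> by simp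
    show "eventually (\<lambda>n. dist (cdf (distr M borel (BJ n)) x) (cdf (distr N borel limit) x) < e) sequentially"
      using upper_tail_liminf[OF d e2, of x] upper_tail_limsup[OF d e2, of "x - \<delta> / 2"]
    proof eventually_elim
      case (elim n)
      have "cdf (distr M borel (BJ n)) x \<le> cdf (distr N borel limit) (x + \<delta> / 2) + e / 2"
        using elim(1) unfolding cM cN by simp
      moreover have "cdf (distr N borel limit) (x - \<delta> / 2) - e / 2 \<le> cdf (distr M borel (BJ n)) x"
        using elim(2) unfolding cM cN by simp
      ultimately show ?case using n1 n2 unfolding dist_real_def by linarith
    qed
  qed
qed

end

theorem corollary5p1:
  fixes P Q :: "real measure" and F G :: "real \<Rightarrow> real"
    and M :: "'a measure" and X :: "nat \<Rightarrow> 'a \<Rightarrow> real"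
    and N :: "'b measure" and BF :: "real \<Rightarrow> 'b \<Rightarrow> real"
    and B :: "nat \<Rightarrow> 'a \<Rightarrow> real" and KFG :: "ereal \<Rightarrow> real" and W :: "'b \<Rightarrow> ereal \<Rightarrow> real"
  assumes "real_distribution P" and "F = cdf P" and "continuous_on UNIV F"
    and "real_distribution Q" and "G = cdf Q" and "continuous_on UNIV G"
    and "monotone_around_infinities (\<lambda>x. log_ratio (F x) (G x))"
    and "(\<integral>\<^sup>+ t. log_ratio_sq (F t) (G t) \<partial>P) < \<infinity>"
    and "prob_space M" and "prob_space.indep_vars M (\<lambda>_. borel) X UNIV"
    and "\<And>i. distr M borel (X i) = P"
    and "F_brownian_bridge N F BF"
    and "B = (\<lambda>n \<omega>. sqrt (real n) * (berk_jones (empirical_cdf X n \<omega>) G - berk_jones F G))"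
    and "KFG = extend (\<lambda>x. bern_KL (F x) (G x))"
    and "W = (\<lambda>\<omega>. extend (\<lambda>x. BF x \<omega> * log_ratio (F x) (G x)))"
  shows "(\<forall>n. B n \<in> borel_measurable M) \<and>
    (\<lambda>\<omega>. sup_fun_deriv KFG (W \<omega>)) \<in> borel_measurable N \<and>
    weak_conv_m (\<lambda>n. distr M borel (B n)) (distr N borel (\<lambda>\<omega>. sup_fun_deriv KFG (W \<omega>))) \<and>
    (AE \<omega> in N. sup_fun_deriv KFG (W \<omega>) = (SUP x\<in>max_set KFG. W \<omega> x))"
proof -
  \<comment> \<open>\<open>BF\<close> is tied to a standard bridge on \<open>space N\<close> only,
    so the conclusions are transferred by congruence on that space.\<close>
  obtain B' where B': "brownian_bridge N B'" "\<And>\<omega> x. \<omega> \<in> space N \<Longrightarrow> BF x \<omega> = B' (F x) \<omega>"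
    using assms(12) unfolding F_brownian_bridge_def by blast
  interpret L: berk_jones_limit P Q F G N B' M X
    by (intro berk_jones_limit.intro bridge_log_ratio.intro square_integrable_log_ratio.intro
        bridge_log_ratio_axioms.intro berk_jones_limit_axioms.intro assms(1-6,8-11) B'(1))
  have B: "B = L.BJ" unfolding assms(13) L.BJ_def L.sup_KFG(1) by (intro ext) simp
  have K: "KFG = L.KFG" unfolding assms(14) L.KFG_def ..
  have W: "W \<omega> = L.W \<omega>" if "\<omega> \<in> space N" for \<omega>
    unfolding assms(15) L.W_def using B'(2)[OF that] by simp
  have T: "sup_fun_deriv KFG (W \<omega>) = sup_fun_deriv L.KFG (L.W \<omega>)" if "\<omega> \<in> space N" for \<omega>
    using W[OF that] K by simp
  have "(\<lambda>\<omega>. sup_fun_deriv KFG (W \<omega>)) \<in> borel_measurable N"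
    using L.limit_measurable T by (simp cong: measurable_cong)
  moreover have "distr N borel (\<lambda>\<omega>. sup_fun_deriv KFG (W \<omega>)) = distr N borel (\<lambda>\<omega>. sup_fun_deriv L.KFG (L.W \<omega>))"
    by (rule distr_cong) (auto simp: T)
  moreover have "AE \<omega> in N. sup_fun_deriv KFG (W \<omega>) = (SUP x\<in>max_set KFG. W \<omega> x)"
    using L.AE_vanishing AE_space
  proof eventually_elim
    case (elim \<omega>)
    then show ?case using L.path_continuous(4)[OF elim(2,1)] W[OF elim(2)] K by simp
  qed
  ultimately show ?thesis using L.BJ_measurable L.weak_convergence unfolding B by simp
qed

end
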